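(* Fix $d\ge 2$. For $L\geq 1$ let $N=L^d$, let $q_N\in[0,1]$, $p_N=1-q_N$, and let $X_L=X_L^d(q_N)$ be bond percolation on the torus $T_L^d$ with retention probability $q_N$. All asymptotics are as $L\to\infty$. (a) Suppose $p_N\to0$, $q_N\to1$, and $p_N=N^{-\alpha+o(1)}$ for some $\alpha>0$. (i) If $\alpha\notin\{1/k:k\in\mathbb N\}$, then $(X_L)$ has a first-order zero--one law. (ii) If $\alpha=1/k$ with $k\in\mathbb N$ and $\lambda_N=Np_N^k\to0$ or $\lambda_N\to\infty$, then $(X_L)$ has a first-order zero--one law. (iii) If $\alpha=1/k$ with $k\in\mathbb N$ and $\lambda_N=Np_N^k\to\lambda\in(0,\infty)$, then $(X_L)$ has a first-order convergence law but not a zero--one law. (iv) If $\alpha=1/k$ with $k\in\mathbb N$ and $\lambda_N=Np_N^k$ has no limit in the extended interval $[0,\infty]$, then $(X_L)$ does not have a first-order convergence law. (b) Suppose instead $q_N\to0$, $p_N\to1$, and $q_N=N^{-\alpha+o(1)}$ for some $\alpha>0$. Then the same four alternatives hold with $p_N$ and $q_N$ interchanged: (i) if $\alpha\notin\{1/k:k\in\mathbb N\}$, then $(X_L)$ has a first-order zero--one law; (ii) if $\alpha=1/k$ with $k\in\mathbb N$ and $Nq_N^k\to0$ or $Nq_N^k\to\infty$, then $(X_L)$ has a first-order zero--one law; (iii) if $\alpha=1/k$ with $k\in\mathbb N$ and $Nq_N^k\to\lambda\in(0,\infty)$, then $(X_L)$ has a first-order convergence law but not a zero--one law; (iv) if $\alpha=1/k$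 with $k\in\mathbb N$ and $Nq_N^k$ has no limit in $[0,\infty]$, then $(X_L)$ does not have a first-order convergence law.
   Context: $T_L^d=(\mathbb Z/L\mathbb Z)^d$ is the (simple) graph in which two vertices are adjacent if they differ by $1$ or $-1$ modulo $L$ in exactly one coordinate and agree in all other coordinates; it has $N=L^d$ vertices. $X_L^d(q_N)$ is the random subgraph of $T_L^d$ on the full vertex set in which each edge is retained with probability $q_N$ and omitted with probability $p_N=1-q_N$, independently. $L$ ranges over all positive integers. $\mathbb N$ denotes the positive integers. The first-order language of graphs has one binary symbol $E$ (symmetric irreflexive adjacency). $(X_L)$ has a first-order convergence law if $\mathbb P(X_L\models\varphi)$ converges as $L\to\infty$ for every first-order sentence $\varphi$, and a first-order zero--one law if each of these limits exists and is $0$ or $1$. *)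

theory Defs
  imports
    "HOL-Probability.Probability"
    "HOL-Probability.Product_PMF"
    "HOL-Library.Landau_Symbols"
    "HOL-Number_Theory.Cong"
begin

section \<open>The first-order language of graphs\<close>

text \<open>A graph is a pair of a vertex set and a set of edges, each edge being an unordered pair
  of distinct vertices.\<close>

type_synonym 'a graph = "'a set \<times> 'a set set"

text \<open>Formulas have named variables, indexed by natural numbers. Equality is part of the logic;
  the other connectives and the universal quantifier are definable.\<close>

datatype fo_formula =
    FO_Eq nat nat
  | FO_Adj nat nat
  | FO_Not fo_formula
  | FO_And fo_formula fo_formula
  | FO_Ex nat fo_formula

primrec fo_free_vars :: "fo_formula \<Rightarrow> nat set" where
  "fo_free_vars (FO_Eq i j) = {i, j}"
| "fo_free_vars (FO_Adj i j) = {i, j}"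
| "fo_free_vars (FO_Not \<phi>) = fo_free_vars \<phi>"
| "fo_free_vars (FO_And \<phi> \<psi>) = fo_free_vars \<phi> \<union> fo_free_vars \<psi>"
| "fo_free_vars (FO_Ex i \<phi>) = fo_free_vars \<phi> - {i}"

definition fo_sentence :: "fo_formula \<Rightarrow> bool" where
  "fo_sentence \<phi> \<longleftrightarrow> fo_free_vars \<phi> = {}"

primrec fo_sat :: "'a graph \<Rightarrow> (nat \<Rightarrow> 'a) \<Rightarrow> fo_formula \<Rightarrow> bool" where
  "fo_sat G s (FO_Eq i j) \<longleftrightarrow> s i = s j"
| "fo_sat G s (FO_Adj i j) \<longleftrightarrow> {s i, s j} \<in> snd G"
| "fo_sat G s (FO_Not \<phi>) \<longleftrightarrow> \<not> fo_sat G s \<phi>"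
| "fo_sat G s (FO_And \<phi> \<psi>) \<longleftrightarrow> fo_sat G s \<phi> \<and> fo_sat G s \<psi>"
| "fo_sat G s (FO_Ex i \<phi>) \<longleftrightarrow> (\<exists>v\<in>fst G. fo_sat G (s(i := v)) \<phi>)"

text \<open>For a sentence and a nonempty vertex set the truth value does not depend on the valuation.\<close>

definition fo_models :: "'a graph \<Rightarrow> fo_formula \<Rightarrow> bool" where
  "fo_models G \<phi> \<longleftrightarrow> (\<forall>s. range s \<subseteq> fst G \<longrightarrow> fo_sat G s \<phi>)"

definition fo_prob :: "'a graph pmf \<Rightarrow> fo_formula \<Rightarrow> real" where
  "fo_prob X \<phi> = measure_pmf.prob X {G. fo_models G \<phi>}"

definition fo_convergence_law :: "(nat \<Rightarrow> 'a graph pmf) \<Rightarrow> bool" where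
  "fo_convergence_law X \<longleftrightarrow>
     (\<forall>\<phi>. fo_sentence \<phi> \<longrightarrow> convergent (\<lambda>L. fo_prob (X L) \<phi>))"

definition fo_zero_one_law :: "(nat \<Rightarrow> 'a graph pmf) \<Rightarrow> bool" where
  "fo_zero_one_law X \<longleftrightarrow>
     (\<forall>\<phi>. fo_sentence \<phi> \<longrightarrow> (\<exists>l\<in>{0, 1}. (\<lambda>L. fo_prob (X L) \<phi>) \<longlonglongrightarrow> l))"

section \<open>Bond percolation on the torus\<close>

text \<open>A vertex is a function on the coordinates below \<open>d\<close> (extended by \<open>undefined\<close>), whose values
  are the canonical representatives of the residue classes modulo \<open>L\<close>.\<close>

definition torus_vertices :: "nat \<Rightarrow> nat \<Rightarrow> (nat \<Rightarrow> nat) set" where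
  "torus_vertices d L = {..<d} \<rightarrow>\<^sub>E {..<L}"

text \<open>The condition \<open>x i \<noteq> y i\<close> matters only for \<open>L = 1\<close>, where it excludes loops.\<close>

definition torus_adj :: "nat \<Rightarrow> nat \<Rightarrow> (nat \<Rightarrow> nat) \<Rightarrow> (nat \<Rightarrow> nat) \<Rightarrow> bool" where
  "torus_adj d L x y \<longleftrightarrow>
     (\<exists>i<d. x i \<noteq> y i \<and> ([x i = y i + 1] (mod L) \<or> [y i = x i + 1] (mod L)) \<and>
            (\<forall>j<d. j \<noteq> i \<longrightarrow> x j = y j))"

definition torus_edges :: "nat \<Rightarrow> nat \<Rightarrow> (nat \<Rightarrow> nat) set set" where
  "torus_edges d L =
     {{x, y} | x y. x \<in> torus_vertices d L \<and> y \<in> torus_vertices d L \<and> torus_adj d L x y}"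

lemma card_torus_vertices: "card (torus_vertices d L) = L ^ d"
  by (simp add: torus_vertices_def card_PiE)

lemma finite_torus_edges: "finite (torus_edges d L)"
proof -
  have "torus_edges d L \<subseteq> Pow (torus_vertices d L)"
    by (auto simp: torus_edges_def)
  moreover have "finite (torus_vertices d L)"
    by (simp add: torus_vertices_def finite_PiE)
  ultimately show ?thesis
    by (meson finite_Pow_iff finite_subset)
qed

lemma card_torus_edge: "e \<in> torus_edges d L \<Longrightarrow> card e = 2"
  by (auto simp: torus_edges_def torus_adj_def card_2_iff)

definition torus_percolation :: "nat \<Rightarrow> nat \<Rightarrow> real \<Rightarrow> (nat \<Rightarrow> nat) graph pmf" where
  "torus_percolation d L q =
     map_pmf (\<lambda>\<omega>. (torus_vertices d L, {e \<in> torus_edges d L. \<omega> e}))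
       (Pi_pmf (torus_edges d L) False (\<lambda>_. bernoulli_pmf q))"

section \<open>Polynomial decay up to an error in the exponent\<close>

text \<open>\<open>r\<^sub>N = N\<^bsup>-\<alpha>+o(1)\<^esup>\<close> along \<open>N = L\<^sup>d\<close> as \<open>L \<rightarrow> \<infinity>\<close>.\<close>

definition power_decay :: "nat \<Rightarrow> (nat \<Rightarrow> real) \<Rightarrow> real \<Rightarrow> bool" where
  "power_decay d r \<alpha> \<longleftrightarrow>
     (\<exists>\<epsilon> :: nat \<Rightarrow> real. \<epsilon> \<in> o(\<lambda>_. 1) \<and>
        (\<forall>\<^sub>F L in sequentially. r (L ^ d) = real (L ^ d) powr (- \<alpha> + \<epsilon> L)))"

end

theory Submission
  imports Defs "HOL-Library.Function_Algebras"
begin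

text \<open>
  Both parts of the theorem are about sparse marks. Mark each edge of the torus with a small
  probability \<open>r\<close>, and let the graph consist of the marked edges (few edges are retained) or of the
  unmarked ones (few edges are deleted). With \<open>N = L ^ d\<close> vertices, the expected number of clusters of
  \<open>j\<close> marks of a given shape is about \<open>N * r ^ j\<close>, and this decides everything.

  The logical half is Hanf's theorem (\<open>hanf\<close>). The torus looks the same from every vertex, so all that
  can be seen near a vertex is the pattern of marked edges in a window around it. A sentence
  cannot distinguish two large tori in which every pattern up to some radius \<open>R\<close> occurs equally
  often, where all numbers from some threshold \<open>t\<close> on count as equal. The proof is an
  Ehrenfeucht-Fraisse game. Duplicator answers a move close to an earlier one by the same
  displacement, and a move far away from all earlier ones by any far vertex with the same pattern.

  The probabilistic half concerns the number of occurrences of a pattern with \<open>j\<close> marks. If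
  \<open>N * r ^ j\<close> tends to \<open>0\<close> then with probability tending to \<open>1\<close> the pattern does not occur. If it tends
  to infinity then, likewise, the pattern occurs at least \<open>t\<close> times. If it tends to a finite limit
  \<open>\<lambda> > 0\<close>, the number is asymptotically a Poisson variable. The last two statements come from
  one identity (\<open>stein\<close>). Finding a given cluster has probability \<open>r ^ j\<close>, and given that, the other
  marks are as random as before; so with a mean of \<open>\<mu>\<close> clusters,
  \<open>c * P (number = c) \<approx> \<mu> * P (number = c - 1)\<close>, the error being due to marks close to the
  cluster. If \<open>\<mu>\<close> tends to infinity, this forces each single value to become unlikely. If it tends to a
  finite limit, then together with Markov's inequality it determines the limiting distribution, also
  jointly for all translation classes of patterns with equally many marks.

  Suppose that \<open>N * r ^ (k - 1)\<close> tends to infinity and \<open>N * r ^ k\<close> to a finite limit \<open>l\<close>. Then patterns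
  with fewer than \<open>k\<close> marks are abundant, those with more are absent, and the truth of a sentence
  depends only on which clusters of \<open>k\<close> marks occur and how often. So its probability converges, and
  for \<open>l = 0\<close> to \<open>0\<close> or \<open>1\<close> (\<open>sentence_limit\<close>).

  Conversely, for each \<open>k\<close> there is a sentence that needs \<open>k\<close> marks close together
  (\<open>critical_sentence\<close>). Its probability tends to \<open>1 - exp (- c * l)\<close> for a constant \<open>c > 0\<close>. For
  \<open>0 < l < \<infinity>\<close> this is neither \<open>0\<close> nor \<open>1\<close>. It is injective in \<open>l\<close>, so along a sequence for which
  \<open>N * r ^ k\<close> has two different limit points the probability does not converge.
\<close>

section \<open>Marked edges seen from a vertex\<close>

text \<open>Vectors in \<open>\<int>\<^sup>d\<close> are modelled by the functions that vanish from \<open>d\<close> on.\<close>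

definition box :: "nat \<Rightarrow> nat \<Rightarrow> (nat \<Rightarrow> int) set" where
  "box d r = {u. (\<forall>i<d. \<bar>u i\<bar> \<le> int r) \<and> (\<forall>i\<ge>d. u i = 0)}"

definition unit :: "nat \<Rightarrow> nat \<Rightarrow> int" where
  "unit i = (\<lambda>j. if j = i then 1 else 0)"

text \<open>A slot \<open>(u, i)\<close> stands for the edge of \<open>\<int>\<^sup>d\<close> that joins \<open>u\<close> and \<open>u + unit i\<close>. This gives
  every edge exactly one name, and translations act on names.\<close>

type_synonym slot = "(nat \<Rightarrow> int) \<times> nat"

definition window :: "nat \<Rightarrow> nat \<Rightarrow> slot set" where
  "window d r = box d r \<times> {..<d}"

definition translate :: "(nat \<Rightarrow> int) \<Rightarrow> slot set \<Rightarrow> slot set" where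
  "translate v w = (\<lambda>(u, i). (u + v, i)) ` w"

lemma finite_box: "finite (box d r)"
proof -
  have "box d r \<subseteq> PiE_dflt {..<d} 0 (\<lambda>_. {- int r..int r})"
    by (force simp: box_def PiE_dflt_def)
  moreover have "finite (PiE_dflt {..<d} (0::int) (\<lambda>_. {- int r..int r}))"
    by (intro finite_PiE_dflt) auto
  ultimately show ?thesis by (rule finite_subset)
qed

lemma finite_window: "finite (window d r)"
  by (simp add: window_def finite_box)

lemma box_0: "0 \<in> box d r"
  by (simp add: box_def)

lemma box_mono: "r \<le> s \<Longrightarrow> u \<in> box d r \<Longrightarrow> u \<in> box d s"
  by (force simp: box_def)

lemma box_add: "u \<in> box d r \<Longrightarrow> v \<in> box d s \<Longrightarrow> u + v \<in> box d (r + s)"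
  by (force simp: box_def)

lemma box_minus: "u \<in> box d r \<Longrightarrow> - u \<in> box d r"
  by (force simp: box_def)

lemma box_diff: "u \<in> box d r \<Longrightarrow> v \<in> box d s \<Longrightarrow> u - v \<in> box d (r + s)"
  using box_add[OF _ box_minus, of u d r v s] by simp

lemma unit_in_box: "i < d \<Longrightarrow> unit i \<in> box d 1"
  by (auto simp: box_def unit_def)

lemma unit_inj: "unit i = unit j \<longleftrightarrow> i = j"
  by (auto simp: unit_def fun_eq_iff split: if_splits)

lemma unit_add_nonzero: "unit i + unit j \<noteq> 0"
proof
  assume "unit i + unit j = 0"
  then have "(unit i + unit j) i = 0" by simp
  then show False by (simp add: unit_def split: if_splits)
qed

lemma window_mono: "r \<le> s \<Longrightarrow> window d r \<subseteq> window d s"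
  using box_mono by (auto simp: window_def)

lemma translate_0 [simp]: "translate 0 w = w"
  by (auto simp: translate_def case_prod_beta)

lemma translate_translate: "translate u (translate v w) = translate (v + u) w"
  by (force simp: translate_def image_image case_prod_beta add.assoc)

lemma card_translate: "card (translate v w) = card w"
  unfolding translate_def by (rule card_image) (auto simp: inj_on_def)

text \<open>A translation by \<open>v\<close> moves the sum of the positions of the slots in \<open>w\<close> by \<open>card w\<close> times \<open>v\<close>.\<close>

lemma translate_fixed:
  assumes "finite w" "w \<noteq> {}" "translate v w = w"
  shows "v = 0"
proof
  fix j
  have "(\<Sum>\<sigma>\<in>translate v w. fst \<sigma> j) = (\<Sum>\<sigma>\<in>w. fst \<sigma> j + v j)"
    unfolding translate_def
    by (subst sum.reindex) (auto simp: inj_on_def case_prod_beta)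
  then have "(\<Sum>\<sigma>\<in>w. fst \<sigma> j) = (\<Sum>\<sigma>\<in>w. fst \<sigma> j) + int (card w) * v j"
    using assms(3) by (simp add: sum.distrib)
  then show "v j = 0 j" using assms by simp
qed

locale torus =
  fixes d :: nat
  assumes d_ge2: "d \<ge> 2"
begin

abbreviation V :: "nat \<Rightarrow> (nat \<Rightarrow> nat) set" where "V \<equiv> torus_vertices d"
abbreviation E :: "nat \<Rightarrow> (nat \<Rightarrow> nat) set set" where "E \<equiv> torus_edges d"
abbreviation Box :: "nat \<Rightarrow> (nat \<Rightarrow> int) set" where "Box \<equiv> box d"
abbreviation Window :: "nat \<Rightarrow> slot set" where "Window \<equiv> window d"

text \<open>The torus is a quotient of \<open>\<int>\<^sup>d\<close>, on which \<open>\<int>\<^sup>d\<close> therefore acts by translations.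
  All local data at a vertex are expressed through this action, so that data at different
  vertices, and on tori of different sizes, can be compared directly.\<close>

definition shift :: "nat \<Rightarrow> (nat \<Rightarrow> nat) \<Rightarrow> (nat \<Rightarrow> int) \<Rightarrow> nat \<Rightarrow> nat" where
  "shift L x u = (\<lambda>i\<in>{..<d}. nat ((int (x i) + u i) mod int L))"

definition edge :: "nat \<Rightarrow> (nat \<Rightarrow> nat) \<Rightarrow> slot \<Rightarrow> (nat \<Rightarrow> nat) set" where
  "edge L x \<sigma> = {shift L x (fst \<sigma>), shift L x (fst \<sigma> + unit (snd \<sigma>))}"

text \<open>The marked edges are recorded relative to \<open>x\<close>, by slots, so that the patterns at different vertices
  can be equal.\<close>

definition pattern :: "nat \<Rightarrow> (nat \<Rightarrow> nat) set set \<Rightarrow> nat \<Rightarrow> (nat \<Rightarrow> nat) \<Rightarrow> slot set" where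
  "pattern L S r x = {\<sigma> \<in> Window r. edge L x \<sigma> \<in> S}"

abbreviation occurrences :: "nat \<Rightarrow> (nat \<Rightarrow> nat) set set \<Rightarrow> nat \<Rightarrow> slot set \<Rightarrow> (nat \<Rightarrow> nat) set" where
  "occurrences L S R w \<equiv> {x \<in> V L. pattern L S R x = w}"

lemma finite_V: "finite (V L)"
  by (simp add: torus_vertices_def finite_PiE)

lemma shift_in_V: "L > 0 \<Longrightarrow> shift L x u \<in> V L"
  by (auto simp: shift_def torus_vertices_def nat_less_iff)

lemma shift_0: "x \<in> V L \<Longrightarrow> shift L x 0 = x"
  by (rule ext) (auto simp: shift_def torus_vertices_def PiE_def Pi_def extensional_def)

lemma shift_shift: "L > 0 \<Longrightarrow> shift L (shift L x u) v = shift L x (u + v)"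
  by (rule ext) (simp add: shift_def mod_add_left_eq add.assoc)

lemma shift_eq_iff:
  "L > 0 \<Longrightarrow> shift L x u = shift L x v \<longleftrightarrow> (\<forall>i<d. int L dvd u i - v i)"
proof -
  assume L: "L > 0"
  have "shift L x u = shift L x v \<longleftrightarrow> (\<forall>i<d. (int (x i) + u i) mod int L = (int (x i) + v i) mod int L)"
    using L by (auto simp: shift_def fun_eq_iff restrict_def eq_nat_nat_iff)
  also have "\<dots> \<longleftrightarrow> (\<forall>i<d. int L dvd u i - v i)"
    by (simp add: mod_eq_dvd_iff)
  finally show ?thesis .
qed

text \<open>Coordinates in the box differ by less than \<open>L\<close>, so congruent ones are equal.\<close>

lemma shift_inj:
  assumes "L > 2 * r" "u \<in> Box r" "v \<in> Box r" "shift L x u = shift L x v"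
  shows "u = v"
proof
  fix i
  show "u i = v i"
  proof (cases "i < d")
    case True
    then have "int L dvd u i - v i" using assms shift_eq_iff[of L x u v] by auto
    moreover have "\<bar>u i - v i\<bar> < int L" using assms True by (force simp: box_def)
    ultimately show ?thesis using zdvd_not_zless[of "\<bar>u i - v i\<bar>" "int L"] by auto
  qed (use assms in \<open>auto simp: box_def\<close>)
qed

lemma shift_eqI:
  assumes "x \<in> V L" "L > 0" "y = shift L x u"
  shows "x = shift L y (- u)"
  using assms by (simp add: shift_shift shift_0)

lemma torus_adj_iff:
  assumes "x \<in> V L" "y \<in> V L" "L \<ge> 2"
  shows "torus_adj d L x y \<longleftrightarrow> (\<exists>i<d. y = shift L x (unit i) \<or> x = shift L y (unit i))"
proof -
  have cg: "[b = Suc a] (mod L) \<longleftrightarrow> b = nat ((int a + 1) mod int L)" if "a < L" "b < L" for a b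
  proof -
    have "[b = Suc a] (mod L) \<longleftrightarrow> b = (a + 1) mod L" using that by (simp add: cong_def)
    also have "(a + 1) mod L = nat ((int a + 1) mod int L)"
      by (metis int_ops(2) int_plus nat_int zmod_int)
    finally show ?thesis .
  qed
  have eq: "(y = shift L x (unit i)) \<longleftrightarrow> [y i = x i + 1] (mod L) \<and> (\<forall>j<d. j \<noteq> i \<longrightarrow> x j = y j)"
    if "i < d" "x \<in> V L" "y \<in> V L" for x y i
  proof -
    have lt: "x j < L" "y j < L" if "j < d" for j
      using that \<open>x \<in> V L\<close> \<open>y \<in> V L\<close> by (auto simp: torus_vertices_def)
    have "y = shift L x (unit i) \<longleftrightarrow> (\<forall>j<d. y j = nat ((int (x j) + unit i j) mod int L))"
      using that by (auto simp: shift_def fun_eq_iff torus_vertices_def PiE_def extensional_def)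
    also have "\<dots> \<longleftrightarrow> (\<forall>j<d. if j = i then [y i = x i + 1] (mod L) else x j = y j)"
      using lt by (intro all_cong) (auto simp: unit_def cg)
    finally show ?thesis using that by auto
  qed
  have ne: "x i \<noteq> y i" if "[x i = y i + 1] (mod L) \<or> [y i = x i + 1] (mod L)" for i
  proof
    assume "x i = y i"
    then have "[y i = y i + 1] (mod L)" using that by auto
    then have "[1 = 0] (mod L)" by (metis add.right_neutral cong_add_lcancel_nat cong_sym)
    then show False using assms(3) by (simp add: cong_def)
  qed
  show ?thesis
    unfolding torus_adj_def using eq[OF _ assms(1,2)] eq[OF _ assms(2,1)] ne by (metis (no_types, lifting))
qed

lemma edges_iff:
  assumes "L \<ge> 2"
  shows "{x, y} \<in> E L \<longleftrightarrow> x \<in> V L \<and> y \<in> V L \<and>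
    (\<exists>i<d. y = shift L x (unit i) \<or> y = shift L x (- unit i))"
proof -
  have sym: "torus_adj d L x y \<longleftrightarrow> torus_adj d L y x" for x y
    unfolding torus_adj_def by metis
  have "{x, y} \<in> E L \<longleftrightarrow> x \<in> V L \<and> y \<in> V L \<and> torus_adj d L x y"
    unfolding torus_edges_def by (auto simp: doubleton_eq_iff sym)
  moreover have "x = shift L y (unit i) \<longleftrightarrow> y = shift L x (- unit i)" if "x \<in> V L" "y \<in> V L" for i
    using shift_eqI[of y L x "unit i"] shift_eqI[of x L y "- unit i"] that assms by auto
  ultimately show ?thesis using torus_adj_iff[OF _ _ assms, of x y] by blast
qed

lemma edge_in_E: "L \<ge> 2 \<Longrightarrow> snd \<sigma> < d \<Longrightarrow> edge L x \<sigma> \<in> E L"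
  unfolding edge_def using edges_iff[of L] shift_in_V[of L] shift_shift[of L] by (metis zero_less_numeral less_le_trans)

lemma edge_shift: "L > 0 \<Longrightarrow> edge L (shift L x v) \<sigma> = edge L x (fst \<sigma> + v, snd \<sigma>)"
  by (simp add: edge_def shift_shift add_ac)

lemma edge_image_shift: "L > 0 \<Longrightarrow> edge L (shift L x v) ` w = edge L x ` translate v w"
  by (auto simp: translate_def image_image edge_shift case_prod_beta)

text \<open>The end points of the slots lie in a box on which shifting is injective. Hence two slots for the
  same edge have the same end points in \<open>\<int>\<^sup>d\<close>, and they also run in the same direction, because the
  sum of two unit vectors is not zero.\<close>

lemma edge_inj:
  assumes L: "L > 2 * r + 2" and s: "\<sigma> \<in> Window r" "\<tau> \<in> Window r" "edge L x \<sigma> = edge L x \<tau>"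
  shows "\<sigma> = \<tau>"
proof -
  obtain u i v j where [simp]: "\<sigma> = (u, i)" "\<tau> = (v, j)" by fastforce
  have b: "u \<in> Box r" "v \<in> Box r" "i < d" "j < d" using s by (auto simp: window_def)
  have b1: "u \<in> Box (r + 1)" "v \<in> Box (r + 1)" "u + unit i \<in> Box (r + 1)" "v + unit j \<in> Box (r + 1)"
    using b box_mono[of r "r + 1" _ d] box_add[OF _ unit_in_box] by auto
  have inj: "a = b" if "shift L x a = shift L x b" "a \<in> Box (r+1)" "b \<in> Box (r+1)" for a b
    using shift_inj[of "r+1" L a b x] that L by auto
  have "u = v \<and> u + unit i = v + unit j \<or> u = v + unit j \<and> u + unit i = v"
    using s(3) b1 inj by (auto simp: edge_def doubleton_eq_iff)
  then show ?thesis
  proof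
    assume "u = v + unit j \<and> u + unit i = v"
    then have "unit i + unit j = 0" by (metis (no_types) add.assoc add.commute add_cancel_left_right)
    then show ?thesis using unit_add_nonzero by blast
  qed (auto simp: unit_inj)
qed

lemma edge_inj_on: "L > 2 * r + 2 \<Longrightarrow> inj_on (edge L x) (Window r)"
  using edge_inj by (auto simp: inj_on_def)

lemma pattern_subset: "pattern L S r x \<subseteq> Window r"
  by (auto simp: pattern_def)

lemma pattern_shift:
  assumes "L > 0" "v \<in> Box s"
  shows "pattern L S r (shift L x v) = {\<sigma> \<in> Window r. (fst \<sigma> + v, snd \<sigma>) \<in> pattern L S (r + s) x}"
  using assms by (auto simp: pattern_def edge_shift window_def box_add)

text \<open>A window contains the smaller windows around all vertices near its centre.\<close>

lemma pattern_shift_cong: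
  assumes "L > 0" "L' > 0" "v \<in> Box s" "pattern L S (r + s) x = pattern L' S' (r + s) x'"
  shows "pattern L S r (shift L x v) = pattern L' S' r (shift L' x' v)"
  using assms by (simp add: pattern_shift)

lemma pattern_restrict: "r \<le> s \<Longrightarrow> pattern L S r x = pattern L S s x \<inter> Window r"
  using window_mono[of r s d] by (auto simp: pattern_def)

text \<open>The sparse random set is the set \<open>S\<close> of marked edges. With \<open>keep\<close> the graph consists of the
  marked edges, and without it of the others, so that one argument covers both ends of the
  percolation parameter.\<close>

definition marked_graph :: "nat \<Rightarrow> bool \<Rightarrow> (nat \<Rightarrow> nat) set set \<Rightarrow> (nat \<Rightarrow> nat) graph" where
  "marked_graph L keep S = (V L, {e \<in> E L. (e \<in> S) = keep})"

text \<open>Adjacency is determined by the displacement between two vertices and by the pattern at one of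
  them. This is all that the atomic formulas need in the game below.\<close>

lemma marked_graph_adj:
  assumes "L \<ge> 2" "x \<in> V L" "y \<in> V L"
  shows "{x, y} \<in> snd (marked_graph L keep S) \<longleftrightarrow>
    (\<exists>i<d. y = shift L x (unit i) \<and> ((0, i) \<in> pattern L S 1 x) = keep \<or>
           y = shift L x (- unit i) \<and> ((- unit i, i) \<in> pattern L S 1 x) = keep)"
proof -
  have 1: "(0, i) \<in> pattern L S 1 x \<longleftrightarrow> {x, y} \<in> S" if "i < d" "y = shift L x (unit i)" for i
    using that assms by (simp add: pattern_def window_def box_0 edge_def shift_0)
  have 2: "(- unit i, i) \<in> pattern L S 1 x \<longleftrightarrow> {x, y} \<in> S" if "i < d" "y = shift L x (- unit i)" for i
    using that assms box_minus[OF unit_in_box[OF that(1)]]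
    by (simp add: pattern_def window_def edge_def shift_0 insert_commute)
  show ?thesis
    using edges_iff[OF assms(1), of x y] assms 1 2 by (auto simp: marked_graph_def)
qed

section \<open>Hanf's theorem on tori with marked edges\<close>

text \<open>By Hanf's theorem these numbers decide a sentence, for suitable \<open>R\<close> and \<open>t\<close>. All radii up to \<open>R\<close> are
  included in order to make the condition monotone in \<open>R\<close>.\<close>

definition count_agree where
  "count_agree L S L' S' R t \<longleftrightarrow> (\<forall>r\<le>R. \<forall>w\<subseteq>Window r.
     min t (card (occurrences L S r w)) = min t (card (occurrences L' S' r w)))"

text \<open>A position in an Ehrenfeucht-Fraisse game that is good for Duplicator: the chosen vertices (the
  values of the variables in \<open>F\<close>) have the same patterns on both sides, and the same short
  displacements between each other.\<close>

definition similar where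
  "similar L S L' S' R F s s' \<longleftrightarrow>
     (\<forall>a\<in>F. s a \<in> V L \<and> s' a \<in> V L' \<and> pattern L S R (s a) = pattern L' S' R (s' a)) \<and>
     (\<forall>a\<in>F. \<forall>b\<in>F. \<forall>u\<in>Box R. s b = shift L (s a) u \<longleftrightarrow> s' b = shift L' (s' a) u)"

lemma count_agree_sym: "count_agree L S L' S' R t \<Longrightarrow> count_agree L' S' L S R t"
  by (simp add: count_agree_def)

lemma similar_sym: "similar L S L' S' R F s s' \<Longrightarrow> similar L' S' L S R F s' s"
  by (simp add: similar_def)

lemma count_agree_mono:
  assumes "count_agree L S L' S' R t" "r \<le> R" "t' \<le> t"
  shows "count_agree L S L' S' r t'"
  unfolding count_agree_def
proof (intro allI impI)
  fix q w assume "q \<le> r" "w \<subseteq> Window q"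
  then have "min t (card (occurrences L S q w)) = min t (card (occurrences L' S' q w))"
    using assms(1,2) unfolding count_agree_def by (meson le_trans)
  then show "min t' (card (occurrences L S q w)) = min t' (card (occurrences L' S' q w))"
    using assms(3) by (auto simp: min_def split: if_splits)
qed

lemma similar_mono:
  assumes "similar L S L' S' R F s s'" "r \<le> R" "F' \<subseteq> F"
  shows "similar L S L' S' r F' s s'"
  using assms pattern_restrict[OF assms(2)] box_mono[OF assms(2)]
  unfolding similar_def by (metis (no_types, lifting) subsetD)

text \<open>If Spoiler moves close to an old vertex, Duplicator copies the displacement. The radius has to be
  halved: both the pattern at the new vertex and its displacements to old vertices are read off
  within twice the radius of the vertex next to it.\<close>

lemma similar_fun_upd_near:
  assumes sim: "similar L S L' S' (2 * r) F s s'" and L: "L > 2 * r" "L' > 2 * r"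
    and a: "a \<in> F" and u: "u \<in> Box r" and i: "i \<notin> F"
  shows "similar L S L' S' r (insert i F) (s(i := shift L (s a) u)) (s'(i := shift L' (s' a) u))"
proof -
  let ?v = "shift L (s a) u" and ?v' = "shift L' (s' a) u"
  have pos: "L > 0" "L' > 0" using L by auto
  have V: "s b \<in> V L" "s' b \<in> V L'" if "b \<in> F" for b
    using sim that by (auto simp: similar_def)
  have pat: "pattern L S r ?v = pattern L' S' r ?v'"
    using sim a u pos by (intro pattern_shift_cong[of L L' u r]) (auto simp: similar_def mult_2)
  have to_b: "s b = shift L ?v w \<longleftrightarrow> s' b = shift L' ?v' w" if "b \<in> F" "w \<in> Box r" for b w
    using sim a that box_add[OF u that(2)] pos by (auto simp: similar_def mult_2 shift_shift)
  have swap: "y = shift L x w \<longleftrightarrow> x = shift L y (- w)" if "x \<in> V L" "y \<in> V L" "L > 0" for L x y w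
    using shift_eqI[of x L y w] shift_eqI[of y L x "- w"] that by auto
  have from_b: "?v = shift L (s b) w \<longleftrightarrow> ?v' = shift L' (s' b) w" if "b \<in> F" "w \<in> Box r" for b w
    using to_b[OF that(1) box_minus[OF that(2)]] V[OF that(1)] pos shift_in_V
      swap[of "s b" L ?v w] swap[of "s' b" L' ?v' w] by auto
  have self: "?v = shift L ?v w \<longleftrightarrow> ?v' = shift L' ?v' w" if "w \<in> Box r" for w
  proof -
    have "z = shift M z w \<longleftrightarrow> w = 0" if "z \<in> V M" "M > 2 * r" for z M
      using shift_inj[of r M w 0 z] that \<open>w \<in> Box r\<close> shift_0[OF that(1)] by (auto simp: box_0)
    then show ?thesis using L shift_in_V pos by auto
  qed
  have F: "similar L S L' S' r F s s'" using sim by (rule similar_mono) auto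
  then show ?thesis
    using pat to_b from_b self shift_in_V pos i
    unfolding similar_def by (auto simp: ball_simps)
qed

lemma similar_fun_upd_far:
  assumes sim: "similar L S L' S' r F s s'" and L: "L > 2 * r" "L' > 2 * r"
    and v: "v \<in> V L" "v' \<in> V L'" "pattern L S r v = pattern L' S' r v'"
    and far: "\<And>a u. a \<in> F \<Longrightarrow> u \<in> Box r \<Longrightarrow> v \<noteq> shift L (s a) u"
      "\<And>a u. a \<in> F \<Longrightarrow> u \<in> Box r \<Longrightarrow> v' \<noteq> shift L' (s' a) u"
    and i: "i \<notin> F"
  shows "similar L S L' S' r (insert i F) (s(i := v)) (s'(i := v'))"
proof -
  have pos: "L > 0" "L' > 0" using L by auto
  have far2: "s b \<noteq> shift L v w" "s' b \<noteq> shift L' v' w" if "b \<in> F" "w \<in> Box r" for b w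
    using far[OF that(1) box_minus[OF that(2)]] shift_eqI v pos by metis+
  have self: "v = shift L v w \<longleftrightarrow> v' = shift L' v' w" if "w \<in> Box r" for w
  proof -
    have "z = shift M z w \<longleftrightarrow> w = 0" if "z \<in> V M" "M > 2 * r" for z M
      using shift_inj[of r M w 0 z] that \<open>w \<in> Box r\<close> shift_0[OF that(1)] by (auto simp: box_0)
    then show ?thesis using L v by auto
  qed
  show ?thesis
    using sim v far far2 self i unfolding similar_def by (auto simp: ball_simps)
qed

text \<open>If Spoiler moves to \<open>v\<close>, away from all old vertices, Duplicator needs a vertex with the same
  pattern that is also away from all old ones. The vertices with this pattern that are close to
  old ones (\<open>X \<inter> Y\<close> and \<open>X' \<inter> Y'\<close> below) correspond to each other on the two sides, and there are
  fewer than \<open>t\<close> of them. As the total numbers agree up to \<open>t\<close>, there is a far one on the second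
  side if there is one on the first.\<close>

lemma far_reply:
  assumes agree: "count_agree L S L' S' R t" and sim: "similar L S L' S' R F s s'"
    and R: "2 * r \<le> R" and t: "card F * card (Box r) < t" and F: "finite F"
    and L: "L > 2 * R" "L' > 2 * R"
    and v: "v \<in> V L" and far: "\<And>a u. a \<in> F \<Longrightarrow> u \<in> Box r \<Longrightarrow> v \<noteq> shift L (s a) u"
  obtains v' where "v' \<in> V L'" "pattern L S r v = pattern L' S' r v'"
    "\<And>a u. a \<in> F \<Longrightarrow> u \<in> Box r \<Longrightarrow> v' \<noteq> shift L' (s' a) u"
proof -
  define w where "w = pattern L S r v"
  define X where "X = occurrences L S r w"
  define X' where "X' = occurrences L' S' r w"
  define Y where "Y = (\<lambda>(a, u). shift L (s a) u) ` (F \<times> Box r)"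
  define Y' where "Y' = (\<lambda>(a, u). shift L' (s' a) u) ` (F \<times> Box r)"
  have pos: "L > 0" "L' > 0" using L by auto
  have fin: "finite X" "finite X'" "finite Y" "finite Y'"
    using finite_V F finite_box by (auto simp: X_def X'_def Y_def Y'_def)
  have cY': "card Y' < t"
  proof -
    have "card Y' \<le> card (F \<times> Box r)"
      unfolding Y'_def by (rule card_image_le) (use F finite_box in auto)
    then show ?thesis using t by (simp add: card_cartesian_product)
  qed
  have V: "s b \<in> V L" "s' b \<in> V L'" if "b \<in> F" for b
    using sim that by (auto simp: similar_def)
  have same: "shift L (s a) u = shift L (s b) z \<longleftrightarrow> shift L' (s' a) u = shift L' (s' b) z"
    if "a \<in> F" "b \<in> F" "u \<in> Box r" "z \<in> Box r" for a b u z
  proof -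
    have "u - z \<in> Box R" using box_diff[OF that(3,4)] R box_mono[of "r + r" R] by auto
    moreover have "shift M x u = shift M y z \<longleftrightarrow> y = shift M x (u - z)"
      if "x \<in> V M" "y \<in> V M" "M > 0" for x y M
    proof
      assume "shift M x u = shift M y z"
      then have "shift M (shift M y z) (- z) = shift M (shift M x u) (- z)" by simp
      then show "y = shift M x (u - z)" using that by (simp add: shift_shift shift_0)
    next
      assume "y = shift M x (u - z)"
      then show "shift M x u = shift M y z" using that by (simp add: shift_shift)
    qed
    ultimately show ?thesis using sim that V pos by (simp add: similar_def)
  qed
  have pat: "pattern L S r (shift L (s a) u) = pattern L' S' r (shift L' (s' a) u)"
    if "a \<in> F" "u \<in> Box r" for a u
  proof (rule pattern_shift_cong)
    show "pattern L S (r + r) (s a) = pattern L' S' (r + r) (s' a)"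
      using sim that R pattern_restrict[of "r + r" R] by (simp add: similar_def)
  qed (use pos that in auto)
  \<comment> \<open>The correspondence keeps the displacement from an old vertex. It does not depend on the choice of that vertex.\<close>
  have "bij_betw (\<lambda>y. THE y'. \<exists>a\<in>F. \<exists>u\<in>Box r. y = shift L (s a) u \<and> y' = shift L' (s' a) u)
      (X \<inter> Y) (X' \<inter> Y')" (is "bij_betw ?h _ _")
  proof -
    have h: "?h (shift L (s a) u) = shift L' (s' a) u" if "a \<in> F" "u \<in> Box r" for a u
    proof (rule the_equality)
      fix y' assume "\<exists>b\<in>F. \<exists>z\<in>Box r. shift L (s a) u = shift L (s b) z \<and> y' = shift L' (s' b) z"
      then obtain b z where "b \<in> F" "z \<in> Box r" "shift L (s a) u = shift L (s b) z" "y' = shift L' (s' b) z"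
        by blast
      then show "y' = shift L' (s' a) u" using same[of a b u z] that by simp
    qed (use that in blast)
    show ?thesis
      unfolding bij_betw_def
    proof
      show "inj_on ?h (X \<inter> Y)"
        using h same by (auto simp: inj_on_def Y_def)
      have mem: "shift L (s a) u \<in> X \<longleftrightarrow> shift L' (s' a) u \<in> X'" if "a \<in> F" "u \<in> Box r" for a u
        using pat[OF that] shift_in_V pos by (auto simp: X_def X'_def)
      show "?h ` (X \<inter> Y) = X' \<inter> Y'"
      proof (intro equalityI subsetI)
        fix y assume "y \<in> ?h ` (X \<inter> Y)"
        then show "y \<in> X' \<inter> Y'" using h mem by (auto simp: Y_def Y'_def)
      next
        fix y assume "y \<in> X' \<inter> Y'"
        then obtain a u where au: "a \<in> F" "u \<in> Box r" "y = shift L' (s' a) u" by (auto simp: Y'_def)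
        then have "shift L (s a) u \<in> X \<inter> Y" using mem \<open>y \<in> X' \<inter> Y'\<close> by (auto simp: Y_def)
        then have "?h (shift L (s a) u) \<in> ?h ` (X \<inter> Y)" by (rule imageI)
        then show "y \<in> ?h ` (X \<inter> Y)" using h[OF au(1,2)] au(3) by simp
      qed
    qed
  qed
  then have cardXY: "card (X \<inter> Y) = card (X' \<inter> Y')" by (rule bij_betw_same_card)
  have "v \<in> X - Y" using v far by (auto simp: X_def Y_def w_def)
  then have lt: "card (X \<inter> Y) < card X" using fin by (intro psubset_card_mono) auto
  have cap: "min t (card X) = min t (card X')"
    using agree R pattern_subset[of L S r v] unfolding count_agree_def X_def X'_def w_def by simp
  have "\<not> X' \<subseteq> Y'"
  proof
    assume sub: "X' \<subseteq> Y'"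
    then have "card X' < t" using card_mono[OF fin(4) sub] cY' by simp
    then have "card X' = card X" using cap by (auto simp: min_def split: if_splits)
    then show False using lt cardXY sub by (simp add: Int_absorb2)
  qed
  then obtain v' where "v' \<in> X'" "v' \<notin> Y'" by blast
  then show ?thesis by (intro that[of v']) (auto simp: X'_def Y'_def w_def)
qed

lemma forth:
  assumes agree: "count_agree L S L' S' R t" and sim: "similar L S L' S' R F s s'"
    and R: "2 * r \<le> R" and t: "card F * card (Box r) < t" and F: "finite F"
    and L: "L > 2 * R" "L' > 2 * R" and v: "v \<in> V L" and i: "i \<notin> F"
  obtains v' where "v' \<in> V L'" "similar L S L' S' r (insert i F) (s(i := v)) (s'(i := v'))"
proof (cases "\<exists>a\<in>F. \<exists>u\<in>Box r. v = shift L (s a) u")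
  case True
  then obtain a u where au: "a \<in> F" "u \<in> Box r" "v = shift L (s a) u" by blast
  have "similar L S L' S' (2 * r) F s s'" using sim R by (rule similar_mono) auto
  from similar_fun_upd_near[OF this _ _ au(1,2) i] show ?thesis
    using that[of "shift L' (s' a) u"] au L R shift_in_V[of L'] by auto
next
  case False
  then obtain v' where v': "v' \<in> V L'" "pattern L S r v = pattern L' S' r v'"
    "\<And>a u. a \<in> F \<Longrightarrow> u \<in> Box r \<Longrightarrow> v' \<noteq> shift L' (s' a) u"
    using far_reply[OF agree sim R t F L v] by blast
  have "similar L S L' S' r F s s'" using sim R by (intro similar_mono[OF sim]) auto
  from similar_fun_upd_far[OF this _ _ v v'(1,2) _ v'(3) i] show ?thesis
    using that[OF v'(1)] False L R by auto
qed

text \<open>Each quantifier costs a factor of two in the radius, and the threshold has to exceed the number of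
  vertices close to the old ones.\<close>

lemma hanf_open:
  "fo_free_vars \<phi> \<subseteq> F \<Longrightarrow> finite F \<Longrightarrow>
   \<exists>R t. \<forall>L S L' S' s s'. L > 2 * R \<longrightarrow> L' > 2 * R \<longrightarrow> count_agree L S L' S' R t \<longrightarrow>
     similar L S L' S' R F s s' \<longrightarrow>
     fo_sat (marked_graph L keep S) s \<phi> = fo_sat (marked_graph L' keep S') s' \<phi>"
proof (induction \<phi> arbitrary: F)
  case (FO_Eq i j)
  have "s i = s j \<longleftrightarrow> s' i = s' j"
    if sim: "similar L S L' S' 0 F s s'" for L S L' S' s s'
  proof -
    have "s i \<in> V L" "s' i \<in> V L'" "s j = shift L (s i) 0 \<longleftrightarrow> s' j = shift L' (s' i) 0"
      using sim FO_Eq by (auto simp: similar_def box_0)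
    then have "s j = s i \<longleftrightarrow> s' j = s' i" by (simp only: shift_0)
    then show ?thesis by metis
  qed
  then show ?case by (intro exI[of _ 0]) auto
next
  case (FO_Adj i j)
  have "{s i, s j} \<in> snd (marked_graph L keep S) \<longleftrightarrow> {s' i, s' j} \<in> snd (marked_graph L' keep S')"
    if "similar L S L' S' 1 F s s'" "L > 2" "L' > 2" for L S L' S' s s'
  proof -
    have m: "i \<in> F" "j \<in> F" using FO_Adj by auto
    have sh: "s j = shift L (s i) u \<longleftrightarrow> s' j = shift L' (s' i) u" if "u \<in> Box 1" for u
      using \<open>similar L S L' S' 1 F s s'\<close> m that by (auto simp: similar_def)
    have "s j = shift L (s i) (unit c) \<longleftrightarrow> s' j = shift L' (s' i) (unit c)"
      "s j = shift L (s i) (- unit c) \<longleftrightarrow> s' j = shift L' (s' i) (- unit c)" if "c < d" for c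
      using sh unit_in_box[OF that] box_minus[OF unit_in_box[OF that]] by auto
    moreover have "pattern L S 1 (s i) = pattern L' S' 1 (s' i)"
       "s i \<in> V L" "s' i \<in> V L'" "s j \<in> V L" "s' j \<in> V L'"
      using that(1) m by (auto simp: similar_def)
    ultimately show ?thesis
      using that(2,3) marked_graph_adj[of L "s i" "s j" keep S] marked_graph_adj[of L' "s' i" "s' j" keep S']
      by (simp cong: conj_cong)
  qed
  then show ?case by (intro exI[of _ 1] exI[of _ 0]) auto
next
  case (FO_Not \<phi>)
  then show ?case by auto
next
  case (FO_And \<phi> \<psi>)
  from FO_And.IH(1)[of F] FO_And.prems obtain R1 t1 where
    1: "\<forall>L S L' S' s s'. L > 2 * R1 \<longrightarrow> L' > 2 * R1 \<longrightarrow> count_agree L S L' S' R1 t1 \<longrightarrow>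
     similar L S L' S' R1 F s s' \<longrightarrow>
     fo_sat (marked_graph L keep S) s \<phi> = fo_sat (marked_graph L' keep S') s' \<phi>" by auto
  from FO_And.IH(2)[of F] FO_And.prems obtain R2 t2 where
    2: "\<forall>L S L' S' s s'. L > 2 * R2 \<longrightarrow> L' > 2 * R2 \<longrightarrow> count_agree L S L' S' R2 t2 \<longrightarrow>
     similar L S L' S' R2 F s s' \<longrightarrow>
     fo_sat (marked_graph L keep S) s \<psi> = fo_sat (marked_graph L' keep S') s' \<psi>" by auto
  show ?case
  proof (rule exI[of _ "max R1 R2"], rule exI[of _ "max t1 t2"], intro allI impI)
    fix L S L' S' s s'
    assume a: "L > 2 * max R1 R2" "L' > 2 * max R1 R2" "count_agree L S L' S' (max R1 R2) (max t1 t2)"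
      "similar L S L' S' (max R1 R2) F s s'"
    have len: "L > 2 * R1" "L' > 2 * R1" "L > 2 * R2" "L' > 2 * R2" using a(1,2) by auto
    have c: "count_agree L S L' S' R1 t1" "count_agree L S L' S' R2 t2"
      "similar L S L' S' R1 F s s'" "similar L S L' S' R2 F s s'"
      using count_agree_mono[OF a(3)] similar_mono[OF a(4)] by auto
    have "fo_sat (marked_graph L keep S) s \<phi> = fo_sat (marked_graph L' keep S') s' \<phi>"
      "fo_sat (marked_graph L keep S) s \<psi> = fo_sat (marked_graph L' keep S') s' \<psi>"
      using 1 2 len c by blast+
    then show "fo_sat (marked_graph L keep S) s (FO_And \<phi> \<psi>) = fo_sat (marked_graph L' keep S') s' (FO_And \<phi> \<psi>)"
      by simp
  qed
next
  case (FO_Ex i \<phi>)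
  define G where "G = F - {i}"
  have G: "finite G" "i \<notin> G" "G \<subseteq> F" "fo_free_vars \<phi> \<subseteq> insert i G"
    using FO_Ex.prems by (auto simp: G_def)
  from FO_Ex.IH[OF G(4)] G(1) obtain r t where
    IH: "\<And>L S L' S' s s'. L > 2 * r \<Longrightarrow> L' > 2 * r \<Longrightarrow> count_agree L S L' S' r t \<Longrightarrow>
     similar L S L' S' r (insert i G) s s' \<Longrightarrow>
     fo_sat (marked_graph L keep S) s \<phi> = fo_sat (marked_graph L' keep S') s' \<phi>"
    by (metis finite_insert)
  define T where "T = max t (card G * card (Box r) + 1)"
  have step: "fo_sat (marked_graph L' keep S') s' (FO_Ex i \<phi>)"
    if L: "L > 2 * (2 * r)" "L' > 2 * (2 * r)" and agree: "count_agree L S L' S' (2 * r) T"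
      and sim: "similar L S L' S' (2 * r) F s s'" and sat: "fo_sat (marked_graph L keep S) s (FO_Ex i \<phi>)"
    for L S L' S' s s'
  proof -
    obtain v where v: "v \<in> V L" "fo_sat (marked_graph L keep S) (s(i := v)) \<phi>"
      using sat by (auto simp: marked_graph_def)
    have "card G * card (Box r) < T" by (simp add: T_def less_max_iff_disj)
    then obtain v' where v': "v' \<in> V L'" "similar L S L' S' r (insert i G) (s(i := v)) (s'(i := v'))"
      using forth[OF agree similar_mono[OF sim order_refl G(3)] order_refl _ G(1) L v(1) G(2)]
      by blast
    have "count_agree L S L' S' r t"
      using agree by (rule count_agree_mono) (auto simp: T_def)
    then have "fo_sat (marked_graph L' keep S') (s'(i := v')) \<phi>"
      using IH[of L L' S S'] v' v(2) L by auto
    then show ?thesis using v'(1) by (auto simp: marked_graph_def)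
  qed
  show ?case
  proof (rule exI[of _ "2 * r"], rule exI[of _ T], intro allI impI)
    fix L S L' S' s s'
    assume a: "L > 2 * (2 * r)" "L' > 2 * (2 * r)" "count_agree L S L' S' (2 * r) T"
      "similar L S L' S' (2 * r) F s s'"
    show "fo_sat (marked_graph L keep S) s (FO_Ex i \<phi>) = fo_sat (marked_graph L' keep S') s' (FO_Ex i \<phi>)"
      using step[OF a] step[OF a(2,1) count_agree_sym[OF a(3)] similar_sym[OF a(4)]] by blast
  qed
qed

text \<open>A sentence starts from the empty position, which is similar on both sides for trivial reasons.\<close>

lemma hanf:
  assumes "fo_sentence \<phi>"
  obtains R t where "\<And>L S L' S'. L > 2 * R \<Longrightarrow> L' > 2 * R \<Longrightarrow> count_agree L S L' S' R t \<Longrightarrow>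
     fo_models (marked_graph L keep S) \<phi> = fo_models (marked_graph L' keep S') \<phi>"
proof -
  have "fo_free_vars \<phi> \<subseteq> {}" using assms by (simp add: fo_sentence_def)
  from hanf_open[OF this finite.emptyI, of keep] obtain R t where
    h: "\<And>L S L' S' s s'. L > 2 * R \<Longrightarrow> L' > 2 * R \<Longrightarrow> count_agree L S L' S' R t \<Longrightarrow>
     fo_sat (marked_graph L keep S) s \<phi> = fo_sat (marked_graph L' keep S') s' \<phi>"
    unfolding similar_def by (simp, blast)
  have ne: "\<exists>s. range s \<subseteq> fst (marked_graph L keep S)" if "L > 0" for L S
    using shift_in_V[OF that, of undefined undefined]
    by (intro exI[of _ "\<lambda>_. shift L undefined undefined"]) (auto simp: marked_graph_def)
  show ?thesis
  proof (rule that)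
    fix L S L' S' assume a: "L > 2 * R" "L' > 2 * R" "count_agree L S L' S' R t"
    then show "fo_models (marked_graph L keep S) \<phi> = fo_models (marked_graph L' keep S') \<phi>"
      using h[OF a] ne[of L S] ne[of L' S'] unfolding fo_models_def by (metis gr_implies_not0 not_gr_zero)
  qed
qed

end

section \<open>Random subsets with a planted part\<close>

definition random_subset :: "'e set \<Rightarrow> real \<Rightarrow> 'e set pmf" where
  "random_subset E r = map_pmf (\<lambda>\<omega>. {e \<in> E. \<omega> e}) (Pi_pmf E False (\<lambda>_. bernoulli_pmf r))"

abbreviation subset_prob :: "'e set \<Rightarrow> real \<Rightarrow> 'e set set \<Rightarrow> real" where
  "subset_prob E r \<equiv> measure_pmf.prob (random_subset E r)"

lemma set_random_subset: "S \<in> set_pmf (random_subset E r) \<Longrightarrow> S \<subseteq> E"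
  by (auto simp: random_subset_def)

lemma finite_set_random_subset: "finite E \<Longrightarrow> finite (set_pmf (random_subset E r))"
  by (rule finite_subset[of _ "Pow E"]) (auto dest: set_random_subset)

lemma random_subset_insert:
  assumes "finite E" "e \<notin> E"
  shows "random_subset (insert e E) r =
    map_pmf (\<lambda>(b, S). if b then insert e S else S) (pair_pmf (bernoulli_pmf r) (random_subset E r))"
proof -
  have "random_subset (insert e E) r =
    map_pmf (\<lambda>(b, f). {x \<in> insert e E. (f(e := b)) x}) (pair_pmf (bernoulli_pmf r) (Pi_pmf E False (\<lambda>_. bernoulli_pmf r)))"
    using assms by (simp add: random_subset_def Pi_pmf_insert pmf.map_comp o_def case_prod_unfold)
  also have "(\<lambda>(b, f). {x \<in> insert e E. (f(e := b)) x}) = (\<lambda>(b, f). (\<lambda>(b, S). if b then insert e S else S) (b, {x \<in> E. f x}))"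
    using assms by (auto simp: fun_eq_iff)
  also have "map_pmf \<dots> (pair_pmf (bernoulli_pmf r) (Pi_pmf E False (\<lambda>_. bernoulli_pmf r))) =
    map_pmf (\<lambda>(b, S). if b then insert e S else S) (pair_pmf (bernoulli_pmf r) (random_subset E r))"
    unfolding random_subset_def pair_map_pmf2 by (simp add: pmf.map_comp o_def case_prod_unfold cong: if_cong)
  finally show ?thesis .
qed

lemma prob_eq_one_minus:
  "measure_pmf.prob p {x. P x} = 1 - measure_pmf.prob p {x. \<not> P x}"
  using measure_pmf.prob_compl[of "{x. \<not> P x}" p] by (simp add: Compl_eq_Diff_UNIV[symmetric] Collect_neg_eq)

lemma prob_pair_Times:
  "measure_pmf.prob (pair_pmf p q) (A \<times> B) = measure_pmf.prob p A * measure_pmf.prob q B"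
proof -
  have "measure_pmf.prob (pair_pmf p q) (A \<times> B)
    = measure_pmf.prob (pair_pmf p q) ((A \<inter> set_pmf p) \<times> (B \<inter> set_pmf q))"
    by (subst measure_Int_set_pmf[symmetric]) (simp add: Times_Int_Times)
  also have "\<dots> = measure_pmf.prob p (A \<inter> set_pmf p) * measure_pmf.prob q (B \<inter> set_pmf q)"
    by (intro measure_pmf_prob_product) auto
  finally show ?thesis by (simp add: measure_Int_set_pmf)
qed

lemma prob_insert_planted:
  assumes "finite E" "e \<in> E" "0 \<le> r" "r \<le> 1"
  shows "subset_prob E r {S. e \<in> S \<and> P S}
    = r * subset_prob E r {S. P (insert e S)}"
proof -
  define F where "F = E - {e}"
  have E: "E = insert e F" "e \<notin> F" "finite F" using assms by (auto simp: F_def)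
  let ?R = "random_subset F r" and ?f = "\<lambda>(b, S). if b then insert e S else S"
  have notin: "AE S in measure_pmf ?R. e \<notin> S"
    using set_random_subset E(2) by (intro AE_pmfI) blast
  have "subset_prob E r {S. e \<in> S \<and> P S}
      = measure_pmf.prob (pair_pmf (bernoulli_pmf r) ?R) {p. e \<in> ?f p \<and> P (?f p)}"
    unfolding E(1) random_subset_insert[OF E(3,2)] measure_map_pmf by (simp add: vimage_def case_prod_unfold)
  also have "\<dots> = measure_pmf.prob (pair_pmf (bernoulli_pmf r) ?R) ({True} \<times> {S. P (insert e S)})"
  proof (rule measure_pmf.finite_measure_eq_AE)
    show "AE p in measure_pmf (pair_pmf (bernoulli_pmf r) ?R).
      (p \<in> {p. e \<in> ?f p \<and> P (?f p)}) = (p \<in> {True} \<times> {S. P (insert e S)})"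
    proof (rule AE_pmfI)
      fix p assume "p \<in> set_pmf (pair_pmf (bernoulli_pmf r) ?R)"
      then have "e \<notin> snd p" using set_random_subset E(2) by (metis mem_Times_iff set_pair_pmf subsetD)
      then show "(p \<in> {p. e \<in> ?f p \<and> P (?f p)}) = (p \<in> {True} \<times> {S. P (insert e S)})"
        by (cases p) (auto split: if_splits)
    qed
  qed auto
  also have "\<dots> = r * measure_pmf.prob ?R {S. P (insert e S)}"
    using assms(3,4) by (simp add: prob_pair_Times measure_pmf_single)
  also have "measure_pmf.prob ?R {S. P (insert e S)} = subset_prob E r {S. P (insert e S)}"
  proof -
    have "subset_prob E r {S. P (insert e S)}
      = measure_pmf.prob (pair_pmf (bernoulli_pmf r) ?R) (UNIV \<times> {S. P (insert e S)})"
      unfolding E(1) random_subset_insert[OF E(3,2)] measure_map_pmf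
      by (rule arg_cong[where f = "measure_pmf.prob _"]) (auto simp: insert_absorb2 split: if_splits)
    also have "\<dots> = measure_pmf.prob ?R {S. P (insert e S)}"
      by (subst prob_pair_Times) auto
    finally show ?thesis by simp
  qed
  finally show ?thesis .
qed

text \<open>Given that the elements of \<open>D\<close> were chosen, the others are still chosen independently with the same
  probability. So conditioning on \<open>D\<close> amounts to adding \<open>D\<close> to an unconditioned set.\<close>

lemma prob_planted:
  assumes "finite E" "D \<subseteq> E" "0 \<le> r" "r \<le> 1"
  shows "subset_prob E r {S. D \<subseteq> S \<and> P S}
    = r ^ card D * subset_prob E r {S. P (S \<union> D)}"
proof -
  have "finite D" using assms finite_subset by blast
  then show ?thesis using assms(2)
  proof (induction D arbitrary: P rule: finite_induct)
    case (insert e D)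
    have "subset_prob E r {S. insert e D \<subseteq> S \<and> P S}
      = subset_prob E r {S. e \<in> S \<and> (D \<subseteq> S \<and> P S)}"
      by (rule arg_cong[where f = "measure_pmf.prob _"]) auto
    also have "\<dots> = r * subset_prob E r {S. D \<subseteq> insert e S \<and> P (insert e S)}"
      using insert.prems assms by (subst prob_insert_planted) auto
    also have "{S. D \<subseteq> insert e S \<and> P (insert e S)} = {S. D \<subseteq> S \<and> P (insert e S)}"
      using insert.hyps by auto
    also have "subset_prob E r \<dots> =
        r ^ card D * subset_prob E r {S. P (insert e (S \<union> D))}"
      using insert.prems by (intro insert.IH) auto
    finally show ?case using insert.hyps by (simp add: mult.assoc)
  qed simp
qed

lemma prob_subset:
  assumes "finite E" "D \<subseteq> E" "0 \<le> r" "r \<le> 1"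
  shows "subset_prob E r {S. D \<subseteq> S} = r ^ card D"
  using prob_planted[OF assms, of "\<lambda>_. True"] by simp

lemma prob_meets:
  assumes "finite E" "D \<subseteq> E" "0 \<le> r" "r \<le> 1"
  shows "subset_prob E r {S. S \<inter> D \<noteq> {}} \<le> real (card D) * r"
proof -
  have fin: "finite D" using assms finite_subset by blast
  have "subset_prob E r {S. S \<inter> D \<noteq> {}}
      = subset_prob E r (\<Union>e\<in>D. {S. {e} \<subseteq> S})"
    by (rule arg_cong[where f = "measure_pmf.prob _"]) auto
  also have "\<dots> \<le> (\<Sum>e\<in>D. subset_prob E r {S. {e} \<subseteq> S})"
    by (rule measure_pmf.finite_measure_subadditive_finite) (use fin in auto)
  also have "\<dots> = (\<Sum>e\<in>D. r)"
    using assms by (intro sum.cong refl) (subst prob_subset; auto)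
  finally show ?thesis by simp
qed

lemma prob_diff_le:
  assumes "\<And>x. x \<in> set_pmf M \<Longrightarrow> \<not> Z x \<Longrightarrow> X x \<longleftrightarrow> Y x"
  shows "\<bar>measure_pmf.prob M {x. X x} - measure_pmf.prob M {x. Y x}\<bar> \<le> measure_pmf.prob M {x. Z x}"
proof -
  have 1: "measure_pmf.prob M A \<le> measure_pmf.prob M B + measure_pmf.prob M C"
    if "\<And>x. x \<in> set_pmf M \<Longrightarrow> x \<in> A \<Longrightarrow> x \<in> B \<union> C" for A B C :: "'a set"
  proof -
    have "measure_pmf.prob M A \<le> measure_pmf.prob M (B \<union> C)"
      using that by (intro measure_pmf.finite_measure_mono_AE) (auto intro!: AE_pmfI)
    also have "\<dots> \<le> measure_pmf.prob M B + measure_pmf.prob M C"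
      by (rule measure_Un_le) auto
    finally show ?thesis .
  qed
  have "measure_pmf.prob M {x. X x} \<le> measure_pmf.prob M {x. Y x} + measure_pmf.prob M {x. Z x}"
    "measure_pmf.prob M {x. Y x} \<le> measure_pmf.prob M {x. X x} + measure_pmf.prob M {x. Z x}"
    using assms by (auto intro!: 1)
  then show ?thesis by linarith
qed

section \<open>Stein's identity for planted families\<close>

text \<open>A hit at \<open>j\<close> requires the \<open>k\<close> elements of \<open>D j\<close>, and other elements nearby, those of \<open>N j\<close>, may
  spoil it. If \<open>S\<close> avoids \<open>N j\<close>, then planting \<open>D j\<close> in \<open>S\<close> produces the hit \<open>j\<close> and changes no other. For
  small \<open>r\<close> and bounded \<open>card (N j)\<close> this is the usual case.\<close>

locale planted_family =
  fixes E :: "'e set" and r :: real and J :: "'j set" and D N :: "'j \<Rightarrow> 'e set"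
    and hit :: "'j \<Rightarrow> 'e set \<Rightarrow> bool" and k C :: nat
  assumes finite_E: "finite E" and finite_J: "finite J"
    and r: "0 \<le> r" "r \<le> 1"
    and D_subset: "j \<in> J \<Longrightarrow> D j \<subseteq> E" and card_D: "j \<in> J \<Longrightarrow> card (D j) = k"
    and N_subset: "j \<in> J \<Longrightarrow> N j \<subseteq> E" and card_N: "j \<in> J \<Longrightarrow> card (N j) \<le> C"
    and hit_D: "j \<in> J \<Longrightarrow> hit j S \<Longrightarrow> D j \<subseteq> S"
    and no_hit: "j \<in> J \<Longrightarrow> S \<subseteq> E \<Longrightarrow> S \<inter> N j = {} \<Longrightarrow> \<not> hit j S"
    and hit_planted: "j \<in> J \<Longrightarrow> S \<subseteq> E \<Longrightarrow> S \<inter> N j = {} \<Longrightarrow> i \<in> J \<Longrightarrow>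
      hit i (S \<union> D j) \<longleftrightarrow> i = j \<or> hit i S"
begin

abbreviation M where "M \<equiv> random_subset E r"
abbreviation prob where "prob \<equiv> measure_pmf.prob M"

definition hits :: "'e set \<Rightarrow> 'j set" where
  "hits S = {j \<in> J. hit j S}"

lemma hits_subset: "hits S \<subseteq> J"
  by (auto simp: hits_def)

lemma finite_hits: "finite (hits S)"
  using hits_subset finite_J finite_subset by blast

text \<open>Being hit at \<open>j\<close> is the same as planting \<open>D j\<close> at the price \<open>r ^ k\<close>, and planting adds just the
  hit \<open>j\<close> unless \<open>N j\<close> is met, which has probability at most \<open>C * r\<close>.\<close>

lemma prob_hit_and:
  assumes j: "j \<in> J" and B: "\<And>Q. Q \<subseteq> J \<Longrightarrow> j \<notin> Q \<Longrightarrow> B (insert j Q) \<longleftrightarrow> B' Q"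
  shows "\<bar>prob {S. j \<in> hits S \<and> B (hits S)} - r ^ k * prob {S. B' (hits S)}\<bar> \<le> r ^ k * (real C * r)"
proof -
  have "prob {S. j \<in> hits S \<and> B (hits S)} = prob {S. D j \<subseteq> S \<and> (j \<in> hits S \<and> B (hits S))}"
    using hit_D[OF j] by (intro arg_cong[where f = prob]) (auto simp: hits_def)
  also have "\<dots> = r ^ k * prob {S. j \<in> hits (S \<union> D j) \<and> B (hits (S \<union> D j))}"
    using prob_planted[OF finite_E D_subset[OF j] r] card_D[OF j] by simp
  finally have 1: "prob {S. j \<in> hits S \<and> B (hits S)}
    = r ^ k * prob {S. j \<in> hits (S \<union> D j) \<and> B (hits (S \<union> D j))}" .
  have "\<bar>prob {S. j \<in> hits (S \<union> D j) \<and> B (hits (S \<union> D j))} - prob {S. B' (hits S)}\<bar>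
    \<le> prob {S. S \<inter> N j \<noteq> {}}"
  proof (rule prob_diff_le)
    fix S assume S: "S \<in> set_pmf M" "\<not> S \<inter> N j \<noteq> {}"
    then have S': "S \<subseteq> E" "S \<inter> N j = {}" using set_random_subset[OF S(1)] by auto
    have "hits (S \<union> D j) = insert j (hits S)" "j \<notin> hits S"
      using hit_planted[OF j S'] no_hit[OF j S'] j by (auto simp: hits_def)
    then show "(j \<in> hits (S \<union> D j) \<and> B (hits (S \<union> D j))) \<longleftrightarrow> B' (hits S)"
      using B[OF hits_subset] by auto
  qed
  also have "\<dots> \<le> real (card (N j)) * r"
    by (rule prob_meets[OF finite_E N_subset[OF j] r])
  also have "\<dots> \<le> real C * r"
    using card_N[OF j] r by (intro mult_right_mono) auto
  finally have "\<bar>prob {S. j \<in> hits (S \<union> D j) \<and> B (hits (S \<union> D j))} - prob {S. B' (hits S)}\<bar> \<le> real C * r" .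
  then have "r ^ k * \<bar>prob {S. j \<in> hits (S \<union> D j) \<and> B (hits (S \<union> D j))} - prob {S. B' (hits S)}\<bar>
    \<le> r ^ k * (real C * r)" using r by (intro mult_left_mono) auto
  then show ?thesis
    unfolding 1 using r by (simp add: abs_mult right_diff_distrib[symmetric])
qed

lemma expectation_card_hits:
  assumes "J' \<subseteq> J"
  shows "measure_pmf.expectation M (\<lambda>S. real (card (hits S \<inter> J')) * indicator {S. P S} S)
    = (\<Sum>j\<in>J'. prob {S. j \<in> hits S \<and> P S})"
proof -
  have fin: "finite J'" using assms finite_J finite_subset by blast
  have "(\<lambda>S. real (card (hits S \<inter> J')) * indicator {S. P S} S) = (\<lambda>S. \<Sum>j\<in>J'. indicator {S. j \<in> hits S \<and> P S} S :: real)"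
  proof
    fix S
    have "(\<Sum>j\<in>J'. indicator {S. j \<in> hits S \<and> P S} S :: real) = (\<Sum>j\<in>J'. (if j \<in> hits S then 1 else 0) * indicator {S. P S} S)"
      by (intro sum.cong) (auto simp: indicator_def)
    also have "\<dots> = real (card (hits S \<inter> J')) * indicator {S. P S} S"
      using fin by (simp add: sum_distrib_right[symmetric] sum.If_cases Int_commute)
    finally show "real (card (hits S \<inter> J')) * indicator {S. P S} S = (\<Sum>j\<in>J'. indicator {S. j \<in> hits S \<and> P S} S :: real)" ..
  qed
  moreover have "measure_pmf.expectation M (\<lambda>S. \<Sum>j\<in>J'. indicator {S. j \<in> hits S \<and> P S} S :: real)
    = (\<Sum>j\<in>J'. measure_pmf.expectation M (indicator {S. j \<in> hits S \<and> P S} :: _ \<Rightarrow> real))"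
    by (rule Bochner_Integration.integral_sum)
      (auto intro!: integrable_measure_pmf_finite finite_set_random_subset finite_E)
  ultimately show ?thesis by simp
qed

text \<open>Sum the previous estimate over \<open>j\<close>: if \<open>B\<close> fixes the number \<open>c\<close> of hits in \<open>J'\<close>, each outcome in \<open>B\<close>
  is counted \<open>c\<close> times. For a Poisson variable \<open>Y\<close> of mean \<open>\<mu>\<close> the resulting relation
  \<open>c * P (Y = c) = \<mu> * P (Y = c - 1)\<close> holds exactly and characterizes the distribution.\<close>

lemma stein:
  assumes J': "J' \<subseteq> J"
    and c: "\<And>Q. Q \<subseteq> J \<Longrightarrow> B Q \<Longrightarrow> card (Q \<inter> J') = c"
    and B: "\<And>j Q. Q \<subseteq> J \<Longrightarrow> j \<in> J' \<Longrightarrow> j \<notin> Q \<Longrightarrow> B (insert j Q) \<longleftrightarrow> B' Q"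
  shows "\<bar>real c * prob {S. B (hits S)} - real (card J') * r ^ k * prob {S. B' (hits S)}\<bar>
    \<le> real (card J') * r ^ k * (real C * r)"
proof -
  have fin: "finite J'" using J' finite_J finite_subset by blast
  have "(\<Sum>j\<in>J'. prob {S. j \<in> hits S \<and> B (hits S)})
    = measure_pmf.expectation M (\<lambda>S. real (card (hits S \<inter> J')) * indicator {S. B (hits S)} S)"
    using expectation_card_hits[OF J'] by simp
  also have "(\<lambda>S. real (card (hits S \<inter> J')) * indicator {S. B (hits S)} S) = (\<lambda>S. real c * indicator {S. B (hits S)} S)"
    using c[OF hits_subset] by (auto simp: indicator_def fun_eq_iff)
  finally have 1: "(\<Sum>j\<in>J'. prob {S. j \<in> hits S \<and> B (hits S)}) = real c * prob {S. B (hits S)}"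
    by simp
  have "\<bar>real c * prob {S. B (hits S)} - real (card J') * r ^ k * prob {S. B' (hits S)}\<bar>
    = \<bar>\<Sum>j\<in>J'. prob {S. j \<in> hits S \<and> B (hits S)} - r ^ k * prob {S. B' (hits S)}\<bar>"
    by (simp add: 1[symmetric] sum_subtractf)
  also have "\<dots> \<le> (\<Sum>j\<in>J'. \<bar>prob {S. j \<in> hits S \<and> B (hits S)} - r ^ k * prob {S. B' (hits S)}\<bar>)"
    by (rule sum_abs)
  also have "\<dots> \<le> (\<Sum>j\<in>J'. r ^ k * (real C * r))"
    using J' B by (intro sum_mono prob_hit_and) auto
  finally show ?thesis by simp
qed

text \<open>Markov's inequality for the number of hits.\<close>

lemma prob_many_hits:
  "prob {S. card (hits S) > m} \<le> real (card J) * r ^ k / real (Suc m)"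
proof -
  have "real (Suc m) * prob {S. card (hits S) > m}
    = measure_pmf.expectation M (\<lambda>S. real (Suc m) * indicator {S. card (hits S) > m} S)"
    by simp
  also have "\<dots> \<le> measure_pmf.expectation M (\<lambda>S. real (card (hits S \<inter> J)) * indicator {S. True} S)"
    using hits_subset
    by (intro integral_mono integrable_measure_pmf_finite finite_set_random_subset finite_E)
      (auto simp: indicator_def Int_absorb2)
  also have "\<dots> = (\<Sum>j\<in>J. prob {S. j \<in> hits S \<and> True})"
    by (rule expectation_card_hits) auto
  also have "\<dots> \<le> (\<Sum>j\<in>J. r ^ k)"
  proof (rule sum_mono)
    fix j assume j: "j \<in> J"
    have "prob {S. j \<in> hits S \<and> True} \<le> prob {S. D j \<subseteq> S}"
      using hit_D[OF j] by (intro measure_pmf.finite_measure_mono) (auto simp: hits_def)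
    then show "prob {S. j \<in> hits S \<and> True} \<le> r ^ k"
      using prob_subset[OF finite_E D_subset[OF j] r] card_D[OF j] by simp
  qed
  finally show ?thesis by (simp add: field_simps)
qed

lemma stein_card:
  "\<bar>real (Suc m) * prob {S. card (hits S) = Suc m} - real (card J) * r ^ k * prob {S. card (hits S) = m}\<bar>
    \<le> real (card J) * r ^ k * (real C * r)"
proof (rule stein[where B = "\<lambda>Q. card Q = Suc m" and B' = "\<lambda>Q. card Q = m", OF order_refl])
  show "card (insert j Q) = Suc m \<longleftrightarrow> card Q = m" if "Q \<subseteq> J" "j \<notin> Q" for j Q
    using that finite_J finite_subset[of Q J] by (simp add: card_insert_if)
qed (auto simp: Int_absorb2)

lemma stein_types:
  fixes \<tau> :: "'j \<Rightarrow> 't" and X :: "'t multiset"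
  shows "\<bar>real (Suc (count X t)) * prob {S. image_mset \<tau> (mset_set (hits S)) = add_mset t X}
      - real (card {j \<in> J. \<tau> j = t}) * r ^ k * prob {S. image_mset \<tau> (mset_set (hits S)) = X}\<bar>
    \<le> real (card {j \<in> J. \<tau> j = t}) * r ^ k * (real C * r)"
proof (rule stein[where B = "\<lambda>Q. image_mset \<tau> (mset_set Q) = add_mset t X" and B' = "\<lambda>Q. image_mset \<tau> (mset_set Q) = X"])
  show "card (Q \<inter> {j \<in> J. \<tau> j = t}) = Suc (count X t)"
    if "Q \<subseteq> J" "image_mset \<tau> (mset_set Q) = add_mset t X" for Q
  proof -
    have "finite Q" using that finite_J finite_subset by blast
    then have "count (image_mset \<tau> (mset_set Q)) t = card {j \<in> Q. \<tau> j = t}"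
      by (simp add: count_image_mset vimage_def Int_def conj_commute)
    moreover have "{j \<in> Q. \<tau> j = t} = Q \<inter> {j \<in> J. \<tau> j = t}" using that by auto
    ultimately show ?thesis using that by simp
  qed
  show "(image_mset \<tau> (mset_set (insert j Q)) = add_mset t X) = (image_mset \<tau> (mset_set Q) = X)"
    if "Q \<subseteq> J" "j \<in> {j \<in> J. \<tau> j = t}" "j \<notin> Q" for j Q
    using that finite_J finite_subset[of Q J] by simp
qed auto

end

section \<open>Poisson limits\<close>

lemma double_limit_convergent:
  fixes v l b :: "nat \<Rightarrow> real"
  assumes close: "\<And>m. \<forall>\<^sub>F n in sequentially. \<bar>v n - l m\<bar> \<le> b m" and b: "b \<longlonglongrightarrow> 0"
  shows "convergent v"
proof -
  have "Cauchy v"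
  proof (rule metric_CauchyI)
    fix e :: real assume "e > 0"
    then have "\<forall>\<^sub>F m in sequentially. b m < e / 2" using b by (intro order_tendstoD(2)[OF b]) auto
    then obtain m where m: "b m < e / 2" by (meson eventually_sequentially order_refl)
    obtain n0 where "\<And>n. n \<ge> n0 \<Longrightarrow> \<bar>v n - l m\<bar> \<le> b m" using close[of m] by (auto simp: eventually_sequentially)
    then have "dist (v n) (v n') < e" if "n \<ge> n0" "n' \<ge> n0" for n n'
      using m that by (smt (verit) dist_real_def field_sum_of_halves)
    then show "\<exists>M. \<forall>m\<ge>M. \<forall>n\<ge>M. dist (v m) (v n) < e" by blast
  qed
  then show ?thesis by (simp add: Cauchy_convergent_iff)
qed

lemma double_limit:
  fixes v l b :: "nat \<Rightarrow> real"
  assumes close: "\<And>m. \<forall>\<^sub>F n in sequentially. \<bar>v n - l m\<bar> \<le> b m" and b: "b \<longlonglongrightarrow> 0"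
    and l: "l \<longlonglongrightarrow> x"
  shows "v \<longlonglongrightarrow> x"
proof -
  obtain y where y: "v \<longlonglongrightarrow> y" using double_limit_convergent[OF close b] by (auto simp: convergent_def)
  have "\<bar>y - l m\<bar> \<le> b m" for m
    by (rule tendsto_upperbound[OF _ close[of m]]) (auto intro!: tendsto_intros y)
  then have "(\<lambda>m. y - l m) \<longlonglongrightarrow> 0"
    by (intro Lim_null_comparison[OF _ b]) auto
  then have "(\<lambda>m. y - (y - l m)) \<longlonglongrightarrow> y - 0" by (intro tendsto_intros)
  then have "l \<longlonglongrightarrow> y" by simp
  then show ?thesis using y l LIMSEQ_unique by blast
qed

lemma tendsto_0_mult_bounded:
  fixes f g :: "nat \<Rightarrow> real"
  assumes "f \<longlonglongrightarrow> 0" "\<forall>\<^sub>F n in sequentially. \<bar>g n\<bar> \<le> B"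
  shows "(\<lambda>n. f n * g n) \<longlonglongrightarrow> 0"
proof (rule Lim_null_comparison)
  show "\<forall>\<^sub>F n in sequentially. norm (f n * g n) \<le> \<bar>f n\<bar> * B"
    using assms(2) by eventually_elim (auto simp: abs_mult intro: mult_left_mono)
  show "(\<lambda>n. \<bar>f n\<bar> * B) \<longlonglongrightarrow> 0"
    using tendsto_mult_left_zero[OF tendsto_rabs_zero[OF assms(1)]] by simp
qed

text \<open>The recursion gives \<open>a n m \<approx> a n 0 * l ^ m / fact m\<close> for each \<open>m\<close>. As almost all mass sits on
  bounded \<open>m\<close>, the sum of these over \<open>m\<close> is close to \<open>1\<close>, that is, \<open>a n 0 * exp l \<approx> 1\<close>.\<close>

lemma poisson_zero_limit:
  fixes a :: "nat \<Rightarrow> nat \<Rightarrow> real" and \<mu> \<delta> :: "nat \<Rightarrow> real"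
  assumes a: "\<forall>\<^sub>F n in sequentially. (\<forall>m. 0 \<le> a n m \<and> a n m \<le> 1) \<and>
      (\<forall>m. \<bar>real (Suc m) * a n (Suc m) - \<mu> n * a n m\<bar> \<le> \<mu> n * \<delta> n) \<and>
      (\<forall>m. (\<Sum>i\<le>m. a n i) \<le> 1 \<and> 1 - (\<Sum>i\<le>m. a n i) \<le> \<mu> n / real (Suc m))"
    and \<mu>: "\<mu> \<longlonglongrightarrow> l" and \<delta>: "\<delta> \<longlonglongrightarrow> 0" and l: "l \<ge> 0"
  shows "(\<lambda>n. a n 0) \<longlonglongrightarrow> exp (- l)"
proof -
  have bd: "\<forall>\<^sub>F n in sequentially. \<bar>a n m\<bar> \<le> 1" for m
    using a by eventually_elim (auto simp: abs_le_iff intro: order_trans[of _ 0])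
  have rec: "(\<lambda>n. real (Suc m) * a n (Suc m) - \<mu> n * a n m) \<longlonglongrightarrow> 0" for m
  proof (rule Lim_null_comparison)
    show "\<forall>\<^sub>F n in sequentially. norm (real (Suc m) * a n (Suc m) - \<mu> n * a n m) \<le> \<mu> n * \<delta> n"
      using a by eventually_elim auto
    show "(\<lambda>n. \<mu> n * \<delta> n) \<longlonglongrightarrow> 0" using tendsto_mult[OF \<mu> \<delta>] by simp
  qed
  have each: "(\<lambda>n. a n m - a n 0 * (l ^ m / fact m)) \<longlonglongrightarrow> 0" for m
  proof (induction m)
    case (Suc m)
    have "(\<lambda>n. (real (Suc m) * a n (Suc m) - \<mu> n * a n m) / real (Suc m)
        + (\<mu> n - l) * a n m / real (Suc m) + l / real (Suc m) * (a n m - a n 0 * (l ^ m / fact m))) \<longlonglongrightarrow> 0 / real (Suc m) + 0 / real (Suc m) + l / real (Suc m) * 0"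
    proof (intro tendsto_add tendsto_divide tendsto_mult tendsto_const rec Suc)
      show "(\<lambda>n. (\<mu> n - l) * a n m) \<longlonglongrightarrow> 0"
        using \<mu> by (intro tendsto_0_mult_bounded[OF _ bd]) (simp add: LIM_zero)
    qed auto
    moreover have "(real (Suc m) * a n (Suc m) - \<mu> n * a n m) / real (Suc m)
        + (\<mu> n - l) * a n m / real (Suc m) + l / real (Suc m) * (a n m - a n 0 * (l ^ m / fact m))
      = a n (Suc m) - a n 0 * (l ^ Suc m / fact (Suc m))" for n
      by (simp add: field_simps del: of_nat_Suc)
    ultimately show ?case by simp
  qed simp
  define e where "e m = (\<Sum>i\<le>m. l ^ i / fact i)" for m
  have e1: "e m \<ge> 1" for m
  proof -
    have "(\<Sum>i\<in>{0}. l ^ i / fact i) \<le> e m" unfolding e_def using l by (intro sum_mono2) auto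
    then show ?thesis by simp
  qed
  have sum: "(\<lambda>n. (\<Sum>i\<le>m. a n i) - a n 0 * e m) \<longlonglongrightarrow> 0" for m
  proof -
    have "(\<lambda>n. \<Sum>i\<le>m. (a n i - a n 0 * (l ^ i / fact i))) \<longlonglongrightarrow> (\<Sum>i\<le>m. 0)"
      by (intro tendsto_sum each)
    then show ?thesis by (simp add: sum_subtractf e_def sum_distrib_left)
  qed
  show ?thesis
  proof (rule double_limit[where l = "\<lambda>m. 1 / e m" and b = "\<lambda>m. (l + 2) * inverse (real (Suc m))"])
    fix m
    have "\<forall>\<^sub>F n in sequentially. \<bar>(\<Sum>i\<le>m. a n i) - a n 0 * e m\<bar> < inverse (real (Suc m))"
      using tendstoD[OF sum[of m], of "inverse (real (Suc m))"] by (simp add: dist_real_def)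
    moreover have "\<forall>\<^sub>F n in sequentially. \<mu> n < l + 1"
      by (rule order_tendstoD(2)[OF \<mu>]) simp
    ultimately show "\<forall>\<^sub>F n in sequentially. \<bar>a n 0 - 1 / e m\<bar> \<le> (l + 2) * inverse (real (Suc m))"
      using a
    proof eventually_elim
      case (elim n)
      have "\<mu> n / real (Suc m) \<le> (l + 1) * inverse (real (Suc m))"
        unfolding divide_inverse using elim(2) by (intro mult_right_mono) auto
      moreover have "(l + 2) * inverse (real (Suc m)) = (l + 1) * inverse (real (Suc m)) + inverse (real (Suc m))"
        by (simp add: algebra_simps)
      moreover have "1 - (\<Sum>i\<le>m. a n i) \<le> \<mu> n / real (Suc m)" "(\<Sum>i\<le>m. a n i) \<le> 1"
        using elim(3) by auto
      ultimately have "\<bar>a n 0 * e m - 1\<bar> \<le> (l + 2) * inverse (real (Suc m))"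
        using elim(1) by linarith
      moreover have "\<bar>a n 0 - 1 / e m\<bar> \<le> \<bar>a n 0 * e m - 1\<bar>"
      proof -
        have "a n 0 * e m - 1 = e m * (a n 0 - 1 / e m)" using e1[of m] by (simp add: field_simps)
        then have "\<bar>a n 0 * e m - 1\<bar> = e m * \<bar>a n 0 - 1 / e m\<bar>" using e1[of m] by (simp add: abs_mult)
        then show ?thesis using mult_right_mono[OF e1[of m], of "\<bar>a n 0 - 1 / e m\<bar>"] by simp
      qed
      ultimately show ?case by linarith
    qed
  next
    show "(\<lambda>m. (l + 2) * inverse (real (Suc m))) \<longlonglongrightarrow> 0"
      using tendsto_mult[OF tendsto_const LIMSEQ_inverse_real_of_nat, of "l + 2"] by simp
  next
    have "(\<lambda>i. l ^ i / fact i) sums exp l"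
      using exp_converges[of l] by (simp add: field_simps)
    then have "e \<longlonglongrightarrow> exp l" by (simp add: sums_def_le e_def[abs_def])
    then have "(\<lambda>m. 1 / e m) \<longlonglongrightarrow> 1 / exp l" by (intro tendsto_intros) auto
    then show "(\<lambda>m. 1 / e m) \<longlonglongrightarrow> exp (- l)" by (simp add: exp_minus field_simps)
  qed
qed

lemma le_of_abs_diff_le: "\<bar>a - b\<bar> \<le> c \<Longrightarrow> a \<le> e \<Longrightarrow> b \<le> e + c" for a b c e :: real
  by linarith

lemma le_divide_add: "0 < m \<Longrightarrow> m * p \<le> s + m * c \<Longrightarrow> p \<le> s / m + c" for m p s c :: real
  by (simp add: field_simps)

text \<open>As \<open>k\<close> and \<open>C\<close> do not depend on \<open>n\<close>, the relative error \<open>C * r n\<close> in Stein's identity vanishes in the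
  limit.\<close>

locale planted_sequence =
  fixes E :: "nat \<Rightarrow> 'e set" and r :: "nat \<Rightarrow> real" and J :: "nat \<Rightarrow> 'j set"
    and D N :: "nat \<Rightarrow> 'j \<Rightarrow> 'e set"
    and hit :: "nat \<Rightarrow> 'j \<Rightarrow> 'e set \<Rightarrow> bool" and k C :: nat
  assumes fam: "\<forall>\<^sub>F n in sequentially. planted_family (E n) (r n) (J n) (D n) (N n) (hit n) k C"
    and r_0: "r \<longlonglongrightarrow> 0"
begin

abbreviation pr :: "nat \<Rightarrow> ('e set \<Rightarrow> bool) \<Rightarrow> real" where
  "pr n P \<equiv> subset_prob (E n) (r n) {S. P S}"

abbreviation H :: "nat \<Rightarrow> 'e set \<Rightarrow> 'j set" where
  "H n S \<equiv> planted_family.hits (J n) (hit n) S"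

abbreviation \<mu> :: "nat \<Rightarrow> real" where "\<mu> n \<equiv> real (card (J n)) * r n ^ k"

lemma spoil_rate_0: "(\<lambda>n. real C * r n) \<longlonglongrightarrow> 0"
  using tendsto_mult_right_zero[OF r_0] by simp

text \<open>If the mean tends to infinity, the identity bounds the probability of exactly \<open>m\<close> hits by
  \<open>(m + 1) / \<mu>\<close> up to an error of order \<open>r\<close>.\<close>

lemma few_hits_unlikely:
  assumes "filterlim \<mu> at_top sequentially"
  shows "(\<lambda>n. pr n (\<lambda>S. card (H n S) = m)) \<longlonglongrightarrow> 0"
proof (rule tendsto_sandwich)
  show "(\<lambda>_. 0) \<longlonglongrightarrow> (0::real)" by simp
  show "\<forall>\<^sub>F n in sequentially. pr n (\<lambda>S. card (H n S) = m) \<le> real (Suc m) / \<mu> n + real C * r n"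
    using fam filterlim_at_top_dense[THEN iffD1, OF assms, rule_format, of 0]
  proof eventually_elim
    case (elim n)
    interpret planted_family "E n" "r n" "J n" "D n" "N n" "hit n" k C by (rule elim(1))
    let ?p = "pr n (\<lambda>S. card (H n S) = m)" and ?q = "pr n (\<lambda>S. card (H n S) = Suc m)"
    have "real (Suc m) * ?q \<le> real (Suc m) * 1" by (intro mult_left_mono) auto
    then have "\<mu> n * ?p \<le> real (Suc m) + \<mu> n * (real C * r n)"
      using le_of_abs_diff_le[OF stein_card[of m]] by simp
    then show ?case by (rule le_divide_add[OF elim(2)])
  qed
  have "(\<lambda>n. real (Suc m) / \<mu> n) \<longlonglongrightarrow> 0"
    by (rule tendsto_divide_0[OF tendsto_const]) (use assms filterlim_at_top_imp_at_infinity in blast)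
  from tendsto_add[OF this spoil_rate_0] show "(\<lambda>n. real (Suc m) / \<mu> n + real C * r n) \<longlonglongrightarrow> 0" by simp
qed simp

lemma many_hits_unlikely:
  assumes "\<mu> \<longlonglongrightarrow> l"
  shows "\<forall>\<^sub>F n in sequentially. pr n (\<lambda>S. card (H n S) > m) \<le> (l + 1) * inverse (real (Suc m))"
  using fam order_tendstoD(2)[OF assms, of "l + 1", simplified]
proof eventually_elim
  case (elim n)
  interpret planted_family "E n" "r n" "J n" "D n" "N n" "hit n" k C by (rule elim(1))
  have "pr n (\<lambda>S. card (H n S) > m) \<le> \<mu> n / real (Suc m)" using prob_many_hits[of m] .
  also have "\<dots> \<le> (l + 1) * inverse (real (Suc m))"
    unfolding divide_inverse using elim(2) by (intro mult_right_mono) auto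
  finally show ?case .
qed

lemma no_hit_limit:
  assumes "\<mu> \<longlonglongrightarrow> l" "l \<ge> 0"
  shows "(\<lambda>n. pr n (\<lambda>S. H n S = {})) \<longlonglongrightarrow> exp (- l)"
proof -
  have "(\<lambda>n. pr n (\<lambda>S. card (H n S) = 0)) \<longlonglongrightarrow> exp (- l)"
  proof (rule poisson_zero_limit[OF _ assms(1) spoil_rate_0 assms(2)])
    show "\<forall>\<^sub>F n in sequentially. (\<forall>m. 0 \<le> pr n (\<lambda>S. card (H n S) = m) \<and> pr n (\<lambda>S. card (H n S) = m) \<le> 1) \<and>
      (\<forall>m. \<bar>real (Suc m) * pr n (\<lambda>S. card (H n S) = Suc m) - \<mu> n * pr n (\<lambda>S. card (H n S) = m)\<bar>
         \<le> \<mu> n * (real C * r n)) \<and>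
      (\<forall>m. (\<Sum>i\<le>m. pr n (\<lambda>S. card (H n S) = i)) \<le> 1 \<and>
         1 - (\<Sum>i\<le>m. pr n (\<lambda>S. card (H n S) = i)) \<le> \<mu> n / real (Suc m))"
      using fam
    proof eventually_elim
      case (elim n)
      interpret planted_family "E n" "r n" "J n" "D n" "N n" "hit n" k C by (rule elim(1))
      have sum: "(\<Sum>i\<le>m. pr n (\<lambda>S. card (H n S) = i)) = 1 - pr n (\<lambda>S. card (H n S) > m)" for m
      proof -
        have "(\<Sum>i\<le>m. pr n (\<lambda>S. card (H n S) = i)) = subset_prob (E n) (r n) (\<Union>i\<le>m. {S. card (H n S) = i})"
          by (rule measure_pmf.finite_measure_finite_Union[symmetric]) (auto simp: disjoint_family_on_def)
        also have "(\<Union>i\<le>m. {S. card (H n S) = i}) = space (measure_pmf (random_subset (E n) (r n))) - {S. card (H n S) > m}"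
          by auto
        also have "subset_prob (E n) (r n) \<dots> = 1 - pr n (\<lambda>S. card (H n S) > m)"
          by (rule measure_pmf.prob_compl) auto
        finally show ?thesis .
      qed
      show ?case
        using stein_card prob_many_hits by (auto simp: sum)
    qed
  qed
  then show ?thesis
  proof (rule Lim_transform_eventually)
    show "\<forall>\<^sub>F n in sequentially. pr n (\<lambda>S. card (H n S) = 0) = pr n (\<lambda>S. H n S = {})"
      using fam
    proof eventually_elim
      case (elim n)
      interpret planted_family "E n" "r n" "J n" "D n" "N n" "hit n" k C by (rule elim(1))
      show ?case using finite_hits by simp
    qed
  qed
qed

text \<open>Let \<open>\<tau>\<close> assign types to the events, and record the multiset of types that occur. Adding one type
  to the multiset multiplies the limit of the probability by a constant, and the empty multiset
  has the limit from \<open>no_hit_limit\<close>. (The limits describe independent Poisson variables, one for each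
  type.)\<close>

lemma type_limit:
  fixes \<tau> :: "'j \<Rightarrow> 't"
  assumes "\<mu> \<longlonglongrightarrow> l" "l \<ge> 0"
    and types: "\<And>t. \<exists>x. (\<lambda>n. real (card {j \<in> J n. \<tau> j = t}) * r n ^ k) \<longlonglongrightarrow> x"
  shows "convergent (\<lambda>n. pr n (\<lambda>S. image_mset \<tau> (mset_set (H n S)) = X))"
proof (induction X)
  case empty
  have "(\<lambda>n. pr n (\<lambda>S. image_mset \<tau> (mset_set (H n S)) = {#})) \<longlonglongrightarrow> exp (- l)"
    using no_hit_limit[OF assms(1,2)]
  proof (rule Lim_transform_eventually)
    show "\<forall>\<^sub>F n in sequentially. pr n (\<lambda>S. H n S = {}) = pr n (\<lambda>S. image_mset \<tau> (mset_set (H n S)) = {#})"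
      using fam
    proof eventually_elim
      case (elim n)
      interpret planted_family "E n" "r n" "J n" "D n" "N n" "hit n" k C by (rule elim(1))
      show ?case using finite_hits by (simp add: mset_set_empty_iff)
    qed
  qed
  then show ?case by (auto simp: convergent_def)
next
  case (add t X)
  let ?p = "\<lambda>n. pr n (\<lambda>S. image_mset \<tau> (mset_set (H n S)) = X)"
  let ?q = "\<lambda>n. pr n (\<lambda>S. image_mset \<tau> (mset_set (H n S)) = add_mset t X)"
  let ?m = "\<lambda>n. real (card {j \<in> J n. \<tau> j = t}) * r n ^ k"
  obtain x where x: "?m \<longlonglongrightarrow> x" using types by blast
  obtain y where y: "?p \<longlonglongrightarrow> y" using add by (auto simp: convergent_def)
  have "(\<lambda>n. real (Suc (count X t)) * ?q n - ?m n * ?p n) \<longlonglongrightarrow> 0"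
  proof (rule Lim_null_comparison)
    show "\<forall>\<^sub>F n in sequentially. norm (real (Suc (count X t)) * ?q n - ?m n * ?p n) \<le> ?m n * (real C * r n)"
      using fam
    proof eventually_elim
      case (elim n)
      interpret planted_family "E n" "r n" "J n" "D n" "N n" "hit n" k C by (rule elim)
      show ?case using stein_types[of X t \<tau>] by simp
    qed
    show "(\<lambda>n. ?m n * (real C * r n)) \<longlonglongrightarrow> 0" using tendsto_mult[OF x spoil_rate_0] by simp
  qed
  from tendsto_add[OF this tendsto_mult[OF x y]]
  have "(\<lambda>n. real (Suc (count X t)) * ?q n) \<longlonglongrightarrow> x * y" by simp
  from tendsto_divide[OF this tendsto_const[of "real (Suc (count X t))"]]
  have "?q \<longlonglongrightarrow> x * y / real (Suc (count X t))" by (simp del: of_nat_Suc)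
  then show ?case by (auto simp: convergent_def)
qed

text \<open>Only finitely many multisets have at most \<open>m\<close> elements, and larger ones have small probability
  uniformly in \<open>n\<close>.\<close>

lemma type_event_convergent:
  fixes \<tau> :: "'j \<Rightarrow> 't" and A :: "'t multiset set"
  assumes \<mu>: "\<mu> \<longlonglongrightarrow> l" "l \<ge> 0"
    and types: "\<And>t. \<exists>x. (\<lambda>n. real (card {j \<in> J n. \<tau> j = t}) * r n ^ k) \<longlonglongrightarrow> x"
    and T: "finite T" "\<forall>\<^sub>F n in sequentially. \<tau> ` J n \<subseteq> T"
  shows "convergent (\<lambda>n. pr n (\<lambda>S. image_mset \<tau> (mset_set (H n S)) \<in> A))"
proof -
  let ?Y = "\<lambda>n S. image_mset \<tau> (mset_set (H n S))"
  define Z where "Z m = {X \<in> A. set_mset X \<subseteq> T \<and> size X \<le> m}" for m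
  have finZ: "finite (Z m)" for m
  proof (rule finite_subset)
    show "Z m \<subseteq> mset ` {xs. set xs \<subseteq> T \<and> length xs \<le> m}"
    proof
      fix X assume X: "X \<in> Z m"
      obtain xs where "mset xs = X" using ex_mset by blast
      then show "X \<in> mset ` {xs. set xs \<subseteq> T \<and> length xs \<le> m}" using X by (auto simp: Z_def intro!: image_eqI[of _ _ xs])
    qed
    show "finite (mset ` {xs. set xs \<subseteq> T \<and> length xs \<le> m})" using finite_lists_length_le[OF T(1)] by simp
  qed
  have conv: "convergent (\<lambda>n. pr n (\<lambda>S. ?Y n S \<in> Z m))" for m
  proof -
    have "pr n (\<lambda>S. ?Y n S \<in> Z m) = (\<Sum>X\<in>Z m. pr n (\<lambda>S. ?Y n S = X))" for n
    proof -
      have "{S. ?Y n S \<in> Z m} = (\<Union>X\<in>Z m. {S. ?Y n S = X})" by auto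
      then show ?thesis
        using finZ by (simp only:) (rule measure_pmf.finite_measure_finite_Union, auto simp: disjoint_family_on_def)
    qed
    then show ?thesis using type_limit[OF \<mu> types] by (simp add: convergent_sum)
  qed
  define y where "y m = lim (\<lambda>n. pr n (\<lambda>S. ?Y n S \<in> Z m))" for m
  have y: "(\<lambda>n. pr n (\<lambda>S. ?Y n S \<in> Z m)) \<longlonglongrightarrow> y m" for m
    using conv[of m] by (simp add: y_def convergent_LIMSEQ_iff)
  show ?thesis
  proof (rule double_limit_convergent[where l = y and b = "\<lambda>m. (l + 2) * inverse (real (Suc m))"])
    fix m
    have "\<forall>\<^sub>F n in sequentially. \<bar>pr n (\<lambda>S. ?Y n S \<in> Z m) - y m\<bar> < inverse (real (Suc m))"
      using tendstoD[OF y[of m], of "inverse (real (Suc m))"] by (simp add: dist_real_def)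
    then show "\<forall>\<^sub>F n in sequentially. \<bar>pr n (\<lambda>S. ?Y n S \<in> A) - y m\<bar> \<le> (l + 2) * inverse (real (Suc m))"
      using fam T(2) many_hits_unlikely[OF \<mu>(1), of m]
    proof eventually_elim
      case (elim n)
      interpret planted_family "E n" "r n" "J n" "D n" "N n" "hit n" k C by (rule elim(2))
      have "\<bar>pr n (\<lambda>S. ?Y n S \<in> A) - pr n (\<lambda>S. ?Y n S \<in> Z m)\<bar> \<le> pr n (\<lambda>S. card (H n S) > m)"
      proof (rule prob_diff_le)
        fix S assume "\<not> card (H n S) > m"
        then have "size (?Y n S) \<le> m" "set_mset (?Y n S) \<subseteq> T"
          using elim(3) hits_subset finite_hits by (auto simp: finite_set_mset_mset_set)
        then show "?Y n S \<in> A \<longleftrightarrow> ?Y n S \<in> Z m" by (simp add: Z_def)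
      qed
      moreover have "(l + 2) * inverse (real (Suc m)) = (l + 1) * inverse (real (Suc m)) + inverse (real (Suc m))"
        by (simp add: algebra_simps)
      ultimately show ?case using elim(1,4) by linarith
    qed
  next
    show "(\<lambda>m. (l + 2) * inverse (real (Suc m))) \<longlonglongrightarrow> 0"
      using tendsto_mult[OF tendsto_const LIMSEQ_inverse_real_of_nat, of "l + 2"] by simp
  qed
qed

end

section \<open>Patterns as a planted family\<close>

context torus
begin

lemma near_if_edges_meet:
  assumes "L > 0" "y \<in> V L" "\<sigma> \<in> Window R" "\<sigma>' \<in> Window R" "edge L y \<sigma>' = edge L x \<sigma>"
  obtains v where "v \<in> Box (2 * R + 1)" "y = shift L x v"
proof -
  obtain u i u' i' where [simp]: "\<sigma> = (u, i)" "\<sigma>' = (u', i')" by fastforce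
  have b: "u \<in> Box R" "u' \<in> Box R" "i < d" using assms by (auto simp: window_def)
  have "shift L y u' = shift L x u \<or> shift L y u' = shift L x (u + unit i)"
    using assms(5) by (auto simp: edge_def doubleton_eq_iff)
  moreover have "y = shift L x (a - u')" if "shift L y u' = shift L x a" for a
  proof -
    have "shift L (shift L y u') (- u') = shift L (shift L x a) (- u')" using that by simp
    then show ?thesis using assms(1,2) by (simp add: shift_shift shift_0)
  qed
  moreover have "u - u' \<in> Box (2 * R + 1)"
    using box_diff[OF b(1,2)] by (rule box_mono[rotated]) simp
  moreover have "u + unit i - u' \<in> Box (2 * R + 1)"
    using box_diff[OF box_add[OF b(1) unit_in_box[OF b(3)]] b(2)] by (rule box_mono[rotated]) simp
  ultimately show ?thesis using that by blast
qed

lemma translate_window: "v \<in> Box s \<Longrightarrow> w \<subseteq> Window r \<Longrightarrow> translate v w \<subseteq> Window (r + s)"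
  by (auto simp: translate_def window_def intro: box_add)

text \<open>The two vertices are close to each other, so both sets of edges can be described in one window
  around \<open>x\<close>, on which slots and edges correspond to each other.\<close>

lemma translate_if_edges_eq:
  assumes L: "L > 6 * R + 4" and y: "y \<in> V L" and w: "w \<subseteq> Window R" "w \<noteq> {}" "w' \<subseteq> Window R"
    and eq: "edge L y ` w' = edge L x ` w"
  obtains v where "y = shift L x v" "translate v w' = w"
proof -
  obtain \<sigma> where \<sigma>: "\<sigma> \<in> w" using w by blast
  then obtain \<sigma>' where \<sigma>': "\<sigma>' \<in> w'" "edge L y \<sigma>' = edge L x \<sigma>" using eq by (metis image_iff)
  obtain v where v: "v \<in> Box (2 * R + 1)" "y = shift L x v"
    using near_if_edges_meet[OF _ y _ _ \<sigma>'(2)] \<sigma> \<sigma>'(1) w L by (metis subsetD gr_implies_not0 not_gr_zero)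
  have "edge L x ` translate v w' = edge L x ` w"
    using eq v(2) L by (simp add: edge_image_shift)
  moreover have "translate v w' \<subseteq> Window (3 * R + 1)"
    using translate_window[OF v(1) w(3)] by (simp add: numeral_3_eq_3 mult_2)
  moreover have "w \<subseteq> Window (3 * R + 1)" using w(1) window_mono[of R "3 * R + 1"] by auto
  moreover have "inj_on (edge L x) (Window (3 * R + 1))" using L by (intro edge_inj_on) auto
  ultimately have "translate v w' = w" by (meson inj_on_image_eq_iff)
  then show ?thesis using that v(2) by blast
qed

text \<open>A cluster of \<open>k\<close> marks is seen as different translates of one pattern from different vertices. To
  count it only once, only one pattern of each translation class may be used.\<close>

definition inequivalent :: "nat \<Rightarrow> nat \<Rightarrow> slot set set \<Rightarrow> bool" where
  "inequivalent R k T \<longleftrightarrow> (\<forall>w\<in>T. w \<subseteq> Window R \<and> card w = k) \<and>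
     (\<forall>w\<in>T. \<forall>v. translate v w \<in> T \<longrightarrow> translate v w = w)"

lemma inequivalent_finite: "inequivalent R k T \<Longrightarrow> finite T"
  by (rule finite_subset[of _ "Pow (Window R)"]) (auto simp: inequivalent_def finite_window)

text \<open>The hits are the pairs of a vertex \<open>x\<close> and a pattern \<open>w\<close> in \<open>T\<close> that is seen at \<open>x\<close>. The window of radius
  \<open>3 * R + 1\<close> around \<open>x\<close> contains every window of radius \<open>R\<close> that meets the planted edges. If there
  are no marks in it, then after planting these windows show planted edges only; and since
  all patterns in \<open>T\<close> have \<open>k\<close> slots, one of them is seen at \<open>y\<close> only if it consists of all
  planted edges. As \<open>T\<close> contains no two translates, this happens only at \<open>x\<close> itself.\<close>

lemma planted_patterns:
  assumes T: "inequivalent R k T" and k: "k \<ge> 1" and L: "L > 6 * R + 4" and r: "0 \<le> r" "r \<le> 1"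
  shows "planted_family (E L) r (V L \<times> T) (\<lambda>(x, w). edge L x ` w)
    (\<lambda>(x, w). edge L x ` Window (3 * R + 1)) (\<lambda>(x, w) S. pattern L S R x = w) k (card (Window (3 * R + 1)))"
proof unfold_locales
  have WR: "Window R \<subseteq> Window (3 * R + 1)" by (rule window_mono) simp
  have inj3: "inj_on (edge L x) (Window (3 * R + 1))" for x using L by (intro edge_inj_on) auto
  have inj: "inj_on (edge L x) (Window R)" for x using inj3 WR by (rule inj_on_subset)
  have w: "w \<subseteq> Window R" "card w = k" "w \<noteq> {}" "finite w" if "w \<in> T" for w
    using that T k finite_window finite_subset[of w "Window R"] by (auto simp: inequivalent_def)
  have inE: "edge L x ` W \<subseteq> E L" if "W \<subseteq> Window q" for x W q
    using that L by (auto intro!: edge_in_E simp: window_def)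
  show "finite (E L)" by (rule finite_torus_edges)
  show "finite (V L \<times> T)" using finite_V inequivalent_finite[OF T] by simp
  show "0 \<le> r" "r \<le> 1" by fact+
  fix j assume "j \<in> V L \<times> T"
  then obtain x t where j: "j = (x, t)" "x \<in> V L" "t \<in> T" by auto
  show "(case j of (x, w) \<Rightarrow> edge L x ` w) \<subseteq> E L" using inE[OF w(1)[OF j(3)]] j(1) by simp
  show "card (case j of (x, w) \<Rightarrow> edge L x ` w) = k"
    using j w card_image[OF inj_on_subset[OF inj]] by auto
  show "(case j of (x, w) \<Rightarrow> edge L x ` Window (3 * R + 1)) \<subseteq> E L" using inE[OF order_refl] j(1) by simp
  show "card (case j of (x, w) \<Rightarrow> edge L x ` Window (3 * R + 1)) \<le> card (Window (3 * R + 1))"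
    using j by (auto intro: card_image_le finite_window)
  show "(case j of (x, w) \<Rightarrow> \<lambda>S. pattern L S R x = w) S \<Longrightarrow> (case j of (x, w) \<Rightarrow> edge L x ` w) \<subseteq> S" for S
    using j by (auto simp: pattern_def)
  show no_hit: "\<not> (case j of (x, w) \<Rightarrow> \<lambda>S. pattern L S R x = w) S"
    if "S \<inter> (case j of (x, w) \<Rightarrow> edge L x ` Window (3 * R + 1)) = {}" for S
  proof -
    have "pattern L S R x = {}" using that j WR by (auto simp: pattern_def)
    then show ?thesis using j(1) w(3)[OF j(3)] by auto
  qed
  fix S i assume S: "S \<inter> (case j of (x, w) \<Rightarrow> edge L x ` Window (3 * R + 1)) = {}" and "i \<in> V L \<times> T"
  then obtain y t' where i: "i = (y, t')" "y \<in> V L" "t' \<in> T" by auto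
  have S0: "S \<inter> edge L x ` Window (3 * R + 1) = {}" using S j by simp
  have "pattern L (S \<union> edge L x ` t) R y = t' \<longleftrightarrow> (y, t') = (x, t) \<or> pattern L S R y = t'"
  proof (cases "\<exists>\<sigma>'\<in>Window R. edge L y \<sigma>' \<in> edge L x ` t")
    case False
    then have "pattern L (S \<union> edge L x ` t) R y = pattern L S R y" by (auto simp: pattern_def)
    moreover have "(y, t') \<noteq> (x, t)" using False w(1,3)[OF j(3)] by blast
    ultimately show ?thesis by auto
  next
    case True
    then obtain \<sigma>' \<sigma> where \<sigma>: "\<sigma>' \<in> Window R" "\<sigma> \<in> t" "edge L y \<sigma>' = edge L x \<sigma>" by auto
    have "0 < L" "\<sigma> \<in> Window R" using L \<sigma>(2) w(1)[OF j(3)] by auto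
    from near_if_edges_meet[OF this(1) i(2) this(2) \<sigma>(1,3)]
    obtain v where v: "v \<in> Box (2 * R + 1)" "y = shift L x v" .
    have "edge L y \<rho> \<in> edge L x ` Window (3 * R + 1)" if "\<rho> \<in> Window R" for \<rho>
    proof -
      have "(fst \<rho> + v, snd \<rho>) \<in> Window (3 * R + 1)"
        using box_add[of "fst \<rho>" d R v "2 * R + 1"] v(1) that by (auto simp: window_def numeral_3_eq_3 mult_2)
      then show ?thesis using v(2) L by (simp add: edge_shift)
    qed
    then have notS: "edge L y \<rho> \<notin> S" if "\<rho> \<in> Window R" for \<rho> using S0 that by blast
    then have empty: "pattern L S R y = {}" by (auto simp: pattern_def)
    have pat: "pattern L (S \<union> edge L x ` t) R y = {\<rho> \<in> Window R. edge L y \<rho> \<in> edge L x ` t}"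
      using notS by (auto simp: pattern_def)
    have "(y, t') = (x, t)" if "pattern L (S \<union> edge L x ` t) R y = t'"
    proof -
      have "edge L y ` t' \<subseteq> edge L x ` t" using that pat by auto
      moreover have "card (edge L y ` t') = k" "card (edge L x ` t) = k"
        using w j(3) i(3) card_image[OF inj_on_subset[OF inj]] by metis+
      ultimately have "edge L y ` t' = edge L x ` t"
        using w(4)[OF j(3)] by (intro card_subset_eq) auto
      from translate_if_edges_eq[OF L i(2) w(1,3)[OF j(3)] w(1)[OF i(3)] this]
      obtain z where z: "y = shift L x z" "translate z t' = t" .
      then have "t' = t" using T i(3) j(3) unfolding inequivalent_def by blast
      then have "z = 0" using z(2) translate_fixed w(3,4) j(3) by blast
      then show ?thesis using z(1) \<open>t' = t\<close> shift_0[OF j(2)] by simp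
    qed
    moreover have "pattern L (S \<union> edge L x ` t) R x = t" if "y = x"
    proof -
      have "edge L x \<rho> \<in> edge L x ` t \<longleftrightarrow> \<rho> \<in> t" if "\<rho> \<in> Window R" for \<rho>
        using inj_on_image_mem_iff[OF inj that w(1)[OF j(3)]] .
      then show ?thesis using pat that w(1)[OF j(3)] by auto
    qed
    ultimately show ?thesis using empty w(3)[OF i(3)] by auto
  qed
  then show "(case i of (x, w) \<Rightarrow> \<lambda>S. pattern L S R x = w) (S \<union> (case j of (x, w) \<Rightarrow> edge L x ` w)) =
    (i = j \<or> (case i of (x, w) \<Rightarrow> \<lambda>S. pattern L S R x = w) S)"
    using i j by simp
qed

text \<open>Any choice that depends only on the translation class will do. For \<open>w\<close> inside the window there is
  one, since \<open>w\<close> itself is a candidate.\<close>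

definition rep :: "nat \<Rightarrow> slot set \<Rightarrow> slot set" where
  "rep R w = (SOME w'. w' \<subseteq> Window R \<and> (\<exists>v. w' = translate v w))"

lemma rep:
  assumes "w \<subseteq> Window R"
  shows "rep R w \<subseteq> Window R" "\<exists>v. rep R w = translate v w"
proof -
  have "w \<subseteq> Window R \<and> (\<exists>v. w = translate v w)" using assms translate_0[of w] by metis
  from someI[of "\<lambda>w'. w' \<subseteq> Window R \<and> (\<exists>v. w' = translate v w)", OF this]
  show "rep R w \<subseteq> Window R" "\<exists>v. rep R w = translate v w" unfolding rep_def by auto
qed

lemma translate_minus: "translate (- v) (translate v w) = w" "translate v (translate (- v) w) = w"
  by (simp_all add: translate_translate)

lemma rep_translate: "rep R (translate v w) = rep R w"
proof -
  have "(\<exists>u. w' = translate u (translate v w)) \<longleftrightarrow> (\<exists>u. w' = translate u w)" for w'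
    using translate_minus(1)[of v w] by (metis translate_translate)
  then show ?thesis by (simp add: rep_def)
qed

lemma inequivalent_reps:
  assumes "\<And>w. w \<in> Q \<Longrightarrow> w \<subseteq> Window R \<and> card w = k"
  shows "inequivalent R k (rep R ` Q)"
proof -
  have 1: "rep R w \<subseteq> Window R \<and> card (rep R w) = k" if "w \<in> Q" for w
    using rep[of w R] assms[OF that] card_translate by metis
  have 2: "rep R w' = rep R w" if "translate v (rep R w) = rep R w'" "w \<in> Q" "w' \<in> Q" for v w w'
  proof -
    have "rep R (rep R u) = rep R u" if "u \<in> Q" for u
      using rep(2)[of u R] assms[OF that] rep_translate by metis
    then show ?thesis using that rep_translate by metis
  qed
  show ?thesis
    unfolding inequivalent_def
  proof (intro conjI ballI allI impI)
    fix t v assume t: "t \<in> rep R ` Q"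
    then show "t \<subseteq> Window R" "card t = k" using 1 by auto
    assume "translate v t \<in> rep R ` Q"
    with t obtain w w' where "w \<in> Q" "t = rep R w" "w' \<in> Q" "translate v t = rep R w'" by blast
    then show "translate v t = t" using 2[of v w w'] by simp
  qed
qed

text \<open>On a sparse torus a pattern with \<open>k\<close> marks is seen from all vertices from which its marks are
  within reach, and the number of times it occurs depends only on its
  translation class.\<close>

definition sparse :: "nat \<Rightarrow> (nat \<Rightarrow> nat) set set \<Rightarrow> nat \<Rightarrow> nat \<Rightarrow> bool" where
  "sparse L S R k \<longleftrightarrow> (\<forall>x\<in>V L. card (pattern L S R x) \<le> k)"

lemma sparse_pattern_eq:
  assumes "sparse L S R k" "x \<in> V L" "w \<subseteq> pattern L S R x" "card w = k"
  shows "pattern L S R x = w"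
proof -
  have "finite (pattern L S R x)" using pattern_subset finite_window finite_subset by metis
  then show ?thesis using assms card_seteq[of "pattern L S R x" w] by (simp add: sparse_def)
qed

lemma sparse_pattern_translate:
  assumes "sparse L S R k" "L > 0" "translate v w \<subseteq> Window R" "card w = k" "pattern L S R x = w"
  shows "pattern L S R (shift L x (- v)) = translate v w"
proof (rule sparse_pattern_eq[OF assms(1) shift_in_V[OF assms(2)]])
  have "edge L (shift L x (- v)) ` translate v w = edge L x ` w"
    by (simp add: edge_image_shift[OF assms(2)] translate_minus)
  moreover have "edge L x ` w \<subseteq> S" using assms(5) by (auto simp: pattern_def)
  ultimately have "edge L (shift L x (- v)) ` translate v w \<subseteq> S" by simp
  then show "translate v w \<subseteq> pattern L S R (shift L x (- v))"
    using assms(3) unfolding pattern_def by blast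
  show "card (translate v w) = k" using assms(4) by (simp add: card_translate)
qed

lemma sparse_count_le:
  assumes "sparse L S R k" "L > 0" "translate v w \<subseteq> Window R" "card w = k"
  shows "card (occurrences L S R w) \<le> card (occurrences L S R (translate v w))"
proof (rule card_inj_on_le[where f = "\<lambda>x. shift L x (- v)"])
  show "inj_on (\<lambda>x. shift L x (- v)) (occurrences L S R w)"
  proof (rule inj_on_inverseI[where g = "\<lambda>x. shift L x v"])
    fix x assume "x \<in> occurrences L S R w"
    then show "shift L (shift L x (- v)) v = x" using assms(2) by (simp add: shift_shift shift_0)
  qed
qed (use sparse_pattern_translate[OF assms] shift_in_V[OF assms(2)] finite_V in auto)

lemma sparse_count_rep:
  assumes "sparse L S R k" "L > 0" "w \<subseteq> Window R" "card w = k"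
  shows "card (occurrences L S R (rep R w)) = card (occurrences L S R w)"
proof -
  obtain v where v: "rep R w = translate v w" using rep assms(3) by blast
  have "translate v w \<subseteq> Window R" using rep(1)[OF assms(3)] v by simp
  moreover have "translate (- v) (translate v w) \<subseteq> Window R" using assms(3) by (simp add: translate_minus)
  ultimately show ?thesis
    using sparse_count_le[OF assms(1,2), of v w] sparse_count_le[OF assms(1,2), of "- v" "translate v w"]
      assms(4) v by (simp add: card_translate translate_minus)
qed

text \<open>The typical situation when the expected number of \<open>j\<close>-mark patterns tends to infinity for \<open>j < k\<close>
  and to \<open>0\<close> for \<open>j > k\<close>.\<close>

definition generic :: "nat \<Rightarrow> (nat \<Rightarrow> nat) set set \<Rightarrow> nat \<Rightarrow> nat \<Rightarrow> nat \<Rightarrow> bool" where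
  "generic L S R k t \<longleftrightarrow> sparse L S R k \<and>
     (\<forall>w\<subseteq>Window R. card w < k \<longrightarrow> t \<le> card (occurrences L S R w))"

text \<open>In the generic situation only the numbers of patterns with exactly \<open>k\<close> marks are left open, and it
  suffices to know them for one member of each translation class.\<close>

lemma count_agree_generic:
  assumes gen: "generic L S R k t" "generic L' S' R k t" and L: "L > 0" "L' > 0"
    and reps: "\<And>w. w \<subseteq> Window R \<Longrightarrow> card w = k \<Longrightarrow>
      card (occurrences L S R (rep R w)) = card (occurrences L' S' R (rep R w))"
  shows "count_agree L S L' S' R t"
  unfolding count_agree_def
proof (intro allI impI)
  fix q w assume q: "q \<le> R" and w: "w \<subseteq> Window q"
  then have wR: "w \<subseteq> Window R" using window_mono by blast
  have fin: "finite w" using w finite_window finite_subset by metis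
  have sub: "occurrences M A R w \<subseteq> occurrences M A q w" for M A
    using pattern_restrict[OF q] w by auto
  consider "card w < k" | "card w = k" | "card w > k" by linarith
  then show "min t (card (occurrences L S q w)) = min t (card (occurrences L' S' q w))"
  proof cases
    case 1
    have "t \<le> card (occurrences M A q w)" if "generic M A R k t" for M A
    proof -
      have "t \<le> card (occurrences M A R w)" using that wR 1 by (auto simp: generic_def)
      also have "\<dots> \<le> card (occurrences M A q w)"
        by (rule card_mono[OF _ sub]) (simp add: finite_V)
      finally show ?thesis .
    qed
    then show ?thesis using gen by (simp add: min_def)
  next
    case 2
    have "occurrences M A q w = occurrences M A R w" if "generic M A R k t" for M A
    proof (intro equalityI sub subsetI)
      fix x assume x: "x \<in> occurrences M A q w"
      then have "w \<subseteq> pattern M A R x" using pattern_restrict[OF q, of M A x] by auto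
      then show "x \<in> occurrences M A R w"
        using sparse_pattern_eq[of M A R k x w] that x 2 by (auto simp: generic_def)
    qed
    then show ?thesis
      using gen reps[OF wR 2] sparse_count_rep[OF _ _ wR 2] L by (simp add: generic_def)
  next
    case 3
    have none: "pattern M A q x \<noteq> w" if "generic M A R k t" "x \<in> V M" for M A x
    proof
      assume "pattern M A q x = w"
      then have "card w \<le> card (pattern M A R x)"
        using pattern_restrict[OF q] pattern_subset[of M A R x] finite_window[of d R] finite_subset
        by (intro card_mono) auto
      then show False using that 3 by (fastforce simp: generic_def sparse_def)
    qed
    have "occurrences M A q w = {}" if "generic M A R k t" for M A
      using none[OF that] by auto
    from this[OF gen(1)] this[OF gen(2)] show ?thesis by (simp only:)
  qed
qed

text \<open>A union bound over all vertices and all sets of \<open>k + 1\<close> slots in the window.\<close>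

lemma prob_not_sparse:
  assumes L: "L > 2 * R + 2" and r: "0 \<le> r" "r \<le> 1"
  shows "subset_prob (E L) r {S. \<not> sparse L S R k}
    \<le> 2 ^ card (Window R) * (real (L ^ d) * r ^ Suc k)"
proof -
  let ?P = "subset_prob (E L) r"
  define I where "I = V L \<times> {w. w \<subseteq> Window R \<and> card w = Suc k}"
  have finP: "finite {w. w \<subseteq> Window R \<and> card w = Suc k}"
    by (rule finite_subset[of _ "Pow (Window R)"]) (auto simp: finite_window)
  have finI: "finite I" using finite_V finP by (simp add: I_def)
  have "{S. \<not> sparse L S R k} \<subseteq> (\<Union>(x, w)\<in>I. {S. edge L x ` w \<subseteq> S})"
  proof
    fix S assume "S \<in> {S. \<not> sparse L S R k}"
    then obtain x where x: "x \<in> V L" "Suc k \<le> card (pattern L S R x)" by (auto simp: sparse_def)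
    obtain w where w: "w \<subseteq> pattern L S R x" "card w = Suc k"
      by (rule obtain_subset_with_card_n[OF x(2)])
    then show "S \<in> (\<Union>(x, w)\<in>I. {S. edge L x ` w \<subseteq> S})"
      using x(1) by (auto simp: I_def pattern_def intro!: bexI[of _ "(x, w)"])
  qed
  then have "?P {S. \<not> sparse L S R k} \<le> ?P (\<Union>(x, w)\<in>I. {S. edge L x ` w \<subseteq> S})"
    by (intro measure_pmf.finite_measure_mono) auto
  also have "\<dots> \<le> (\<Sum>(x, w)\<in>I. ?P {S. edge L x ` w \<subseteq> S})"
    unfolding case_prod_unfold
    by (rule measure_pmf.finite_measure_subadditive_finite) (use finI in auto)
  also have "\<dots> = (\<Sum>(x, w)\<in>I. r ^ Suc k)"
  proof (rule sum.cong[OF refl])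
    fix p assume "p \<in> I"
    then obtain x w where p: "p = (x, w)" and w: "w \<subseteq> Window R" "card w = Suc k" by (auto simp: I_def)
    have "edge L x ` w \<subseteq> E L" using w L by (auto intro!: edge_in_E simp: window_def)
    moreover have "card (edge L x ` w) = Suc k"
      using card_image[OF inj_on_subset[OF edge_inj_on[OF L] w(1)]] w(2) by simp
    ultimately show "(case p of (x, w) \<Rightarrow> ?P {S. edge L x ` w \<subseteq> S}) = (case p of (x, w) \<Rightarrow> r ^ Suc k)"
      using prob_subset[OF finite_torus_edges _ r] p by (simp del: power_Suc)
  qed
  also have "\<dots> = real (card I) * r ^ Suc k" by (simp add: case_prod_unfold del: power_Suc)
  also have "\<dots> \<le> (2 ^ card (Window R) * real (L ^ d)) * r ^ Suc k"
  proof (rule mult_right_mono)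
    have "card {w. w \<subseteq> Window R \<and> card w = Suc k} \<le> card (Pow (Window R))"
      using finite_window by (intro card_mono) auto
    then have "card I \<le> L ^ d * 2 ^ card (Window R)"
      unfolding I_def card_cartesian_product card_torus_vertices
      by (intro mult_left_mono) (auto simp: card_Pow finite_window)
    then have "real (card I) \<le> real (L ^ d * 2 ^ card (Window R))" by (rule of_nat_mono)
    then show "real (card I) \<le> 2 ^ card (Window R) * real (L ^ d)" by (simp add: mult.commute)
  qed (use r in simp)
  finally show ?thesis by (simp only: mult.assoc)
qed

text \<open>Fix \<open>t\<close> vertices. Each of them sees a mark with probability of order \<open>r\<close> only.\<close>

lemma prob_few_empty:
  assumes L: "L > 1" "t \<le> L ^ d" and r: "0 \<le> r" "r \<le> 1"
  shows "subset_prob (E L) r {S. card (occurrences L S R {}) < t}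
    \<le> real t * (real (card (Window R)) * r)"
proof -
  let ?P = "subset_prob (E L) r"
  obtain Y where Y: "Y \<subseteq> V L" "card Y = t"
    using obtain_subset_with_card_n[of t "V L"] L(2) by (auto simp: card_torus_vertices)
  have finY: "finite Y" using Y finite_V finite_subset by metis
  have "{S. card (occurrences L S R {}) < t} \<subseteq> (\<Union>x\<in>Y. {S. S \<inter> edge L x ` Window R \<noteq> {}})"
  proof (rule subsetI, rule ccontr)
    fix S assume "S \<in> {S. card (occurrences L S R {}) < t}"
      and "S \<notin> (\<Union>x\<in>Y. {S. S \<inter> edge L x ` Window R \<noteq> {}})"
    then have S: "card (occurrences L S R {}) < t"
      and none: "\<forall>x\<in>Y. S \<inter> edge L x ` Window R = {}" by blast+
    have "Y \<subseteq> occurrences L S R {}" using none Y(1) by (auto simp: pattern_def)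
    from card_mono[OF _ this] have "t \<le> card (occurrences L S R {})"
      using Y(2) finite_V by simp
    then show False using S by simp
  qed
  then have "?P {S. card (occurrences L S R {}) < t} \<le> ?P (\<Union>x\<in>Y. {S. S \<inter> edge L x ` Window R \<noteq> {}})"
    by (intro measure_pmf.finite_measure_mono) auto
  also have "\<dots> \<le> (\<Sum>x\<in>Y. ?P {S. S \<inter> edge L x ` Window R \<noteq> {}})"
    by (rule measure_pmf.finite_measure_subadditive_finite) (use finY in auto)
  also have "\<dots> \<le> (\<Sum>x\<in>Y. real (card (Window R)) * r)"
  proof (rule sum_mono)
    fix x
    have "?P {S. S \<inter> edge L x ` Window R \<noteq> {}} \<le> real (card (edge L x ` Window R)) * r"
      using L by (intro prob_meets finite_torus_edges r) (auto intro!: edge_in_E simp: window_def)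
    also have "\<dots> \<le> real (card (Window R)) * r"
      using r by (intro mult_right_mono) (auto intro: card_image_le finite_window)
    finally show "?P {S. S \<inter> edge L x ` Window R \<noteq> {}} \<le> real (card (Window R)) * r" .
  qed
  finally show ?thesis using Y(2) by simp
qed

end

section \<open>Limits of probabilities of sentences\<close>

text \<open>The side lengths are an arbitrary sequence that tends to infinity, so that the results can be
  applied along subsequences.\<close>

locale torus_sequence = torus +
  fixes L :: "nat \<Rightarrow> nat" and r :: "nat \<Rightarrow> real"
  assumes L_top: "filterlim L at_top sequentially"
    and r_0: "r \<longlonglongrightarrow> 0" and r_range: "\<And>n. 0 \<le> r n \<and> r n \<le> 1"
begin

abbreviation pr :: "nat \<Rightarrow> ((nat \<Rightarrow> nat) set set \<Rightarrow> bool) \<Rightarrow> real" where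
  "pr n P \<equiv> subset_prob (E (L n)) (r n) {S. P S}"

abbreviation rate :: "nat \<Rightarrow> nat \<Rightarrow> real" where
  "rate j n \<equiv> real (L n ^ d) * r n ^ j"

lemma L_large: "\<forall>\<^sub>F n in sequentially. L n > m"
  using L_top[unfolded filterlim_at_top, rule_format, of "Suc m"] by eventually_elim simp

lemma planted_seq:
  assumes "inequivalent R k T" "k \<ge> 1"
  shows "planted_sequence (\<lambda>n. E (L n)) r (\<lambda>n. V (L n) \<times> T) (\<lambda>n (x, w). edge (L n) x ` w)
    (\<lambda>n (x, w). edge (L n) x ` Window (3 * R + 1)) (\<lambda>n (x, w) S. pattern (L n) S R x = w)
    k (card (Window (3 * R + 1)))"
proof
  show "\<forall>\<^sub>F n in sequentially. planted_family (E (L n)) (r n) (V (L n) \<times> T) (\<lambda>(x, w). edge (L n) x ` w)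
    (\<lambda>(x, w). edge (L n) x ` Window (3 * R + 1)) (\<lambda>(x, w) S. pattern (L n) S R x = w) k (card (Window (3 * R + 1)))"
    using L_large[of "6 * R + 4"] by eventually_elim (use planted_patterns[OF assms] r_range in auto)
qed (rule r_0)

abbreviation found :: "nat \<Rightarrow> slot set set \<Rightarrow> nat \<Rightarrow> (nat \<Rightarrow> nat) set set \<Rightarrow> ((nat \<Rightarrow> nat) \<times> slot set) set" where
  "found R T n S \<equiv> {(x, w) \<in> V (L n) \<times> T. pattern (L n) S R x = w}"

lemma hits_eq_found:
  "planted_family.hits (V (L n) \<times> T) (\<lambda>(x, w) S. pattern (L n) S R x = w) S = found R T n S"
  if "planted_family (E (L n)) (r n) (V (L n) \<times> T) (\<lambda>(x, w). edge (L n) x ` w)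
    (\<lambda>(x, w). edge (L n) x ` Window (3 * R + 1)) (\<lambda>(x, w) S. pattern (L n) S R x = w) k C"
  using planted_family.hits_def[OF that] by auto

lemma planted_eventually:
  assumes "inequivalent R k T" "k \<ge> 1"
  shows "\<forall>\<^sub>F n in sequentially. \<forall>S. planted_family.hits (V (L n) \<times> T) (\<lambda>(x, w) S. pattern (L n) S R x = w) S = found R T n S"
  using planted_sequence.fam[OF planted_seq[OF assms]] by eventually_elim (intro allI hits_eq_found)

lemma pr_union_0:
  assumes "finite W" "\<And>w. w \<in> W \<Longrightarrow> (\<lambda>n. pr n (P w n)) \<longlonglongrightarrow> 0"
  shows "(\<lambda>n. pr n (\<lambda>S. \<exists>w\<in>W. P w n S)) \<longlonglongrightarrow> 0"
proof (rule tendsto_sandwich)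
  show "(\<lambda>_. 0) \<longlonglongrightarrow> (0::real)" by simp
  show "\<forall>\<^sub>F n in sequentially. pr n (\<lambda>S. \<exists>w\<in>W. P w n S) \<le> (\<Sum>w\<in>W. pr n (P w n))"
  proof (intro always_eventually allI)
    fix n
    have "{S. \<exists>w\<in>W. P w n S} = (\<Union>w\<in>W. {S. P w n S})" by auto
    then show "pr n (\<lambda>S. \<exists>w\<in>W. P w n S) \<le> (\<Sum>w\<in>W. pr n (P w n))"
      using measure_pmf.finite_measure_subadditive_finite[OF assms(1), of "\<lambda>w. {S. P w n S}" "random_subset (E (L n)) (r n)"] by simp
  qed
  have "(\<lambda>n. \<Sum>w\<in>W. pr n (P w n)) \<longlonglongrightarrow> (\<Sum>w\<in>W. 0)" by (intro tendsto_sum assms)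
  then show "(\<lambda>n. \<Sum>w\<in>W. pr n (P w n)) \<longlonglongrightarrow> 0" by simp
qed simp

lemma pr_or_0:
  assumes "(\<lambda>n. pr n (P n)) \<longlonglongrightarrow> 0" "(\<lambda>n. pr n (Q n)) \<longlonglongrightarrow> 0"
  shows "(\<lambda>n. pr n (\<lambda>S. P n S \<or> Q n S)) \<longlonglongrightarrow> 0"
proof (rule tendsto_sandwich)
  show "(\<lambda>_. 0) \<longlonglongrightarrow> (0::real)" by simp
  show "\<forall>\<^sub>F n in sequentially. pr n (\<lambda>S. P n S \<or> Q n S) \<le> pr n (P n) + pr n (Q n)"
    unfolding Collect_disj_eq by (intro always_eventually allI measure_Un_le) auto
  show "(\<lambda>n. pr n (P n) + pr n (Q n)) \<longlonglongrightarrow> 0" using tendsto_add[OF assms] by simp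
qed simp

lemma pr_mono_0:
  assumes "(\<lambda>n. pr n (P n)) \<longlonglongrightarrow> 0" "\<forall>\<^sub>F n in sequentially. \<forall>S. Q n S \<longrightarrow> P n S"
  shows "(\<lambda>n. pr n (Q n)) \<longlonglongrightarrow> 0"
proof (rule tendsto_sandwich[OF _ _ tendsto_const assms(1)])
  show "\<forall>\<^sub>F n in sequentially. pr n (Q n) \<le> pr n (P n)"
    using assms(2) by eventually_elim (auto intro!: measure_pmf.finite_measure_mono)
qed simp

lemma pr_diff_0:
  assumes "(\<lambda>n. pr n (Z n)) \<longlonglongrightarrow> 0" "\<forall>\<^sub>F n in sequentially. \<forall>S. \<not> Z n S \<longrightarrow> (P n S \<longleftrightarrow> Q n S)"
    and "(\<lambda>n. pr n (Q n)) \<longlonglongrightarrow> x"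
  shows "(\<lambda>n. pr n (P n)) \<longlonglongrightarrow> x"
proof -
  have "(\<lambda>n. pr n (P n) - pr n (Q n)) \<longlonglongrightarrow> 0"
  proof (rule Lim_null_comparison[OF _ assms(1)])
    show "\<forall>\<^sub>F n in sequentially. norm (pr n (P n) - pr n (Q n)) \<le> pr n (Z n)"
      using assms(2)
    proof eventually_elim
      case (elim n)
      then have "\<bar>pr n (P n) - pr n (Q n)\<bar> \<le> pr n (Z n)" by (intro prob_diff_le) blast
      then show ?case by simp
    qed
  qed
  from tendsto_add[OF this assms(3)] show ?thesis by simp
qed

lemma pattern_frequent:
  assumes w: "w \<subseteq> Window R" "w \<noteq> {}" and rate: "filterlim (rate (card w)) at_top sequentially"
  shows "(\<lambda>n. pr n (\<lambda>S. card (occurrences (L n) S R w) < t)) \<longlonglongrightarrow> 0"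
proof -
  have ineq: "inequivalent R (card w) {w}" using w by (auto simp: inequivalent_def)
  have k: "card w \<ge> 1" using w finite_window finite_subset card_gt_0_iff by (metis One_nat_def Suc_leI)
  interpret ps: planted_sequence "\<lambda>n. E (L n)" r "\<lambda>n. V (L n) \<times> {w}" "\<lambda>n (x, w). edge (L n) x ` w"
    "\<lambda>n (x, w). edge (L n) x ` Window (3 * R + 1)" "\<lambda>n (x, w) S. pattern (L n) S R x = w"
    "card w" "card (Window (3 * R + 1))"
    by (rule planted_seq[OF ineq k])
  have "filterlim (\<lambda>n. real (card (V (L n) \<times> {w})) * r n ^ card w) at_top sequentially"
    using rate by (simp add: card_torus_vertices card_cartesian_product)
  note few = ps.few_hits_unlikely[OF this]
  have "(\<lambda>n. pr n (\<lambda>S. \<exists>m\<in>{..<t}. card (ps.H n S) = m)) \<longlonglongrightarrow> 0"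
    by (rule pr_union_0) (use few in auto)
  then show ?thesis
  proof (rule pr_mono_0)
    show "\<forall>\<^sub>F n in sequentially. \<forall>S. card (occurrences (L n) S R w) < t \<longrightarrow> (\<exists>m\<in>{..<t}. card (ps.H n S) = m)"
      using planted_eventually[OF ineq k]
    proof eventually_elim
      case (elim n)
      have "found R {w} n S = occurrences (L n) S R w \<times> {w}" for S by auto
      then show ?case using elim by (simp add: card_cartesian_product)
    qed
  qed
qed

lemma empty_frequent:
  "(\<lambda>n. pr n (\<lambda>S. card (occurrences (L n) S R {}) < t)) \<longlonglongrightarrow> 0"
proof (rule tendsto_sandwich)
  show "(\<lambda>_. 0) \<longlonglongrightarrow> (0::real)" by simp
  show "\<forall>\<^sub>F n in sequentially. pr n (\<lambda>S. card (occurrences (L n) S R {}) < t)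
    \<le> real t * (real (card (Window R)) * r n)"
    using L_large[of "t + 1"]
  proof eventually_elim
    case (elim n)
    have "L n ^ 1 \<le> L n ^ d" using elim d_ge2 by (intro power_increasing) auto
    then show ?case using elim r_range by (intro prob_few_empty) auto
  qed
  show "(\<lambda>n. real t * (real (card (Window R)) * r n)) \<longlonglongrightarrow> 0"
    using tendsto_mult_right_zero[OF tendsto_mult_right_zero[OF r_0]] by blast
qed simp

lemma not_sparse_unlikely:
  assumes "rate (Suc k) \<longlonglongrightarrow> 0"
  shows "(\<lambda>n. pr n (\<lambda>S. \<not> sparse (L n) S R k)) \<longlonglongrightarrow> 0"
proof (rule tendsto_sandwich)
  show "(\<lambda>_. 0) \<longlonglongrightarrow> (0::real)" by simp
  show "\<forall>\<^sub>F n in sequentially. pr n (\<lambda>S. \<not> sparse (L n) S R k) \<le> 2 ^ card (Window R) * rate (Suc k) n"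
    using L_large[of "2 * R + 2"] by eventually_elim (use prob_not_sparse r_range in blast)
  show "(\<lambda>n. 2 ^ card (Window R) * rate (Suc k) n) \<longlonglongrightarrow> 0"
    using tendsto_mult_right_zero[OF assms] by blast
qed simp

lemma rate_Suc_0:
  assumes "rate k \<longlonglongrightarrow> l"
  shows "rate (Suc k) \<longlonglongrightarrow> 0"
  using tendsto_mult[OF assms r_0] by (simp add: mult_ac)

lemma rate_at_top_mono:
  assumes "filterlim (rate k) at_top sequentially" "j \<le> k"
  shows "filterlim (rate j) at_top sequentially"
proof (rule filterlim_at_top_mono[OF assms(1)])
  show "\<forall>\<^sub>F n in sequentially. rate k n \<le> rate j n"
    using assms(2) r_range by (intro always_eventually allI mult_left_mono power_decreasing) auto
qed

lemma not_generic_unlikely: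
  assumes top: "filterlim (rate (k - 1)) at_top sequentially" and l: "rate k \<longlonglongrightarrow> l" and k: "k \<ge> 1"
  shows "(\<lambda>n. pr n (\<lambda>S. \<not> generic (L n) S R k t)) \<longlonglongrightarrow> 0"
proof -
  define W where "W = {w. w \<subseteq> Window R \<and> card w < k}"
  have finW: "finite W" by (rule finite_subset[of _ "Pow (Window R)"]) (auto simp: W_def finite_window)
  have freq: "(\<lambda>n. pr n (\<lambda>S. card (occurrences (L n) S R w) < t)) \<longlonglongrightarrow> 0" if "w \<in> W" for w
  proof (cases "w = {}")
    case True
    then show ?thesis using empty_frequent by simp
  next
    case False
    have "card w \<le> k - 1" "w \<subseteq> Window R" using that by (auto simp: W_def)
    then show ?thesis
      using False rate_at_top_mono[OF top] by (intro pattern_frequent)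
  qed
  have "(\<lambda>n. pr n (\<lambda>S. \<not> sparse (L n) S R k \<or>
      (\<exists>w\<in>W. card (occurrences (L n) S R w) < t))) \<longlonglongrightarrow> 0"
    by (intro pr_or_0 not_sparse_unlikely[OF rate_Suc_0[OF l]] pr_union_0[OF finW freq])
  then show ?thesis
    by (rule pr_mono_0) (auto simp: generic_def W_def not_le)
qed

text \<open>Outside an unlikely event the marked torus is generic. Then, by Hanf's theorem, the truth of the
  sentence depends only on the multiset of representatives of \<open>k\<close>-mark patterns that occur, and the
  probability of any set of such multisets converges. If \<open>l = 0\<close>, this multiset is empty with
  probability tending to \<open>1\<close>, so that the sentence is decided.\<close>

theorem sentence_limit:
  assumes top: "filterlim (rate (k - 1)) at_top sequentially" and l: "rate k \<longlonglongrightarrow> l" and k: "k \<ge> 1"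
    and \<phi>: "fo_sentence \<phi>"
  shows "convergent (\<lambda>n. pr n (\<lambda>S. fo_models (marked_graph (L n) keep S) \<phi>))"
    and "l = 0 \<Longrightarrow> \<exists>x\<in>{0, 1}. (\<lambda>n. pr n (\<lambda>S. fo_models (marked_graph (L n) keep S) \<phi>)) \<longlonglongrightarrow> x"
proof -
  obtain R t where hanf: "\<And>L S L' S'. L > 2 * R \<Longrightarrow> L' > 2 * R \<Longrightarrow> count_agree L S L' S' R t \<Longrightarrow>
     fo_models (marked_graph L keep S) \<phi> = fo_models (marked_graph L' keep S') \<phi>"
    using hanf[OF \<phi>, of keep thesis] by blast
  define T where "T = rep R ` {w. w \<subseteq> Window R \<and> card w = k}"
  have T: "inequivalent R k T" unfolding T_def by (rule inequivalent_reps) auto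
  have finT: "finite T" using inequivalent_finite[OF T] .
  interpret ps: planted_sequence "\<lambda>n. E (L n)" r "\<lambda>n. V (L n) \<times> T" "\<lambda>n (x, w). edge (L n) x ` w"
    "\<lambda>n (x, w). edge (L n) x ` Window (3 * R + 1)" "\<lambda>n (x, w) S. pattern (L n) S R x = w"
    k "card (Window (3 * R + 1))"
    by (rule planted_seq[OF T k])
  define types where "types M S = image_mset snd (mset_set {(x, w) \<in> V M \<times> T. pattern M S R x = w})" for M S
  have count: "count (types M S) w = card (occurrences M S R w)" if "w \<in> T" for M S w
  proof -
    have fin: "finite {(x, w) \<in> V M \<times> T. pattern M S R x = w}"
      by (rule finite_subset[of _ "V M \<times> T"]) (use finT finite_V in auto)
    have "count (types M S) w = card {j \<in> {(x, w) \<in> V M \<times> T. pattern M S R x = w}. snd j = w}"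
      using fin unfolding types_def by (simp add: count_image_mset vimage_def Int_def conj_commute)
    also have "{j \<in> {(x, w) \<in> V M \<times> T. pattern M S R x = w}. snd j = w} = occurrences M S R w \<times> {w}"
      using that by auto
    finally show ?thesis by (simp add: card_cartesian_product)
  qed
  \<comment> \<open>The multisets for which the sentence holds in some large generic torus; then it holds in all of them.\<close>
  define A where "A = {types M S | M S. M > 2 * R \<and> generic M S R k t \<and> fo_models (marked_graph M keep S) \<phi>}"
  have determined: "fo_models (marked_graph M keep S) \<phi> \<longleftrightarrow> types M S \<in> A" if M: "M > 2 * R" "generic M S R k t" for M S
  proof
    assume "types M S \<in> A"
    then obtain M' S' where M': "types M S = types M' S'" "M' > 2 * R" "generic M' S' R k t" "fo_models (marked_graph M' keep S') \<phi>"
      by (auto simp: A_def)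
    have "count_agree M S M' S' R t"
    proof (rule count_agree_generic[OF M(2) M'(3)])
      fix w assume "w \<subseteq> Window R" "card w = k"
      then have inT: "rep R w \<in> T" by (auto simp: T_def)
      show "card (occurrences M S R (rep R w)) = card (occurrences M' S' R (rep R w))"
        using count[OF inT, of M S] count[OF inT, of M' S'] M'(1) by simp
    qed (use M M' in auto)
    then show "fo_models (marked_graph M keep S) \<phi>" using hanf M(1) M'(2,4) by blast
  qed (use that in \<open>auto simp: A_def\<close>)
  let ?p = "\<lambda>n. pr n (\<lambda>S. fo_models (marked_graph (L n) keep S) \<phi>)"
  let ?Y = "\<lambda>n S. image_mset snd (mset_set (ps.H n S))"
  have Y: "\<forall>\<^sub>F n in sequentially. \<forall>S. ?Y n S = types (L n) S"
    using planted_eventually[OF T k] by eventually_elim (simp add: types_def)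
  have event: "\<forall>\<^sub>F n in sequentially. \<forall>S. \<not> \<not> generic (L n) S R k t \<longrightarrow>
      (fo_models (marked_graph (L n) keep S) \<phi> \<longleftrightarrow> ?Y n S \<in> A)"
    using L_large[of "2 * R"] Y by eventually_elim (use determined in auto)
  have \<mu>: "ps.\<mu> \<longlonglongrightarrow> real (card T) * l"
    using tendsto_mult[OF tendsto_const l, of "real (card T)"]
    by (simp add: card_cartesian_product card_torus_vertices mult_ac)
  have "rate k n \<ge> 0" for n using r_range by simp
  then have l0: "l \<ge> 0" using l by (intro tendsto_lowerbound[OF l]) auto
  have "convergent (\<lambda>n. pr n (\<lambda>S. ?Y n S \<in> A))"
  proof (rule ps.type_event_convergent[OF \<mu> _ _ finT])
    show "0 \<le> real (card T) * l" using l0 by simp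
    show "\<forall>\<^sub>F n in sequentially. snd ` (V (L n) \<times> T) \<subseteq> T" by auto
    fix w
    show "\<exists>x. (\<lambda>n. real (card {j \<in> V (L n) \<times> T. snd j = w}) * r n ^ k) \<longlonglongrightarrow> x"
    proof (cases "w \<in> T")
      case True
      then have "{j \<in> V M \<times> T. snd j = w} = V M \<times> {w}" for M by auto
      then show ?thesis using l by (auto simp: card_cartesian_product card_torus_vertices)
    next
      case False
      then have "{j \<in> V M \<times> T. snd j = w} = {}" for M by auto
      then have "(\<lambda>n. real (card {j \<in> V (L n) \<times> T. snd j = w}) * r n ^ k) = (\<lambda>_. 0)"
        by (simp only: card.empty of_nat_0 mult_zero_left)
      then show ?thesis using tendsto_const by metis
    qed
  qed
  then obtain y where y: "(\<lambda>n. pr n (\<lambda>S. ?Y n S \<in> A)) \<longlonglongrightarrow> y" by (auto simp: convergent_def)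
  have py: "?p \<longlonglongrightarrow> y"
    by (rule pr_diff_0[OF not_generic_unlikely[OF top l k] event y])
  then show "convergent ?p" by (auto simp: convergent_def)
  show "\<exists>x\<in>{0, 1}. ?p \<longlonglongrightarrow> x" if "l = 0"
  proof -
    have "(\<lambda>n. pr n (\<lambda>S. ps.H n S = {})) \<longlonglongrightarrow> 1"
      using ps.no_hit_limit[OF \<mu>] that by simp
    from tendsto_diff[OF tendsto_const[of 1] this]
    have "(\<lambda>n. 1 - pr n (\<lambda>S. ps.H n S = {})) \<longlonglongrightarrow> 0" by simp
    moreover have "1 - pr n (\<lambda>S. ps.H n S = {}) = pr n (\<lambda>S. ps.H n S \<noteq> {})" for n
      using measure_pmf.prob_compl[of "{S. ps.H n S = {}}" "random_subset (E (L n)) (r n)"]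
      by (simp add: Compl_eq_Diff_UNIV[symmetric] Collect_neg_eq)
    ultimately have none: "(\<lambda>n. pr n (\<lambda>S. ps.H n S \<noteq> {})) \<longlonglongrightarrow> 0" by simp
    have "(\<lambda>n. pr n (\<lambda>S. ?Y n S \<in> A)) \<longlonglongrightarrow> (if {#} \<in> A then 1 else 0)"
    proof (rule pr_diff_0[OF none])
      show "\<forall>\<^sub>F n in sequentially. \<forall>S. \<not> ps.H n S \<noteq> {} \<longrightarrow> (?Y n S \<in> A \<longleftrightarrow> {#} \<in> A)" by auto
      show "(\<lambda>n. pr n (\<lambda>S. {#} \<in> A)) \<longlonglongrightarrow> (if {#} \<in> A then 1 else 0)" by auto
    qed
    then have "y = (if {#} \<in> A then 1 else 0)" using y LIMSEQ_unique by blast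
    then have "y \<in> {0, 1}" by simp
    with py show ?thesis by blast
  qed
qed

text \<open>On sparse tori a pattern in \<open>Q\<close> is seen somewhere if and only if its representative is, and the
  representatives form a planted family of mean \<open>card (rep R ` Q) * N * r ^ k\<close>.\<close>

lemma pattern_absent_limit:
  assumes l: "rate k \<longlonglongrightarrow> l" and k: "k \<ge> 1"
    and Q: "\<And>w. w \<in> Q \<Longrightarrow> w \<subseteq> Window R \<and> card w = k"
  shows "(\<lambda>n. pr n (\<lambda>S. \<not> (\<exists>x\<in>V (L n). pattern (L n) S R x \<in> Q))) \<longlonglongrightarrow> exp (- (real (card (rep R ` Q)) * l))"
proof -
  define T where "T = rep R ` Q"
  have T: "inequivalent R k T" unfolding T_def by (rule inequivalent_reps[OF Q])
  interpret ps: planted_sequence "\<lambda>n. E (L n)" r "\<lambda>n. V (L n) \<times> T" "\<lambda>n (x, w). edge (L n) x ` w"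
    "\<lambda>n (x, w). edge (L n) x ` Window (3 * R + 1)" "\<lambda>n (x, w) S. pattern (L n) S R x = w"
    k "card (Window (3 * R + 1))"
    by (rule planted_seq[OF T k])
  have \<mu>: "ps.\<mu> \<longlonglongrightarrow> real (card T) * l"
    using tendsto_mult[OF tendsto_const l, of "real (card T)"]
    by (simp add: card_cartesian_product card_torus_vertices mult_ac)
  have "rate k n \<ge> 0" for n using r_range by simp
  then have l0: "l \<ge> 0" using l by (intro tendsto_lowerbound[OF l]) auto
  have lim: "(\<lambda>n. pr n (\<lambda>S. ps.H n S = {})) \<longlonglongrightarrow> exp (- (real (card T) * l))"
    using ps.no_hit_limit[OF \<mu>] l0 by simp
  have iff: "(\<exists>x\<in>V M. pattern M S R x \<in> Q) \<longleftrightarrow> (\<exists>x\<in>V M. pattern M S R x \<in> T)"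
    if sp: "sparse M S R k" and M: "M > 0" for M S
  proof
    assume "\<exists>x\<in>V M. pattern M S R x \<in> Q"
    then obtain x where x: "pattern M S R x \<in> Q" by blast
    define w where "w = pattern M S R x"
    have w: "w \<in> Q" "w \<subseteq> Window R" "card w = k" using Q x by (auto simp: w_def)
    obtain v where v: "rep R w = translate v w" using rep w by blast
    have "pattern M S R (shift M x (- v)) = translate v w"
      using sparse_pattern_translate[OF sp M _ w(3)] rep(1)[OF w(2)] v by (auto simp: w_def)
    then show "\<exists>x\<in>V M. pattern M S R x \<in> T" using v w(1) shift_in_V[OF M] by (metis T_def imageI)
  next
    assume "\<exists>x\<in>V M. pattern M S R x \<in> T"
    then obtain x w where x: "pattern M S R x = rep R w" "w \<in> Q" by (auto simp: T_def)
    have w: "w \<subseteq> Window R" "card w = k" using Q x by auto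
    obtain v where v: "rep R w = translate v w" using rep w by blast
    have "pattern M S R (shift M x (- (- v))) = translate (- v) (translate v w)"
      by (rule sparse_pattern_translate[OF sp M]) (use w x v in \<open>auto simp: translate_minus card_translate\<close>)
    then show "\<exists>x\<in>V M. pattern M S R x \<in> Q" using x(2) shift_in_V[OF M] by (metis translate_minus(1))
  qed
  have "(\<lambda>n. pr n (\<lambda>S. \<not> (\<exists>x\<in>V (L n). pattern (L n) S R x \<in> Q))) \<longlonglongrightarrow> exp (- (real (card T) * l))"
  proof (rule pr_diff_0[OF not_sparse_unlikely[OF rate_Suc_0[OF l], of R] _ lim])
    show "\<forall>\<^sub>F n in sequentially. \<forall>S. \<not> \<not> sparse (L n) S R k \<longrightarrow>
        (\<not> (\<exists>x\<in>V (L n). pattern (L n) S R x \<in> Q) \<longleftrightarrow> ps.H n S = {})"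
      using L_large[of 0] planted_eventually[OF T k]
    proof eventually_elim
      case (elim n)
      then show ?case using iff by auto
    qed
  qed
  then show ?thesis by (simp add: T_def)
qed

end

section \<open>A sentence about paths\<close>

text \<open>To find a sentence with a given meaning, it is enough to follow the logical form of the meaning.
  Free variables are dealt with at the end, in \<open>definable_sentence\<close>.\<close>

definition definable :: "('a graph \<Rightarrow> (nat \<Rightarrow> 'a) \<Rightarrow> bool) \<Rightarrow> bool" where
  "definable P \<longleftrightarrow> (\<exists>\<phi>. \<forall>G s. fo_sat G s \<phi> = P G s)"

lemma definable_eq: "definable (\<lambda>(G :: 'a graph) s. s i = s j)"
  unfolding definable_def by (rule exI[of _ "FO_Eq i j"]) simp

lemma definable_adj: "definable (\<lambda>(G :: 'a graph) s. {s i, s j} \<in> snd G)"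
  unfolding definable_def by (rule exI[of _ "FO_Adj i j"]) simp

lemma definable_not: "definable P \<Longrightarrow> definable (\<lambda>(G :: 'a graph) s. \<not> P G s)"
  unfolding definable_def by (metis fo_sat.simps(3))

lemma definable_and: "definable P \<Longrightarrow> definable Q \<Longrightarrow> definable (\<lambda>(G :: 'a graph) s. P G s \<and> Q G s)"
  unfolding definable_def by (metis fo_sat.simps(4))

lemma definable_ex: "definable P \<Longrightarrow> definable (\<lambda>(G :: 'a graph) s. \<exists>v\<in>fst G. P G (s(i := v)))"
  unfolding definable_def by (metis (no_types, lifting) fo_sat.simps(5))

lemma definable_ball:
  assumes "finite A" "\<And>a. a \<in> A \<Longrightarrow> definable (P a)"
  shows "definable (\<lambda>(G :: 'a graph) s. \<forall>a\<in>A. P a G s)"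
  using assms
proof (induction A rule: finite_induct)
  case empty
  then show ?case using definable_eq[of 0 0] by simp
next
  case (insert a A)
  then have "definable (\<lambda>(G :: 'a graph) s. P a G s \<and> (\<forall>a\<in>A. P a G s))" by (intro definable_and) auto
  then show ?case by simp
qed

lemma definable_ex_block:
  assumes "finite A" "definable P"
  shows "definable (\<lambda>(G :: 'a graph) s. \<exists>f. f ` A \<subseteq> fst G \<and> P G (override_on s f A))"
  using assms(1)
proof (induction A rule: finite_induct)
  case empty
  then show ?case using assms(2) by simp
next
  case (insert a A)
  have "(\<exists>f. f ` insert a A \<subseteq> fst G \<and> P G (override_on s f (insert a A))) \<longleftrightarrow>
    (\<exists>v\<in>fst G. \<exists>f. f ` A \<subseteq> fst G \<and> P G (override_on (s(a := v)) f A))" (is "?l \<longleftrightarrow> ?r") for G s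
  proof
    assume ?l
    then obtain f where f: "f ` insert a A \<subseteq> fst G" "P G (override_on s f (insert a A))" by blast
    have "override_on s f (insert a A) = override_on (s(a := f a)) f A"
      using insert.hyps by (auto simp: override_on_def fun_eq_iff)
    then show ?r using f by (intro bexI[of _ "f a"] exI[of _ f]) auto
  next
    assume ?r
    then obtain v f where f: "v \<in> fst G" "f ` A \<subseteq> fst G" "P G (override_on (s(a := v)) f A)" by blast
    have "override_on (s(a := v)) f A = override_on s (f(a := v)) (insert a A)"
      using insert.hyps by (auto simp: override_on_def fun_eq_iff)
    moreover have "(f(a := v)) ` insert a A \<subseteq> fst G" using f insert.hyps by auto
    ultimately show ?l using f(3) by metis
  qed
  then show ?case using definable_ex[OF insert.IH, of a] by (simp only:)
qed

lemma finite_fo_free_vars: "finite (fo_free_vars \<phi>)"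
  by (induction \<phi>) auto

text \<open>If the truth of a formula does not depend on the valuation, then neither does prefixing it with
  existential quantifiers for its free variables change its truth.\<close>

lemma definable_sentence:
  assumes "definable (\<lambda>(G :: 'a graph) s. P G)"
  obtains \<phi> where "fo_sentence \<phi>" "\<And>G. fst G \<noteq> {} \<Longrightarrow> fo_models G \<phi> \<longleftrightarrow> P G"
proof -
  obtain \<psi> where \<psi>: "\<And>G s. fo_sat G s \<psi> = P G" using assms by (auto simp: definable_def)
  obtain xs where xs: "set xs = fo_free_vars \<psi>" using finite_list[OF finite_fo_free_vars] by blast
  define \<phi> where "\<phi> = foldr FO_Ex xs \<psi>"
  have fv: "fo_free_vars (foldr FO_Ex ys \<psi>) = fo_free_vars \<psi> - set ys" for ys
    by (induction ys) auto
  have sat: "fo_sat G s (foldr FO_Ex ys \<psi>) = P G" if "fst G \<noteq> {}" for G s ys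
    using that by (induction ys arbitrary: s) (auto simp: \<psi>)
  show ?thesis
  proof (rule that)
    show "fo_sentence \<phi>" by (simp add: fo_sentence_def \<phi>_def fv xs)
    fix G :: "'a graph" assume G: "fst G \<noteq> {}"
    then obtain v where "v \<in> fst G" by blast
    then have "range (\<lambda>_::nat. v) \<subseteq> fst G" by auto
    then show "fo_models G \<phi> \<longleftrightarrow> P G" unfolding fo_models_def \<phi>_def sat[OF G] by blast
  qed
qed

text \<open>In the torus every vertex has \<open>2 * d\<close> neighbours. A vertex is deficient for \<open>D = 2 * d\<close> if one of
  its torus edges is missing from the graph.\<close>

definition deficient :: "nat \<Rightarrow> 'a graph \<Rightarrow> 'a \<Rightarrow> bool" where
  "deficient D G x \<longleftrightarrow> \<not> (\<exists>Y\<subseteq>fst G. finite Y \<and> card Y = D \<and> (\<forall>y\<in>Y. {x, y} \<in> snd G))"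

text \<open>A self-avoiding path with \<open>m\<close> steps whose vertices with index in \<open>I\<close> are deficient. With \<open>m = k\<close>
  and \<open>I = {}\<close> it needs \<open>k\<close> retained edges. With suitable \<open>m\<close> and \<open>I\<close> it needs \<open>k\<close> deleted edges: there
  the path only serves to keep the deficient vertices close together.\<close>

definition has_path :: "nat \<Rightarrow> nat set \<Rightarrow> nat \<Rightarrow> 'a graph \<Rightarrow> bool" where
  "has_path m I D G \<longleftrightarrow> (\<exists>f. f ` {..m} \<subseteq> fst G \<and> inj_on f {..m} \<and>
     (\<forall>j<m. {f j, f (Suc j)} \<in> snd G) \<and> (\<forall>j\<in>I. deficient D G (f j)))"

lemma definable_inj:
  assumes "finite A"
  shows "definable (\<lambda>(G :: 'a graph) s. inj_on s A)"
proof -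
  have "definable (\<lambda>(G :: 'a graph) s. \<forall>p\<in>{(i, j). i \<in> A \<and> j \<in> A \<and> i \<noteq> j}. \<not> s (fst p) = s (snd p))"
  proof (rule definable_ball)
    show "finite {(i, j). i \<in> A \<and> j \<in> A \<and> i \<noteq> j}"
      by (rule finite_subset[of _ "A \<times> A"]) (use assms in auto)
  qed (intro definable_not definable_eq)
  moreover have "(\<forall>p\<in>{(i, j). i \<in> A \<and> j \<in> A \<and> i \<noteq> j}. \<not> s (fst p) = s (snd p)) \<longleftrightarrow> inj_on s A" for s :: "nat \<Rightarrow> 'a"
    by (auto simp: inj_on_def)
  ultimately show ?thesis by simp
qed

lemma definable_deficient:
  "definable (\<lambda>(G :: 'a graph) s. deficient D G (s j))"
proof -
  define Z where "Z = {Suc j..<Suc j + D}"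
  have Z: "finite Z" "card Z = D" "j \<notin> Z" by (auto simp: Z_def)
  have "definable (\<lambda>(G :: 'a graph) s. \<not> (\<exists>f. f ` Z \<subseteq> fst G \<and> (inj_on (override_on s f Z) Z \<and>
      (\<forall>z\<in>Z. {override_on s f Z j, override_on s f Z z} \<in> snd G))))"
    by (intro definable_not definable_ex_block definable_and definable_inj definable_ball definable_adj Z)
  moreover have "(\<exists>f. f ` Z \<subseteq> fst G \<and> (inj_on (override_on s f Z) Z \<and>
      (\<forall>z\<in>Z. {override_on s f Z j, override_on s f Z z} \<in> snd G))) \<longleftrightarrow> \<not> deficient D G (s j)" (is "?l \<longleftrightarrow> ?r")
    for G :: "'a graph" and s
  proof -
    have ov: "inj_on (override_on s f Z) Z = inj_on f Z" "override_on s f Z j = s j" for f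
      using Z(3) by (auto simp: inj_on_def)
    show ?thesis
    proof
      assume ?l
      then obtain f where f: "f ` Z \<subseteq> fst G" "inj_on f Z" "\<forall>z\<in>Z. {s j, f z} \<in> snd G"
        by (auto simp: ov)
      then show ?r
        unfolding deficient_def not_not
        by (intro exI[of _ "f ` Z"]) (auto simp: card_image Z)
    next
      assume ?r
      then obtain Y where Y: "Y \<subseteq> fst G" "finite Y" "card Y = D" "\<forall>y\<in>Y. {s j, y} \<in> snd G"
        by (auto simp: deficient_def)
      obtain f where "bij_betw f Z Y" using finite_same_card_bij Z Y by metis
      then show ?l using Y by (intro exI[of _ f]) (auto simp: ov bij_betw_def)
    qed
  qed
  ultimately show ?thesis by (simp only: not_not)
qed

lemma has_path_sentence:
  assumes "I \<subseteq> {..m}"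
  obtains \<phi> where "fo_sentence \<phi>" "\<And>G. fst G \<noteq> {} \<Longrightarrow> fo_models G \<phi> \<longleftrightarrow> has_path m I D G"
proof -
  have fin: "finite I" using assms finite_subset by blast
  have "definable (\<lambda>(G :: 'a graph) s. \<exists>f. f ` {..m} \<subseteq> fst G \<and> (inj_on (override_on s f {..m}) {..m} \<and>
    ((\<forall>j\<in>{..<m}. {override_on s f {..m} j, override_on s f {..m} (Suc j)} \<in> snd G) \<and>
    (\<forall>j\<in>I. deficient D G (override_on s f {..m} j)))))"
    by (intro definable_ex_block definable_and definable_inj definable_ball definable_adj
        definable_deficient fin) auto
  moreover have "(\<exists>f. f ` {..m} \<subseteq> fst G \<and> (inj_on (override_on s f {..m}) {..m} \<and>
    ((\<forall>j\<in>{..<m}. {override_on s f {..m} j, override_on s f {..m} (Suc j)} \<in> snd G) \<and>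
    (\<forall>j\<in>I. deficient D G (override_on s f {..m} j))))) \<longleftrightarrow> has_path m I D G" for G :: "'a graph" and s
  proof -
    have "inj_on (override_on s f {..m}) {..m} = inj_on f {..m}" for f by (auto simp: inj_on_def)
    moreover have "override_on s f {..m} j = f j" if "j \<in> I" for f j using that assms by auto
    ultimately show ?thesis by (simp add: has_path_def Ball_def)
  qed
  ultimately have "definable (\<lambda>(G :: 'a graph) s. has_path m I D G)" by (simp only:)
  from definable_sentence[OF this] show ?thesis using that by metis
qed

definition joins :: "nat \<Rightarrow> slot \<Rightarrow> (nat \<Rightarrow> int) \<Rightarrow> (nat \<Rightarrow> int) \<Rightarrow> bool" where
  "joins d \<sigma> u v \<longleftrightarrow> snd \<sigma> < d \<and> {fst \<sigma>, fst \<sigma> + unit (snd \<sigma>)} = {u, v}"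

text \<open>The path property, read in \<open>\<int>\<^sup>d\<close> with the set \<open>w\<close> of marks, for paths that start at the origin.\<close>

definition realizes :: "nat \<Rightarrow> bool \<Rightarrow> nat \<Rightarrow> nat set \<Rightarrow> slot set \<Rightarrow> bool" where
  "realizes d keep m I w \<longleftrightarrow> (\<exists>u. u 0 = 0 \<and> inj_on u {..m} \<and>
     (\<forall>j<m. \<exists>\<sigma>. joins d \<sigma> (u j) (u (Suc j)) \<and> (\<sigma> \<in> w) = keep) \<and>
     (\<forall>j\<in>I. \<exists>\<sigma> v. joins d \<sigma> (u j) v \<and> (\<sigma> \<in> w) = (\<not> keep)))"

lemma box_diff_unit: "i < d \<Longrightarrow> u + unit i \<in> box d r \<Longrightarrow> u \<in> box d (Suc r)"
  using box_diff[OF _ unit_in_box, of "u + unit i" d r i] by simp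

lemma joins_box:
  assumes "joins d \<sigma> u v" "u \<in> box d r"
  shows "\<sigma> \<in> window d (Suc r)" "v \<in> box d (Suc r)"
proof -
  obtain z i where \<sigma>: "\<sigma> = (z, i)" by fastforce
  have i: "i < d" using assms \<sigma> by (simp add: joins_def)
  have "z = u \<and> z + unit i = v \<or> z = v \<and> z + unit i = u"
    using assms \<sigma> by (auto simp: joins_def doubleton_eq_iff)
  then show "\<sigma> \<in> window d (Suc r)" "v \<in> box d (Suc r)"
    using assms(2) \<sigma> i box_add[OF assms(2) unit_in_box[OF i]] box_diff_unit[OF i, of z r]
      box_mono[of r "Suc r" u d]
    by (auto simp: window_def)
qed

context torus
begin

lemma joins_edge: "joins d \<sigma> u v \<Longrightarrow> edge L x \<sigma> = {shift L x u, shift L x v}"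
  by (auto simp: joins_def edge_def doubleton_eq_iff)

lemma joins_if_edge:
  assumes L: "L \<ge> 2" and e: "{shift L x u, y} \<in> E L"
  obtains \<sigma> v where "joins d \<sigma> u v" "y = shift L x v"
proof -
  obtain i where i: "i < d" "y = shift L (shift L x u) (unit i) \<or> y = shift L (shift L x u) (- unit i)"
    using e edges_iff[OF L] by blast
  then have "y = shift L x (u + unit i) \<or> y = shift L x (u + - unit i)"
    using L shift_shift[of L x u] by auto
  moreover have "joins d (u, i) u (u + unit i)" "joins d (u + - unit i, i) u (u + - unit i)"
    using i by (auto simp: joins_def insert_commute)
  ultimately show ?thesis using that by blast
qed

lemma card_torus_neighbours:
  assumes "L \<ge> 3" "x \<in> V L"
  shows "finite {y. {x, y} \<in> E L}" "card {y. {x, y} \<in> E L} = 2 * d"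
proof -
  define N where "N = (\<lambda>(i, b). if b then unit i else - unit i) ` ({..<d} \<times> {True, False})"
  have "{..<d} \<times> {True, False} = (\<lambda>i. (i, True)) ` {..<d} \<union> (\<lambda>i. (i, False)) ` {..<d}" by auto
  then have "N = unit ` {..<d} \<union> (\<lambda>i. - unit i) ` {..<d}"
    unfolding N_def by (simp add: image_Un image_image)
  then have eq: "{y. {x, y} \<in> E L} = shift L x ` N"
    using edges_iff[of L x] assms shift_in_V[of L x] by auto
  have ne: "unit i \<noteq> - unit j" for i j
    using unit_add_nonzero[of i j] by (metis add.commute add.right_inverse)
  have "inj_on (\<lambda>(i, b). if b then unit i else - unit i) ({..<d} \<times> {True, False})"
  proof (rule inj_onI)
    fix p q :: "nat \<times> bool"
    assume pq: "(case p of (i, b) \<Rightarrow> if b then unit i else - unit i) = (case q of (i, b) \<Rightarrow> if b then unit i else - unit i)"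
    obtain i b j c where "p = (i, b)" "q = (j, c)" by fastforce
    then show "p = q" using pq ne ne[symmetric] by (cases b; cases c) (auto simp: unit_inj)
  qed
  then have cN: "card N = 2 * d" unfolding N_def by (simp add: card_image card_cartesian_product)
  have "N \<subseteq> Box 1" using unit_in_box box_minus[OF unit_in_box] by (auto simp: N_def)
  then have "inj_on (shift L x) N"
    using assms(1) by (intro inj_onI shift_inj[of 1 L _ _ x]) auto
  then show "card {y. {x, y} \<in> E L} = 2 * d" using cN by (simp add: eq card_image)
  show "finite {y. {x, y} \<in> E L}" unfolding eq by (simp add: N_def)
qed

lemma deficient_marked_graph:
  assumes "L \<ge> 3" "x \<in> V L"
  shows "deficient (2 * d) (marked_graph L keep S) x \<longleftrightarrow> (\<exists>y. {x, y} \<in> E L \<and> ({x, y} \<in> S) = (\<not> keep))"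
proof -
  let ?N = "{y. {x, y} \<in> E L}" and ?G = "{y. {x, y} \<in> E L \<and> ({x, y} \<in> S) = keep}"
  note N = card_torus_neighbours[OF assms]
  have sub: "?G \<subseteq> ?N" by auto
  have inV: "?N \<subseteq> V L" using edges_iff[of L x] assms by auto
  show ?thesis
  proof
    assume def: "deficient (2 * d) (marked_graph L keep S) x"
    show "\<exists>y. {x, y} \<in> E L \<and> ({x, y} \<in> S) = (\<not> keep)"
    proof (rule ccontr)
      assume "\<not> ?thesis"
      then have "\<forall>y\<in>?N. {x, y} \<in> snd (marked_graph L keep S)" by (auto simp: marked_graph_def)
      then show False using def N inV unfolding deficient_def by (auto simp: marked_graph_def)
    qed
  next
    assume "\<exists>y. {x, y} \<in> E L \<and> ({x, y} \<in> S) = (\<not> keep)"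
    then have "?G \<subset> ?N" by auto
    from psubset_card_mono[OF N(1) this] have lt: "card ?G < 2 * d" by (simp only: N(2))
    show "deficient (2 * d) (marked_graph L keep S) x"
      unfolding deficient_def
    proof clarify
      fix Y assume "card Y = 2 * d" "\<forall>y\<in>Y. {x, y} \<in> snd (marked_graph L keep S)"
      then have "Y \<subseteq> ?G" by (auto simp: marked_graph_def)
      then have "card Y \<le> card ?G" using N(1) sub by (intro card_mono) (auto intro: finite_subset)
      then show False using lt \<open>card Y = 2 * d\<close> by simp
    qed
  qed
qed

text \<open>The path in \<open>\<int>\<^sup>d\<close> is projected to the torus. It stays in a box on which the projection is injective.\<close>

lemma has_path_if_realizes:
  assumes L: "L > 2 * m + 4" and x: "x \<in> V L" and I: "I \<subseteq> {..m}"
    and w: "realizes d keep m I (pattern L S (Suc m) x)"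
  shows "has_path m I (2 * d) (marked_graph L keep S)"
proof -
  obtain u where u: "u 0 = 0" "inj_on u {..m}"
    "\<And>j. j < m \<Longrightarrow> \<exists>\<sigma>. joins d \<sigma> (u j) (u (Suc j)) \<and> (\<sigma> \<in> pattern L S (Suc m) x) = keep"
    "\<And>j. j \<in> I \<Longrightarrow> \<exists>\<sigma> v. joins d \<sigma> (u j) v \<and> (\<sigma> \<in> pattern L S (Suc m) x) = (\<not> keep)"
    using w unfolding realizes_def by blast
  have ub: "u j \<in> Box j" if "j \<le> m" for j
    using that
  proof (induction j)
    case (Suc j)
    then show ?case using u(3)[of j] joins_box(2) by auto
  qed (simp add: u(1) box_0)
  have ubm: "u j \<in> Box m" if "j \<le> m" for j using ub[OF that] box_mono that by blast
  have mem: "edge L x \<sigma> \<in> E L \<and> (edge L x \<sigma> \<in> S) = (\<sigma> \<in> pattern L S (Suc m) x)"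
    if "joins d \<sigma> (u j) v" "j \<le> m" for \<sigma> v j
    using joins_box(1)[OF that(1) ubm[OF that(2)]] L that(1)
    by (auto simp: pattern_def joins_def intro!: edge_in_E)
  show ?thesis
    unfolding has_path_def
  proof (intro exI[of _ "\<lambda>j. shift L x (u j)"] conjI allI impI ballI)
    show "(\<lambda>j. shift L x (u j)) ` {..m} \<subseteq> fst (marked_graph L keep S)"
      using shift_in_V L by (auto simp: marked_graph_def)
    show "inj_on (\<lambda>j. shift L x (u j)) {..m}"
      using u(2) shift_inj[of m L] ubm L by (auto simp: inj_on_def)
    fix j assume j: "j < m"
    then obtain \<sigma> where \<sigma>: "joins d \<sigma> (u j) (u (Suc j))" "(\<sigma> \<in> pattern L S (Suc m) x) = keep"
      using u(3) by blast
    then show "{shift L x (u j), shift L x (u (Suc j))} \<in> snd (marked_graph L keep S)"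
      using mem[OF \<sigma>(1)] j joins_edge[OF \<sigma>(1)] by (simp add: marked_graph_def)
  next
    fix j assume j: "j \<in> I"
    then obtain \<sigma> v where \<sigma>: "joins d \<sigma> (u j) v" "(\<sigma> \<in> pattern L S (Suc m) x) = (\<not> keep)"
      using u(4) by blast
    have "{shift L x (u j), shift L x v} \<in> E L \<and> ({shift L x (u j), shift L x v} \<in> S) = (\<not> keep)"
      using mem[OF \<sigma>(1)] j I joins_edge[OF \<sigma>(1)] \<sigma>(2) by auto
    then show "deficient (2 * d) (marked_graph L keep S) (shift L x (u j))"
      using deficient_marked_graph[of L "shift L x (u j)"] L shift_in_V by auto
  qed
qed

text \<open>The path in the torus is lifted to \<open>\<int>\<^sup>d\<close> step by step.\<close>

lemma realizes_if_has_path: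
  assumes L: "L > 2 * m + 4" and I: "I \<subseteq> {..m}"
    and path: "has_path m I (2 * d) (marked_graph L keep S)"
  obtains x where "x \<in> V L" "realizes d keep m I (pattern L S (Suc m) x)"
proof -
  obtain f where f: "f ` {..m} \<subseteq> V L" "inj_on f {..m}"
    "\<And>j. j < m \<Longrightarrow> {f j, f (Suc j)} \<in> E L \<and> ({f j, f (Suc j)} \<in> S) = keep"
    "\<And>j. j \<in> I \<Longrightarrow> deficient (2 * d) (marked_graph L keep S) (f j)"
    using path unfolding has_path_def by (auto simp: marked_graph_def)
  define x where "x = f 0"
  have x: "x \<in> V L" using f(1) by (auto simp: x_def)
  have pos: "L > 0" "L \<ge> 2" "L \<ge> 3" using L by auto
  have "\<exists>u. u 0 = 0 \<and> (\<forall>j\<le>n. f j = shift L x (u j)) \<and> (\<forall>j<n. \<exists>\<sigma>. joins d \<sigma> (u j) (u (Suc j)))"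
    if "n \<le> m" for n
    using that
  proof (induction n)
    case 0
    show ?case by (rule exI[of _ "\<lambda>_. 0"]) (use shift_0[OF x] in \<open>auto simp: x_def zero_fun_def\<close>)
  next
    case (Suc n)
    from Suc.IH[OF Suc_leD[OF Suc.prems]] obtain u
      where u: "u 0 = 0" "\<And>j. j \<le> n \<Longrightarrow> f j = shift L x (u j)"
      "\<And>j. j < n \<Longrightarrow> \<exists>\<sigma>. joins d \<sigma> (u j) (u (Suc j))" by blast
    have "{shift L x (u n), f (Suc n)} \<in> E L" using f(3)[of n] Suc.prems u(2)[of n] by simp
    from joins_if_edge[OF pos(2) this] obtain \<sigma> v where v: "joins d \<sigma> (u n) v" "f (Suc n) = shift L x v" .
    show ?case
    proof (intro exI[of _ "u(Suc n := v)"] conjI allI impI)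
      show "\<exists>\<sigma>. joins d \<sigma> ((u(Suc n := v)) j) ((u(Suc n := v)) (Suc j))" if "j < Suc n" for j
      proof (cases "j = n")
        case True
        then show ?thesis using v(1) by (intro exI[of _ \<sigma>]) simp
      next
        case False
        then show ?thesis using u(3)[of j] that by simp
      qed
    qed (use u v(2) in \<open>auto simp: le_Suc_eq\<close>)
  qed
  then obtain u where u: "u 0 = 0" "\<And>j. j \<le> m \<Longrightarrow> f j = shift L x (u j)"
    "\<And>j. j < m \<Longrightarrow> \<exists>\<sigma>. joins d \<sigma> (u j) (u (Suc j))" by blast
  have ub: "u j \<in> Box j" if "j \<le> m" for j
    using that
  proof (induction j)
    case (Suc j)
    then show ?case using u(3)[of j] joins_box(2) by auto
  qed (simp add: u(1) box_0)
  have ubm: "u j \<in> Box m" if "j \<le> m" for j using ub[OF that] box_mono that by blast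
  have mem: "(\<sigma> \<in> pattern L S (Suc m) x) = (edge L x \<sigma> \<in> S)"
    if "joins d \<sigma> (u j) v" "j \<le> m" for \<sigma> v j
    using joins_box(1)[OF that(1) ubm[OF that(2)]] by (auto simp: pattern_def)
  have "realizes d keep m I (pattern L S (Suc m) x)"
    unfolding realizes_def
  proof (intro exI[of _ u] conjI allI impI ballI u(1))
    show "inj_on u {..m}"
    proof (rule inj_onI)
      fix i j assume "i \<in> {..m}" "j \<in> {..m}" "u i = u j"
      then show "i = j" using f(2) u(2) by (auto simp: inj_on_def)
    qed
    fix j assume j: "j < m"
    then obtain \<sigma> where \<sigma>: "joins d \<sigma> (u j) (u (Suc j))" using u(3) by blast
    have "edge L x \<sigma> = {f j, f (Suc j)}" using joins_edge[OF \<sigma>] u(2) j by simp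
    then have "(\<sigma> \<in> pattern L S (Suc m) x) = keep" using mem[OF \<sigma>] f(3)[OF j] j by simp
    then show "\<exists>\<sigma>. joins d \<sigma> (u j) (u (Suc j)) \<and> (\<sigma> \<in> pattern L S (Suc m) x) = keep" using \<sigma> by blast
  next
    fix j assume j: "j \<in> I"
    then have jm: "j \<le> m" "f j \<in> V L" using I f(1) by auto
    obtain y where y: "{f j, y} \<in> E L" "({f j, y} \<in> S) = (\<not> keep)"
      using f(4)[OF j] deficient_marked_graph[OF pos(3) jm(2)] by blast
    have "{shift L x (u j), y} \<in> E L" using y(1) u(2)[OF jm(1)] by simp
    from joins_if_edge[OF pos(2) this] obtain \<sigma> v where v: "joins d \<sigma> (u j) v" "y = shift L x v" .
    have "edge L x \<sigma> = {f j, y}" using joins_edge[OF v(1)] u(2)[OF jm(1)] v(2) by simp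
    then have "(\<sigma> \<in> pattern L S (Suc m) x) = (\<not> keep)" using mem[OF v(1) jm(1)] y(2) by simp
    then show "\<exists>\<sigma> v. joins d \<sigma> (u j) v \<and> (\<sigma> \<in> pattern L S (Suc m) x) = (\<not> keep)" using v(1) by blast
  qed
  then show ?thesis using that x by blast
qed

section \<open>The least number of marks\<close>

definition pt :: "nat \<Rightarrow> nat \<Rightarrow> nat \<Rightarrow> int" where
  "pt a b = (\<lambda>i. if i = 0 then int a else if i = 1 then int b else 0)"

lemma pt_0: "pt 0 0 = 0"
  by (auto simp: pt_def fun_eq_iff)

lemma pt_inj: "pt a b = pt a' b' \<longleftrightarrow> a = a' \<and> b = b'"
  by (auto simp: pt_def fun_eq_iff)

lemma pt_unit: "pt a b + unit 0 = pt (Suc a) b" "pt a 0 + unit (Suc 0) = pt a (Suc 0)"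
  by (auto simp: pt_def unit_def fun_eq_iff)

lemma pt_box: "a \<le> r \<Longrightarrow> b \<le> r \<Longrightarrow> pt a b \<in> Box r"
  using d_ge2 by (auto simp: pt_def box_def)

text \<open>A self-avoiding path uses each edge only once.\<close>

lemma path_marks:
  assumes "realizes d True k {} w" "finite w"
  shows "k \<le> card w"
proof -
  obtain u where u: "inj_on u {..k}" "\<And>j. j < k \<Longrightarrow> \<exists>\<sigma>. joins d \<sigma> (u j) (u (Suc j)) \<and> \<sigma> \<in> w"
    using assms(1) unfolding realizes_def by auto
  define g where "g j = (SOME \<sigma>. joins d \<sigma> (u j) (u (Suc j)) \<and> \<sigma> \<in> w)" for j
  have g: "joins d (g j) (u j) (u (Suc j))" "g j \<in> w" if "j < k" for j
    using someI_ex[OF u(2)[OF that]] unfolding g_def by auto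
  have "inj_on g {..<k}"
  proof (rule inj_onI)
    fix i j assume ij: "i \<in> {..<k}" "j \<in> {..<k}" "g i = g j"
    then have "{u i, u (Suc i)} = {u j, u (Suc j)}" using g(1)[of i] g(1)[of j] by (auto simp: joins_def)
    then have "u i = u j \<or> u i = u (Suc j) \<and> u (Suc i) = u j" by (auto simp: doubleton_eq_iff)
    then show "i = j" using ij by (auto simp: inj_on_eq_iff[OF u(1)])
  qed
  then have "card (g ` {..<k}) = k" by (simp add: card_image)
  moreover have "g ` {..<k} \<subseteq> w" using g(2) by auto
  ultimately show ?thesis using card_mono[OF assms(2)] by metis
qed

lemma path_example:
  "\<exists>w\<subseteq>Window (Suc k). card w = k \<and> realizes d True k {} w"
proof (intro exI[of _ "(\<lambda>j. (pt j 0, 0)) ` {..<k}"] conjI)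
  show "(\<lambda>j. (pt j 0, 0)) ` {..<k} \<subseteq> Window (Suc k)"
    using d_ge2 by (auto simp: window_def intro: pt_box)
  show "card ((\<lambda>j. (pt j 0, 0 :: nat)) ` {..<k}) = k"
    by (subst card_image) (auto simp: inj_on_def pt_inj)
  show "realizes d True k {} ((\<lambda>j. (pt j 0, 0)) ` {..<k})"
    unfolding realizes_def
  proof (intro exI[of _ "\<lambda>j. pt j 0"] conjI allI impI)
    fix j assume "j < k"
    then show "\<exists>\<sigma>. joins d \<sigma> (pt j 0) (pt (Suc j) 0) \<and> (\<sigma> \<in> (\<lambda>j. (pt j 0, 0)) ` {..<k}) = True"
      using d_ge2 by (intro exI[of _ "(pt j 0, 0)"]) (auto simp: joins_def pt_unit)
  qed (auto simp: pt_0 inj_on_def pt_inj)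
qed

text \<open>Take a ladder in the plane whose \<open>k\<close> rungs are deleted. The path runs along one side, crosses over
  just behind the last rung, and returns on the other side. Its \<open>2 * k + 2\<close> vertices other than the
  two at the crossing are end points of the deleted rungs.\<close>

definition ladder :: "nat \<Rightarrow> nat set" where
  "ladder k = {..2 * k + 1} - {k, Suc k}"

text \<open>There are \<open>2 * k\<close> deficient vertices on the path, and each deleted edge accounts for at most two.\<close>

lemma ladder_marks:
  assumes "realizes d False (2 * k + 1) (ladder k) w" "finite w"
  shows "k \<le> card w"
proof -
  obtain u where u: "inj_on u {..2 * k + 1}" "\<And>j. j \<in> ladder k \<Longrightarrow> \<exists>\<sigma> v. joins d \<sigma> (u j) v \<and> \<sigma> \<in> w"
    using assms(1) unfolding realizes_def by auto
  have "u ` ladder k \<subseteq> (\<Union>\<sigma>\<in>w. {fst \<sigma>, fst \<sigma> + unit (snd \<sigma>)})"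
  proof
    fix z assume "z \<in> u ` ladder k"
    then obtain \<sigma> v where "joins d \<sigma> z v" "\<sigma> \<in> w" using u(2) by blast
    then show "z \<in> (\<Union>\<sigma>\<in>w. {fst \<sigma>, fst \<sigma> + unit (snd \<sigma>)})" unfolding joins_def by blast
  qed
  then have "card (u ` ladder k) \<le> card (\<Union>\<sigma>\<in>w. {fst \<sigma>, fst \<sigma> + unit (snd \<sigma>)})"
    using assms(2) by (intro card_mono) auto
  also have "\<dots> \<le> (\<Sum>\<sigma>\<in>w. card {fst \<sigma>, fst \<sigma> + unit (snd \<sigma>)})"
    by (rule card_UN_le[OF assms(2)])
  also have "\<dots> \<le> (\<Sum>\<sigma>\<in>w. 2)" by (intro sum_mono) (simp add: card_insert_if)
  finally have "card (u ` ladder k) \<le> 2 * card w" by simp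
  moreover have "card (u ` ladder k) = card (ladder k)"
    using u(1) by (intro card_image) (auto simp: ladder_def inj_on_def)
  moreover have "card (ladder k) = 2 * k"
    unfolding ladder_def by (subst card_Diff_subset) auto
  ultimately show ?thesis by simp
qed

lemma ladder_example:
  "\<exists>w\<subseteq>Window (Suc (2 * k + 1)). card w = k \<and> realizes d False (2 * k + 1) (ladder k) w"
proof (intro exI[of _ "(\<lambda>j. (pt j 0, 1)) ` {..<k}"] conjI)
  let ?w = "(\<lambda>j. (pt j 0, 1)) ` {..<k} :: slot set"
  show "?w \<subseteq> Window (Suc (2 * k + 1))"
    using d_ge2 by (auto simp: window_def intro: pt_box)
  show "card ?w = k"
    by (subst card_image) (auto simp: inj_on_def pt_inj)
  define u where "u j = (if j \<le> k then pt j 0 else pt (2 * k + 1 - j) 1)" for j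
  show "realizes d False (2 * k + 1) (ladder k) ?w"
    unfolding realizes_def
  proof (intro exI[of _ u] conjI allI impI ballI)
    show "u 0 = 0" by (simp add: u_def pt_0)
    show "inj_on u {..2 * k + 1}" by (auto simp: inj_on_def u_def pt_inj split: if_splits)
  next
    fix j assume j: "j < 2 * k + 1"
    consider "j < k" | "j = k" | "j > k" by linarith
    then show "\<exists>\<sigma>. joins d \<sigma> (u j) (u (Suc j)) \<and> (\<sigma> \<in> ?w) = False"
    proof cases
      case 1
      then show ?thesis
        using d_ge2 by (intro exI[of _ "(pt j 0, 0)"]) (auto simp: joins_def u_def pt_unit)
    next
      case 2
      then show ?thesis
        using d_ge2 by (intro exI[of _ "(pt k 0, 1)"]) (auto simp: joins_def u_def pt_unit pt_inj)
    next
      case 3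
      then have "2 * k + 1 - j = Suc (2 * k - j)" using j by simp
      then show ?thesis
        using 3 d_ge2
        by (intro exI[of _ "(pt (2 * k - j) 1, 0)"]) (auto simp: joins_def u_def pt_unit insert_commute)
    qed
  next
    fix j assume j: "j \<in> ladder k"
    show "\<exists>\<sigma> v. joins d \<sigma> (u j) v \<and> (\<sigma> \<in> ?w) = (\<not> False)"
    proof (cases "j < k")
      case True
      then show ?thesis
        using d_ge2 by (intro exI[of _ "(pt j 0, 1)"] exI[of _ "pt j 1"]) (auto simp: joins_def u_def pt_unit)
    next
      case False
      then have "j > Suc k" "j \<le> 2 * k + 1" using j by (auto simp: ladder_def)
      then show ?thesis
        using d_ge2
        by (intro exI[of _ "(pt (2 * k + 1 - j) 0, 1)"] exI[of _ "pt (2 * k + 1 - j) 0"])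
          (auto simp: joins_def u_def pt_unit insert_commute)
    qed
  qed
qed

lemma marks_example:
  "\<exists>m I. I \<subseteq> {..m} \<and> (\<forall>w. realizes d keep m I w \<longrightarrow> finite w \<longrightarrow> k \<le> card w) \<and>
    (\<exists>w\<subseteq>Window (Suc m). card w = k \<and> realizes d keep m I w)"
proof (cases keep)
  case True
  then show ?thesis
    using path_marks path_example by (intro exI[of _ k] exI[of _ "{}"]) auto
next
  case False
  have "ladder k \<subseteq> {..2 * k + 1}" by (auto simp: ladder_def)
  moreover have "keep = False" using False by simp
  ultimately show ?thesis
    using ladder_marks[of k] ladder_example[of k] by blast
qed

text \<open>For each \<open>k\<close> there is a path property that \<open>k\<close> marks suffice for, but fewer do not. On sparse tori it
  holds if and only if one of finitely many \<open>k\<close>-mark patterns is seen, and \<open>c\<close> is the number of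
  translation classes of these patterns.\<close>

theorem critical_sentence:
  assumes k: "k \<ge> 1"
  shows "\<exists>\<phi> c. fo_sentence \<phi> \<and> c > (0::real) \<and> (\<forall>L r. torus_sequence d L r \<longrightarrow>
    (\<forall>l. (\<lambda>n. real (L n ^ d) * r n ^ k) \<longlonglongrightarrow> l \<longrightarrow>
      (\<lambda>n. subset_prob (E (L n)) (r n) {S. fo_models (marked_graph (L n) keep S) \<phi>})
        \<longlonglongrightarrow> 1 - exp (- (c * l))) \<and>
    (filterlim (\<lambda>n. real (L n ^ d) * r n ^ k) at_top sequentially \<longrightarrow>
      (\<lambda>n. subset_prob (E (L n)) (r n) {S. fo_models (marked_graph (L n) keep S) \<phi>})
        \<longlonglongrightarrow> 1))"
proof -
  obtain m I where mI: "I \<subseteq> {..m}"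
    "\<forall>w. realizes d keep m I w \<longrightarrow> finite w \<longrightarrow> k \<le> card w"
    "\<exists>w\<subseteq>Window (Suc m). card w = k \<and> realizes d keep m I w"
    using marks_example[of keep k] by blast
  obtain \<phi> where \<phi>: "fo_sentence \<phi>" "\<And>G :: (nat \<Rightarrow> nat) graph. fst G \<noteq> {} \<Longrightarrow> fo_models G \<phi> \<longleftrightarrow> has_path m I (2 * d) G"
    using has_path_sentence[OF mI(1), where D = "2 * d"] by blast
  define Q where "Q = {w. w \<subseteq> Window (Suc m) \<and> card w = k \<and> realizes d keep m I w}"
  obtain w0 where w0: "w0 \<in> Q" using mI(3) by (auto simp: Q_def)
  have finQ: "finite Q"
    by (rule finite_subset[of _ "Pow (Window (Suc m))"]) (auto simp: Q_def finite_window)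
  define c where "c = real (card (rep (Suc m) ` Q))"
  have c: "c > 0" using w0 finQ by (auto simp: c_def card_gt_0_iff)
  have models: "fo_models (marked_graph L keep S) \<phi> \<longleftrightarrow> has_path m I (2 * d) (marked_graph L keep S)" if "L > 2 * m + 4" for L S
    using \<phi>(2)[of "marked_graph L keep S"] shift_in_V[of L undefined undefined] that by (auto simp: marked_graph_def)
  have found: "fo_models (marked_graph L keep S) \<phi>" if "L > 2 * m + 4" "x \<in> V L" "pattern L S (Suc m) x \<in> Q" for L S x
    using models[OF that(1)] has_path_if_realizes[OF that(1,2) mI(1)] that(3) by (simp add: Q_def)
  have iff: "\<not> fo_models (marked_graph L keep S) \<phi> \<longleftrightarrow> \<not> (\<exists>x\<in>V L. pattern L S (Suc m) x \<in> Q)"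
    if L: "L > 2 * m + 4" and sp: "sparse L S (Suc m) k" for L S
  proof -
    have "\<exists>x\<in>V L. pattern L S (Suc m) x \<in> Q" if "fo_models (marked_graph L keep S) \<phi>"
    proof -
      have "has_path m I (2 * d) (marked_graph L keep S)" using models[OF L] that by simp
      from realizes_if_has_path[OF L mI(1) this]
      obtain x where x: "x \<in> V L" "realizes d keep m I (pattern L S (Suc m) x)" .
      have "finite (pattern L S (Suc m) x)" using pattern_subset finite_window finite_subset by metis
      then have "card (pattern L S (Suc m) x) = k" using mI(2)[rule_format, OF x(2)] sp x(1) by (simp add: sparse_def le_antisym)
      then show ?thesis using x pattern_subset by (auto simp: Q_def)
    qed
    then show ?thesis using found[OF L] by blast
  qed
  show ?thesis
  proof (intro exI[of _ \<phi>] exI[of _ c] conjI allI impI \<phi>(1) c)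
    fix L r l assume ts: "torus_sequence d L r" and l: "(\<lambda>n. real (L n ^ d) * r n ^ k) \<longlonglongrightarrow> l"
    interpret ts: torus_sequence d L r by (rule ts)
    have "(\<lambda>n. ts.pr n (\<lambda>S. \<not> fo_models (marked_graph (L n) keep S) \<phi>)) \<longlonglongrightarrow> exp (- (c * l))"
    proof (rule ts.pr_diff_0[OF ts.not_sparse_unlikely[OF ts.rate_Suc_0[OF l], of "Suc m"]])
      show "\<forall>\<^sub>F n in sequentially. \<forall>S. \<not> \<not> sparse (L n) S (Suc m) k \<longrightarrow>
        (\<not> fo_models (marked_graph (L n) keep S) \<phi> \<longleftrightarrow> \<not> (\<exists>x\<in>V (L n). pattern (L n) S (Suc m) x \<in> Q))"
        using ts.L_large[of "2 * m + 4"] by eventually_elim (use iff in blast)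
      show "(\<lambda>n. ts.pr n (\<lambda>S. \<not> (\<exists>x\<in>V (L n). pattern (L n) S (Suc m) x \<in> Q))) \<longlonglongrightarrow> exp (- (c * l))"
        unfolding c_def by (rule ts.pattern_absent_limit[OF l k]) (auto simp: Q_def)
    qed
    from tendsto_diff[OF tendsto_const[of 1] this]
    show "(\<lambda>n. ts.pr n (\<lambda>S. fo_models (marked_graph (L n) keep S) \<phi>)) \<longlonglongrightarrow> 1 - exp (- (c * l))"
      by (subst prob_eq_one_minus)
  next
    fix L r assume ts: "torus_sequence d L r"
      and top: "filterlim (\<lambda>n. real (L n ^ d) * r n ^ k) at_top sequentially"
    interpret ts: torus_sequence d L r by (rule ts)
    have w: "w0 \<subseteq> Window (Suc m)" "card w0 = k" "w0 \<noteq> {}" using w0 k by (auto simp: Q_def)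
    have "(\<lambda>n. ts.pr n (\<lambda>S. card (occurrences (L n) S (Suc m) w0) < 1)) \<longlonglongrightarrow> 0"
      using top w by (intro ts.pattern_frequent) auto
    then have "(\<lambda>n. ts.pr n (\<lambda>S. \<not> fo_models (marked_graph (L n) keep S) \<phi>)) \<longlonglongrightarrow> 0"
    proof (rule ts.pr_mono_0)
      show "\<forall>\<^sub>F n in sequentially. \<forall>S. \<not> fo_models (marked_graph (L n) keep S) \<phi> \<longrightarrow>
        card (occurrences (L n) S (Suc m) w0) < 1"
        using ts.L_large[of "2 * m + 4"]
      proof eventually_elim
        case (elim n)
        have "card (occurrences (L n) S (Suc m) w0) < 1"
          if "\<not> fo_models (marked_graph (L n) keep S) \<phi>" for S
        proof -
          have "occurrences (L n) S (Suc m) w0 = {}" using found[OF elim] w0 that by blast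
          then show ?thesis by (simp only: card.empty zero_less_one)
        qed
        then show ?case by blast
      qed
    qed
    from tendsto_diff[OF tendsto_const[of 1] this]
    have "(\<lambda>n. 1 - ts.pr n (\<lambda>S. \<not> fo_models (marked_graph (L n) keep S) \<phi>)) \<longlonglongrightarrow> 1" by simp
    then show "(\<lambda>n. ts.pr n (\<lambda>S. fo_models (marked_graph (L n) keep S) \<phi>)) \<longlonglongrightarrow> 1"
      by (subst prob_eq_one_minus)
  qed
qed

end

section \<open>Percolation\<close>

lemma map_Not_bernoulli:
  assumes "0 \<le> q" "q \<le> 1"
  shows "map_pmf Not (bernoulli_pmf q) = bernoulli_pmf (1 - q)"
proof (rule pmf_eqI)
  fix b
  have "pmf (map_pmf Not (bernoulli_pmf q)) (\<not> \<not> b) = pmf (bernoulli_pmf q) (\<not> b)"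
    by (rule pmf_map_inj') (auto simp: inj_def)
  then show "pmf (map_pmf Not (bernoulli_pmf q)) b = pmf (bernoulli_pmf (1 - q)) b"
    using assms by (cases b) auto
qed

text \<open>This turns the case of few deleted edges into one of few marked edges.\<close>

lemma random_subset_complement:
  assumes "finite E" "0 \<le> q" "q \<le> 1"
  shows "random_subset E (1 - q) = map_pmf (\<lambda>S. E - S) (random_subset E q)"
proof -
  have "Pi_pmf E True (\<lambda>_. bernoulli_pmf (1 - q)) = map_pmf (\<lambda>h. Not \<circ> h) (Pi_pmf E False (\<lambda>_. bernoulli_pmf q))"
    using Pi_pmf_map[OF assms(1), of Not False True "\<lambda>_. bernoulli_pmf q"] map_Not_bernoulli[OF assms(2,3)] by simp
  then have "Pi_pmf E False (\<lambda>_. bernoulli_pmf (1 - q)) =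
    map_pmf (\<lambda>f x. if x \<in> E then f x else False) (map_pmf (\<lambda>h. Not \<circ> h) (Pi_pmf E False (\<lambda>_. bernoulli_pmf q)))"
    using Pi_pmf_default_swap[OF assms(1), of False True "\<lambda>_. bernoulli_pmf (1 - q)"] by simp
  then show ?thesis
    unfolding random_subset_def
    by (auto simp: pmf.map_comp o_def intro!: map_pmf_cong)
qed

context torus
begin

lemma fo_prob_retained:
  "fo_prob (torus_percolation d L q) \<phi>
    = subset_prob (E L) q {S. fo_models (marked_graph L True S) \<phi>}"
proof -
  have "torus_percolation d L q = map_pmf (marked_graph L True) (random_subset (E L) q)"
    by (auto simp: torus_percolation_def random_subset_def marked_graph_def pmf.map_comp o_def intro!: map_pmf_cong)
  then show ?thesis by (simp add: fo_prob_def vimage_def)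
qed

lemma fo_prob_deleted:
  assumes "0 \<le> q" "q \<le> 1"
  shows "fo_prob (torus_percolation d L q) \<phi>
    = subset_prob (E L) (1 - q) {S. fo_models (marked_graph L False S) \<phi>}"
proof -
  have "marked_graph L False (E L - S) = marked_graph L True S" for S by (auto simp: marked_graph_def)
  then show ?thesis
    unfolding fo_prob_retained random_subset_complement[OF finite_torus_edges assms]
    by (simp add: vimage_def)
qed

end

text \<open>The number in question is \<open>N\<close> to the power \<open>1 - \<alpha> * j + o(1)\<close>.\<close>

lemma power_decay_rate:
  fixes \<rho> :: "nat \<Rightarrow> real"
  assumes d: "d \<ge> 1" and decay: "power_decay d \<rho> \<alpha>"
  shows "\<alpha> * real j < 1 \<Longrightarrow> filterlim (\<lambda>L. real (L ^ d) * \<rho> (L ^ d) ^ j) at_top sequentially"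
    and "\<alpha> * real j > 1 \<Longrightarrow> (\<lambda>L. real (L ^ d) * \<rho> (L ^ d) ^ j) \<longlonglongrightarrow> 0"
proof -
  obtain \<epsilon> where \<epsilon>: "\<epsilon> \<in> o(\<lambda>_. 1)"
    and \<rho>: "\<forall>\<^sub>F L in sequentially. \<rho> (L ^ d) = real (L ^ d) powr (- \<alpha> + \<epsilon> L)"
    using decay by (auto simp: power_decay_def)
  have \<epsilon>0: "(\<lambda>L. real j * \<epsilon> L) \<longlonglongrightarrow> 0"
    using tendsto_mult_right_zero[OF smalloD_tendsto[OF \<epsilon>, simplified]] by simp
  have N: "filterlim (\<lambda>L. real (L ^ d)) at_top sequentially"
  proof (rule filterlim_at_top_mono[OF filterlim_real_sequentially])
    show "\<forall>\<^sub>F L in sequentially. real L \<le> real (L ^ d)"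
      using eventually_gt_at_top[of 0]
    proof eventually_elim
      case (elim L)
      have "L ^ 1 \<le> L ^ d" using elim d by (intro power_increasing) auto
      then show ?case by simp
    qed
  qed
  have eq: "\<forall>\<^sub>F L in sequentially. real (L ^ d) * \<rho> (L ^ d) ^ j = real (L ^ d) powr ((1 - \<alpha> * real j) + real j * \<epsilon> L)"
    using \<rho> eventually_gt_at_top[of 0]
  proof eventually_elim
    case (elim L)
    define M where "M = real (L ^ d)"
    have M: "M > 0" using elim by (simp add: M_def)
    have "M * (M powr (- \<alpha> + \<epsilon> L)) ^ j = M powr 1 * M powr ((- \<alpha> + \<epsilon> L) * real j)"
      using M by (simp add: powr_powr powr_realpow[symmetric])
    also have "\<dots> = M powr (1 + (- \<alpha> + \<epsilon> L) * real j)" by (simp add: powr_add)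
    also have "1 + (- \<alpha> + \<epsilon> L) * real j = (1 - \<alpha> * real j) + real j * \<epsilon> L" by (simp add: algebra_simps)
    finally show ?case using elim by (simp add: M_def)
  qed
  define \<delta> where "\<delta> = 1 - \<alpha> * real j"
  have ge1: "\<forall>\<^sub>F L in sequentially. real (L ^ d) \<ge> 1"
    using N by (simp add: filterlim_at_top)
  show "filterlim (\<lambda>L. real (L ^ d) * \<rho> (L ^ d) ^ j) at_top sequentially" if "\<alpha> * real j < 1"
  proof -
    have \<delta>: "\<delta> > 0" using that by (simp add: \<delta>_def)
    have "filterlim (\<lambda>L. real (L ^ d) powr (\<delta> / 2)) at_top sequentially"
      using \<delta> by (intro filterlim_compose[OF real_powr_at_top N]) auto
    then show ?thesis
    proof (rule filterlim_at_top_mono)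
      have "\<forall>\<^sub>F L in sequentially. - (\<delta> / 2) < real j * \<epsilon> L"
        using \<delta> by (intro order_tendstoD(1)[OF \<epsilon>0]) auto
      then show "\<forall>\<^sub>F L in sequentially. real (L ^ d) powr (\<delta> / 2) \<le> real (L ^ d) * \<rho> (L ^ d) ^ j"
        using eq ge1
      proof eventually_elim
        case (elim L)
        have "\<delta> / 2 \<le> (1 - \<alpha> * real j) + real j * \<epsilon> L" using elim(1) unfolding \<delta>_def by argo
        then show ?case unfolding elim(2) using elim(3) by (rule powr_mono)
      qed
    qed
  qed
  show "(\<lambda>L. real (L ^ d) * \<rho> (L ^ d) ^ j) \<longlonglongrightarrow> 0" if "\<alpha> * real j > 1"
  proof -
    have \<delta>: "\<delta> < 0" using that by (simp add: \<delta>_def)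
    have lim: "(\<lambda>L. real (L ^ d) powr (\<delta> / 2)) \<longlonglongrightarrow> 0"
      using \<delta> by (intro tendsto_neg_powr N) auto
    have up: "\<forall>\<^sub>F L in sequentially. real (L ^ d) * \<rho> (L ^ d) ^ j \<le> real (L ^ d) powr (\<delta> / 2)"
    proof -
      have "\<forall>\<^sub>F L in sequentially. real j * \<epsilon> L < - (\<delta> / 2)"
        using \<delta> by (intro order_tendstoD(2)[OF \<epsilon>0]) auto
      then show ?thesis
        using eq ge1
      proof eventually_elim
        case (elim L)
        have "(1 - \<alpha> * real j) + real j * \<epsilon> L \<le> \<delta> / 2" using elim(1) unfolding \<delta>_def by argo
        then show ?case unfolding elim(2) using elim(3) by (rule powr_mono)
      qed
    qed
    have lo: "\<forall>\<^sub>F L in sequentially. 0 \<le> real (L ^ d) * \<rho> (L ^ d) ^ j"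
      using eq by eventually_elim (simp only: powr_ge_zero)
    show ?thesis by (rule tendsto_sandwich[OF lo up tendsto_const lim])
  qed
qed

context torus
begin

text \<open>Nothing is assumed about \<open>\<rho>\<close> at \<open>0\<close>; the successor avoids the side length \<open>0\<close>.\<close>

lemma torus_sequence_subsequence:
  assumes range: "\<And>L. L \<ge> 1 \<Longrightarrow> \<rho> (L ^ d) \<in> {0..1}" and \<rho>0: "(\<lambda>L. \<rho> (L ^ d)) \<longlonglongrightarrow> 0"
    and \<sigma>: "filterlim \<sigma> at_top sequentially"
  shows "torus_sequence d (\<lambda>n. Suc (\<sigma> n)) (\<lambda>n. \<rho> (Suc (\<sigma> n) ^ d))"
proof
  show S: "filterlim (\<lambda>n. Suc (\<sigma> n)) at_top sequentially"
    by (rule filterlim_compose[OF filterlim_Suc \<sigma>])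
  show "(\<lambda>n. \<rho> (Suc (\<sigma> n) ^ d)) \<longlonglongrightarrow> 0" by (rule filterlim_compose[OF \<rho>0 S])
  show "0 \<le> \<rho> (Suc (\<sigma> n) ^ d) \<and> \<rho> (Suc (\<sigma> n) ^ d) \<le> 1" for n using range[of "Suc (\<sigma> n)"] by simp
qed

text \<open>For \<open>\<alpha> \<noteq> 1 / k\<close> let \<open>k\<close> be the least number with \<open>\<alpha> * k > 1\<close>. Then the expected number of clusters of
  \<open>k - 1\<close> marks tends to infinity and that of \<open>k\<close> marks to \<open>0\<close>, and every sentence is decided. For
  \<open>\<alpha> = 1 / k\<close> the same holds at \<open>k\<close> or at \<open>k + 1\<close> if \<open>N * \<rho> ^ k\<close> tends to \<open>0\<close> or to infinity. If it tends
  to \<open>\<Lambda>\<close>, all probabilities converge, but the critical sentence has the limit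
  \<open>1 - exp (- c * \<Lambda>)\<close>, which is neither \<open>0\<close> nor \<open>1\<close>. Finally this limit is an injective function of
  \<open>\<Lambda>\<close> in \<open>[0, \<infinity>]\<close>. So if the probability of the critical sentence converges, then all
  subsequential limits of \<open>N * \<rho> ^ k\<close> are equal.\<close>

lemma four_alternatives:
  fixes \<rho> :: "nat \<Rightarrow> real" and X :: "nat \<Rightarrow> (nat \<Rightarrow> nat) graph pmf"
  assumes range: "\<And>L. L \<ge> 1 \<Longrightarrow> \<rho> (L ^ d) \<in> {0..1}"
    and X: "\<And>L \<phi>. L \<ge> 1 \<Longrightarrow> fo_prob (X L) \<phi>
      = subset_prob (E L) (\<rho> (L ^ d)) {S. fo_models (marked_graph L keep S) \<phi>}"
    and \<rho>0: "(\<lambda>L. \<rho> (L ^ d)) \<longlonglongrightarrow> 0" and decay: "power_decay d \<rho> \<alpha>" and \<alpha>: "\<alpha> > 0"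
  shows "(\<alpha> \<notin> {1 / real k | k :: nat. k \<ge> 1} \<longrightarrow> fo_zero_one_law X) \<and>
     (\<forall>k::nat. k \<ge> 1 \<and> \<alpha> = 1 / real k \<longrightarrow>
        ((\<lambda>L. real (L ^ d) * \<rho> (L ^ d) ^ k) \<longlonglongrightarrow> 0 \<or>
         filterlim (\<lambda>L. real (L ^ d) * \<rho> (L ^ d) ^ k) at_top sequentially \<longrightarrow>
           fo_zero_one_law X) \<and>
        (\<forall>\<Lambda>::real. \<Lambda> > 0 \<and> (\<lambda>L. real (L ^ d) * \<rho> (L ^ d) ^ k) \<longlonglongrightarrow> \<Lambda> \<longrightarrow>
           fo_convergence_law X \<and> \<not> fo_zero_one_law X) \<and>
        (\<not> (\<exists>l\<in>{0..\<infinity>::ereal}. (\<lambda>L. ereal (real (L ^ d) * \<rho> (L ^ d) ^ k)) \<longlonglongrightarrow> l) \<longrightarrow>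
           \<not> fo_convergence_law X))"
proof -
  define rate where "rate k L = real (L ^ d) * \<rho> (L ^ d) ^ k" for k L
  note decay_rate = power_decay_rate[OF _ decay, folded rate_def]
  have d1: "d \<ge> 1" using d_ge2 by simp
  interpret ts: torus_sequence d Suc "\<lambda>n. \<rho> (Suc n ^ d)"
    using torus_sequence_subsequence[OF range \<rho>0 filterlim_ident] by simp
  have prob: "fo_prob (X (Suc n)) \<phi> = ts.pr n (\<lambda>S. fo_models (marked_graph (Suc n) keep S) \<phi>)" for n \<phi>
    using X[of "Suc n" \<phi>] by simp
  have rate_Suc: "ts.rate k = (\<lambda>n. rate k (Suc n))" for k by (simp add: rate_def fun_eq_iff)
  have conv: "convergent (\<lambda>L. fo_prob (X L) \<phi>)"
      "l = 0 \<Longrightarrow> \<exists>x\<in>{0, 1}. (\<lambda>L. fo_prob (X L) \<phi>) \<longlonglongrightarrow> x"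
    if k: "k \<ge> 1" and top: "filterlim (rate (k - 1)) at_top sequentially" and l: "rate k \<longlonglongrightarrow> l"
      and \<phi>: "fo_sentence \<phi>" for k l \<phi>
  proof -
    have "filterlim (ts.rate (k - 1)) at_top sequentially"
      unfolding rate_Suc by (rule filterlim_compose[OF top filterlim_Suc])
    moreover have "ts.rate k \<longlonglongrightarrow> l"
      unfolding rate_Suc using l by (rule LIMSEQ_Suc)
    ultimately have "convergent (\<lambda>n. fo_prob (X (Suc n)) \<phi>)"
      "l = 0 \<Longrightarrow> \<exists>x\<in>{0, 1}. (\<lambda>n. fo_prob (X (Suc n)) \<phi>) \<longlonglongrightarrow> x"
      unfolding prob using ts.sentence_limit[OF _ _ k \<phi>] by blast+
    then show "convergent (\<lambda>L. fo_prob (X L) \<phi>)"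
      "l = 0 \<Longrightarrow> \<exists>x\<in>{0, 1}. (\<lambda>L. fo_prob (X L) \<phi>) \<longlonglongrightarrow> x"
      using LIMSEQ_imp_Suc[of "\<lambda>L. fo_prob (X L) \<phi>"] by (auto simp: convergent_def)
  qed
  have zero_one: "fo_zero_one_law X"
    if "k \<ge> 1" "filterlim (rate (k - 1)) at_top sequentially" "rate k \<longlonglongrightarrow> 0" for k
    unfolding fo_zero_one_law_def using conv(2)[OF that] by blast
  show ?thesis
    unfolding rate_def[symmetric]
  proof (intro conjI impI allI)
    assume \<alpha>k: "\<alpha> \<notin> {1 / real k | k :: nat. k \<ge> 1}"
    define k where "k = nat \<lceil>1 / \<alpha>\<rceil>"
    have pos: "1 / \<alpha> > 0" using \<alpha> by simp
    have c1: "\<lceil>1 / \<alpha>\<rceil> \<ge> 1" using pos by (simp add: le_ceiling_iff)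
    then have k: "k \<ge> 1" "real k = of_int \<lceil>1 / \<alpha>\<rceil>" unfolding k_def by linarith+
    have "real k \<ge> 1 / \<alpha>" "real k - 1 < 1 / \<alpha>"
      using le_of_int_ceiling[of "1 / \<alpha>"] ceiling_correct[of "1 / \<alpha>"] k(2) by auto
    moreover have "real k \<noteq> 1 / \<alpha>"
    proof
      assume "real k = 1 / \<alpha>"
      then have "\<alpha> = 1 / real k" using \<alpha> by simp
      then show False using \<alpha>k k(1) by auto
    qed
    ultimately have "\<alpha> * real k > 1" "\<alpha> * real (k - 1) < 1"
      using \<alpha> k(1) by (auto simp: field_simps)
    then show "fo_zero_one_law X"
      using zero_one[OF k(1)] decay_rate[OF d1] by blast
  next
    fix k :: nat assume "k \<ge> 1 \<and> \<alpha> = 1 / real k"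
    then have k: "k \<ge> 1" "\<alpha> = 1 / real k" by auto
    have \<alpha>k: "\<alpha> * real k = 1" using k by simp
    then have "\<alpha> * real (k - 1) < 1" using \<alpha> k(1) by (simp add: of_nat_diff right_diff_distrib)
    then have top: "filterlim (rate (k - 1)) at_top sequentially" by (rule decay_rate(1)[OF d1])
    have "\<alpha> * real (Suc k) > 1" using \<alpha>k \<alpha> by (simp add: distrib_left)
    then have bot: "rate (Suc k) \<longlonglongrightarrow> 0" by (rule decay_rate(2)[OF d1])
    obtain \<phi> c where \<phi>: "fo_sentence \<phi>" and c: "c > (0::real)"
      and lim: "\<forall>L r. torus_sequence d L r \<longrightarrow>
        (\<forall>l. (\<lambda>n. real (L n ^ d) * r n ^ k) \<longlonglongrightarrow> l \<longrightarrow>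
          (\<lambda>n. subset_prob (E (L n)) (r n) {S. fo_models (marked_graph (L n) keep S) \<phi>})
            \<longlonglongrightarrow> 1 - exp (- (c * l))) \<and>
        (filterlim (\<lambda>n. real (L n ^ d) * r n ^ k) at_top sequentially \<longrightarrow>
          (\<lambda>n. subset_prob (E (L n)) (r n) {S. fo_models (marked_graph (L n) keep S) \<phi>})
            \<longlonglongrightarrow> 1)"
      using critical_sentence[OF k(1), of keep] by (elim exE conjE)
    have sub: "(\<lambda>n. fo_prob (X (Suc (\<sigma> n))) \<phi>) \<longlonglongrightarrow> 1 - exp (- (c * l))"
      if "filterlim \<sigma> at_top sequentially" "(\<lambda>n. rate k (Suc (\<sigma> n))) \<longlonglongrightarrow> l" for \<sigma> l
      using lim[rule_format, OF torus_sequence_subsequence[OF range \<rho>0 that(1)]] that(2) X by (simp add: rate_def)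
    have sub_top: "(\<lambda>n. fo_prob (X (Suc (\<sigma> n))) \<phi>) \<longlonglongrightarrow> 1"
      if "filterlim \<sigma> at_top sequentially" "filterlim (\<lambda>n. rate k (Suc (\<sigma> n))) at_top sequentially" for \<sigma>
      using lim[rule_format, OF torus_sequence_subsequence[OF range \<rho>0 that(1)]] that(2) X by (simp add: rate_def)
    show "fo_zero_one_law X" if "rate k \<longlonglongrightarrow> 0 \<or> filterlim (rate k) at_top sequentially"
      using that zero_one[OF k(1) top] zero_one[of "Suc k"] bot by auto
    show "fo_convergence_law X" if "\<Lambda> > 0 \<and> rate k \<longlonglongrightarrow> \<Lambda>" for \<Lambda>
      using conv(1)[OF k(1) top] that unfolding fo_convergence_law_def by blast
    show "\<not> fo_zero_one_law X" if "\<Lambda> > 0 \<and> rate k \<longlonglongrightarrow> \<Lambda>" for \<Lambda>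
    proof
      assume "fo_zero_one_law X"
      then obtain x where x: "x \<in> {0, 1}" "(\<lambda>L. fo_prob (X L) \<phi>) \<longlonglongrightarrow> x"
        using \<phi> by (auto simp: fo_zero_one_law_def)
      have "(\<lambda>n. fo_prob (X (Suc n)) \<phi>) \<longlonglongrightarrow> 1 - exp (- (c * \<Lambda>))"
        by (rule sub[OF filterlim_ident]) (use that LIMSEQ_Suc in blast)
      then have "x = 1 - exp (- (c * \<Lambda>))" using LIMSEQ_Suc[OF x(2)] LIMSEQ_unique by blast
      moreover have "exp (- (c * \<Lambda>)) < 1" using c that by simp
      ultimately show False using x(1) by auto
    qed
    show "\<not> fo_convergence_law X" if no: "\<not> (\<exists>l\<in>{0..\<infinity>::ereal}. (\<lambda>L. ereal (rate k L)) \<longlonglongrightarrow> l)"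
    proof
      assume "fo_convergence_law X"
      then obtain x where x: "(\<lambda>L. fo_prob (X L) \<phi>) \<longlonglongrightarrow> x"
        using \<phi> by (auto simp: fo_convergence_law_def convergent_def)
      define u where "u n = ereal (rate k (Suc n))" for n
      define g where "g l = (if l = \<infinity> then 1 else 1 - exp (- (c * real_of_ereal l)))" for l
      have nonneg: "rate k (Suc n) \<ge> 0" for n using range[of "Suc n"] by (simp add: rate_def)
      have limit_value: "l \<ge> 0 \<and> x = g l" if \<sigma>: "strict_mono \<sigma>" and l: "(u \<circ> \<sigma>) \<longlonglongrightarrow> l" for \<sigma> l
      proof -
        have \<sigma>_top: "filterlim \<sigma> at_top sequentially" using \<sigma> by (rule filterlim_subseq)
        have "(\<lambda>n. fo_prob (X (Suc (\<sigma> n))) \<phi>) \<longlonglongrightarrow> x"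
          using filterlim_compose[OF LIMSEQ_Suc[OF x] \<sigma>_top] .
        note same = LIMSEQ_unique[OF this]
        have l0: "l \<ge> 0"
          by (rule tendsto_lowerbound[OF l]) (auto simp: u_def nonneg)
        show ?thesis
        proof (cases l)
          case (real y)
          then have "(\<lambda>n. rate k (Suc (\<sigma> n))) \<longlonglongrightarrow> y" using l by (simp add: u_def o_def)
          then show ?thesis using same[OF sub[OF \<sigma>_top]] l0 real by (simp add: g_def)
        next
          case PInf
          then have "filterlim (\<lambda>n. rate k (Suc (\<sigma> n))) at_top sequentially"
            using l by (simp add: u_def o_def tendsto_PInfty_eq_at_top)
          then show ?thesis using same[OF sub_top[OF \<sigma>_top]] l0 PInf by (simp add: g_def)
        next
          case MInf
          then show ?thesis using l0 by simp
        qed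
      qed
      obtain \<sigma>1 \<sigma>2 where "strict_mono \<sigma>1" "(u \<circ> \<sigma>1) \<longlonglongrightarrow> limsup u" "strict_mono \<sigma>2" "(u \<circ> \<sigma>2) \<longlonglongrightarrow> liminf u"
        using limsup_subseq_lim[of u] liminf_subseq_lim[of u] by blast
      then have v: "limsup u \<ge> 0" "x = g (limsup u)" "liminf u \<ge> 0" "x = g (liminf u)"
        using limit_value by blast+
      have inj: "a = b" if "a \<ge> 0" "b \<ge> 0" "g a = g b" for a b
        using that c by (cases a; cases b) (auto simp: g_def split: if_splits)
      have eq: "limsup u = liminf u" using v by (intro inj) auto
      then have "u \<longlonglongrightarrow> limsup u" by (intro Liminf_eq_Limsup) auto
      then have "(\<lambda>L. ereal (rate k L)) \<longlonglongrightarrow> limsup u"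
        unfolding u_def by (rule LIMSEQ_imp_Suc)
      then show False using no v(1) by auto
    qed
  qed
qed

end

theorem theorem1p4:
  fixes d :: nat and q p :: "nat \<Rightarrow> real" and \<alpha> :: real
    and X :: "nat \<Rightarrow> (nat \<Rightarrow> nat) graph pmf"
  assumes "d \<ge> 2"
    and "\<And>L. L \<ge> 1 \<Longrightarrow> q (L ^ d) \<in> {0..1}"
    and "\<And>N. p N = 1 - q N"
    and "\<And>L. X L = torus_percolation d L (q (L ^ d))"
    and "\<alpha> > 0"
  shows "((\<lambda>L. p (L ^ d)) \<longlonglongrightarrow> 0 \<and> (\<lambda>L. q (L ^ d)) \<longlonglongrightarrow> 1 \<and> power_decay d p \<alpha> \<longrightarrow>
           (\<alpha> \<notin> {1 / real k | k :: nat. k \<ge> 1} \<longrightarrow> fo_zero_one_law X) \<and>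
           (\<forall>k::nat. k \<ge> 1 \<and> \<alpha> = 1 / real k \<longrightarrow>
              ((\<lambda>L. real (L ^ d) * p (L ^ d) ^ k) \<longlonglongrightarrow> 0 \<or>
               filterlim (\<lambda>L. real (L ^ d) * p (L ^ d) ^ k) at_top sequentially \<longrightarrow>
                 fo_zero_one_law X) \<and>
              (\<forall>\<Lambda>::real. \<Lambda> > 0 \<and> (\<lambda>L. real (L ^ d) * p (L ^ d) ^ k) \<longlonglongrightarrow> \<Lambda> \<longrightarrow>
                 fo_convergence_law X \<and> \<not> fo_zero_one_law X) \<and>
              (\<not> (\<exists>l\<in>{0..\<infinity>::ereal}. (\<lambda>L. ereal (real (L ^ d) * p (L ^ d) ^ k)) \<longlonglongrightarrow> l) \<longrightarrow>
                 \<not> fo_convergence_law X)))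
       \<and> ((\<lambda>L. q (L ^ d)) \<longlonglongrightarrow> 0 \<and> (\<lambda>L. p (L ^ d)) \<longlonglongrightarrow> 1 \<and> power_decay d q \<alpha> \<longrightarrow>
           (\<alpha> \<notin> {1 / real k | k :: nat. k \<ge> 1} \<longrightarrow> fo_zero_one_law X) \<and>
           (\<forall>k::nat. k \<ge> 1 \<and> \<alpha> = 1 / real k \<longrightarrow>
              ((\<lambda>L. real (L ^ d) * q (L ^ d) ^ k) \<longlonglongrightarrow> 0 \<or>
               filterlim (\<lambda>L. real (L ^ d) * q (L ^ d) ^ k) at_top sequentially \<longrightarrow>
                 fo_zero_one_law X) \<and>
              (\<forall>\<Lambda>::real. \<Lambda> > 0 \<and> (\<lambda>L. real (L ^ d) * q (L ^ d) ^ k) \<longlonglongrightarrow> \<Lambda> \<longrightarrow>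
                 fo_convergence_law X \<and> \<not> fo_zero_one_law X) \<and>
              (\<not> (\<exists>l\<in>{0..\<infinity>::ereal}. (\<lambda>L. ereal (real (L ^ d) * q (L ^ d) ^ k)) \<longlonglongrightarrow> l) \<longrightarrow>
                 \<not> fo_convergence_law X)))"
proof -
  interpret torus d by standard (rule assms(1))
  have q: "0 \<le> q (L ^ d)" "q (L ^ d) \<le> 1" if "L \<ge> 1" for L using assms(2)[OF that] by auto
  show ?thesis
  proof (intro conjI[of "_ \<longrightarrow> _" "_ \<longrightarrow> _"] impI, goal_cases)
    case 1
    show ?case
    proof (rule four_alternatives)
      show "p (L ^ d) \<in> {0..1}" if "L \<ge> 1" for L using q[OF that] assms(3) by simp
      show "fo_prob (X L) \<phi> = subset_prob (E L) (p (L ^ d)) {S. fo_models (marked_graph L False S) \<phi>}"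
        if "L \<ge> 1" for L \<phi>
        unfolding assms(3,4) by (rule fo_prob_deleted[OF q[OF that]])
    qed (use 1 assms(5) in auto)
  next
    case 2
    show ?case
    proof (rule four_alternatives)
      show "q (L ^ d) \<in> {0..1}" if "L \<ge> 1" for L using assms(2)[OF that] .
      show "fo_prob (X L) \<phi> = subset_prob (E L) (q (L ^ d)) {S. fo_models (marked_graph L True S) \<phi>}"
        if "L \<ge> 1" for L \<phi>
        unfolding assms(4) by (rule fo_prob_retained)
    qed (use 2 assms(5) in auto)
  qed
qed

end
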